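(* Let $V$ be an $n$-dimensional left vector space over a division ring $K$, $2\le n<\infty$, let $k\in\{1,\dots,n-1\}$, and let $\mathcal G=\{(S,U)\in\mathcal G_k\times\mathcal G_{n-k}\mid S+U=V\}$. Every closeness preserving transformation of $\mathcal G$ is one of the following mappings: (1) the restriction to $\mathcal G$ of $G_k(l)\times G_{n-k}(l)$ for some semilinear isomorphism $l:V\to V$; (2) the restriction to $\mathcal G$ of $D_k(s)\mathbin{\dot\times} D_{n-k}(s)$ for some semilinear isomorphism $s:V\to V^*$; (3) only when $n=2k$: the restriction to $\mathcal G$ of $G_k(l)\mathbin{\dot\times}G_k(l)$ for some semilinear isomorphism $l:V\to V$, or of $D_k(s)\times D_k(s)$ for some semilinear isomorphism $s:V\to V^*$; (4) only when $n=2$ and $k=1$: the restriction to $\mathcal G$ of $f\times f$ or of $f\mathbin{\dot\times}f$ for some bijection $f:\mathcal G_1\to\mathcal G_1$. Hence every closeness preserving transformation of $\mathcal G$ is an adjacency preserving transformation of $\mathcal G$.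
   Context: $\mathcal G_i$ denotes the set of all $i$-dimensional subspaces of $V$. Subspaces $P,T$ of $V$ are adjacent, $P\sim T$, if $\dim P=\dim T=\dim(P\cap T)+1$. Elements $(S,U),(S',U')\in\mathcal G$ are adjacent if ($S=S'$ and $U\sim U'$) or ($S\sim S'$ and $U=U'$); they are close if ($S=S'$ and $U\ne U'$) or ($S\neq S'$ and $U=U'$). A bijection $f:\mathcal G\to\mathcal G$ is an adjacency preserving (respectively closeness preserving) transformation if both $f$ and $f^{-1}$ map adjacent (respectively close) elements to adjacent (respectively close) elements. For maps $f':\mathcal G_k\to\mathcal G_k$, $f'':\mathcal G_{n-k}\to\mathcal G_{n-k}$, the map $f'\times f''$ on $\mathcal G_k\times\mathcal G_{n-k}$ is $(S,U)\mapsto(f'(S),f''(U))$. For maps $g':\mathcal G_k\to\mathcal G_{n-k}$, $g'':\mathcal G_{n-k}\to\mathcal G_k$, the map $g'\mathbin{\dot\times}g''$ on $\mathcal G_k\times\mathcal G_{n-k}$ is $(S,U)\mapsto(g''(U),g'(S))$. A semilinear isomorphism $l:V\to V$ is an additive bijection with $l(av)=\sigma(a)l(v)$ for some automorphism $\sigma$ of $K$. $V^*$ is the dual space of $V$ (a right vector space over $K$); a semilinear isomorphism $s:V\to V^*$ is an additive bijection with $s(av)=s(v)\tau(a)$ for some anti-automorphism $\tau$ of $K$. For $1\le i\le n-1$, $G_i(l):\mathcal G_i\to\mathcal G_i$ is $S\mapsto l(S)$, and $D_i(s):\mathcal G_i\to\mathcal G_{n-i}$ is $S\mapsto (s(S))^\circ$,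 where $(s(S))^\circ\subset V$ is the annihilator of $s(S)$, i.e. the set of vectors on which all functionals in $s(S)$ vanish. *)

theory Defs
  imports Main
begin

(* The library's module and vector_space locales require commutative scalars.  The locale below
   has a division ring of scalars; the basic notions have the same definitions as in those
   locales. *)

locale left_vector_space =
  fixes scale :: "'k::division_ring \<Rightarrow> 'v::ab_group_add \<Rightarrow> 'v" (infixr \<open>*s\<close> 75)
  assumes scale_right_distrib: "a *s (x + y) = a *s x + a *s y"
    and scale_left_distrib: "(a + b) *s x = a *s x + b *s x"
    and scale_scale: "a *s (b *s x) = (a * b) *s x"
    and scale_one: "1 *s x = x"

definition ring_automorphism :: "('k::ring_1 \<Rightarrow> 'k) \<Rightarrow> bool" where
  "ring_automorphism \<sigma> \<longleftrightarrow> bij \<sigma> \<and> \<sigma> 1 = 1 \<and>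
     (\<forall>a b. \<sigma> (a + b) = \<sigma> a + \<sigma> b) \<and> (\<forall>a b. \<sigma> (a * b) = \<sigma> a * \<sigma> b)"

definition ring_anti_automorphism :: "('k::ring_1 \<Rightarrow> 'k) \<Rightarrow> bool" where
  "ring_anti_automorphism \<tau> \<longleftrightarrow> bij \<tau> \<and> \<tau> 1 = 1 \<and>
     (\<forall>a b. \<tau> (a + b) = \<tau> a + \<tau> b) \<and> (\<forall>a b. \<tau> (a * b) = \<tau> b * \<tau> a)"

definition cross_prod :: "('a \<Rightarrow> 'b) \<Rightarrow> ('b \<Rightarrow> 'a) \<Rightarrow> 'a \<times> 'b \<Rightarrow> 'a \<times> 'b"
    (infixr \<open>\<times>\<^sub>d\<close> 70) where
  "g' \<times>\<^sub>d g'' = (\<lambda>(S, U). (g'' U, g' S))"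

definition preserving_transformation :: "('a \<Rightarrow> 'a \<Rightarrow> bool) \<Rightarrow> 'a set \<Rightarrow> ('a \<Rightarrow> 'a) \<Rightarrow> bool" where
  "preserving_transformation R A f \<longleftrightarrow> bij_betw f A A \<and>
     (\<forall>x\<in>A. \<forall>y\<in>A. R x y \<longrightarrow> R (f x) (f y)) \<and>
     (\<forall>x\<in>A. \<forall>y\<in>A. R x y \<longrightarrow> R (inv_into A f x) (inv_into A f y))"

(* Maps between sets of subspaces are total functions on all sets of vectors; this predicate says
   that f is the restriction of h to A, values outside A being irrelevant. *)
definition is_restriction :: "('a \<Rightarrow> 'b) \<Rightarrow> 'a set \<Rightarrow> ('a \<Rightarrow> 'b) \<Rightarrow> bool" where
  "is_restriction f A h \<longleftrightarrow> (\<forall>x\<in>A. f x = h x)"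

definition close_pairs :: "'a \<times> 'b \<Rightarrow> 'a \<times> 'b \<Rightarrow> bool" where
  "close_pairs = (\<lambda>(S, U) (S', U'). (S = S' \<and> U \<noteq> U') \<or> (S \<noteq> S' \<and> U = U'))"

definition annihilator :: "('v \<Rightarrow> 'k::zero) set \<Rightarrow> 'v set" where
  "annihilator F = {v. \<forall>\<phi>\<in>F. \<phi> v = 0}"

(* The defining formulas of G_i(l) and D_i(s) do not involve i, so each is a single function on
   sets of vectors, used on the Grassmannian of the relevant dimension. *)
definition G_map :: "('v \<Rightarrow> 'v) \<Rightarrow> 'v set \<Rightarrow> 'v set" where
  "G_map l S = l ` S"

definition D_map :: "('v \<Rightarrow> 'v \<Rightarrow> 'k::zero) \<Rightarrow> 'v set \<Rightarrow> 'v set" where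
  "D_map s S = annihilator (s ` S)"

context left_vector_space
begin

definition subspace :: "'v set \<Rightarrow> bool" where
  "subspace S \<longleftrightarrow> 0 \<in> S \<and> (\<forall>x\<in>S. \<forall>y\<in>S. x + y \<in> S) \<and> (\<forall>c. \<forall>x\<in>S. c *s x \<in> S)"

definition span :: "'v set \<Rightarrow> 'v set" where
  "span B = {(\<Sum>a\<in>T. r a *s a) | T r. finite T \<and> T \<subseteq> B}"

definition independent :: "'v set \<Rightarrow> bool" where
  "independent B \<longleftrightarrow>
     (\<forall>T u. finite T \<and> T \<subseteq> B \<and> (\<Sum>v\<in>T. u v *s v) = 0 \<longrightarrow> (\<forall>v\<in>T. u v = 0))"

(* As for the library's dim, infinite-dimensional spaces get the value 0. *)
definition dim :: "'v set \<Rightarrow> nat" where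
  "dim S = (if \<exists>B. independent B \<and> span B = span S
            then card (SOME B. independent B \<and> span B = span S) else 0)"

definition grassmannian :: "nat \<Rightarrow> 'v set set" where
  "grassmannian i = {S. subspace S \<and> dim S = i}"

definition subspace_adjacent :: "'v set \<Rightarrow> 'v set \<Rightarrow> bool" where
  "subspace_adjacent P T \<longleftrightarrow> dim P = dim T \<and> dim T = dim (P \<inter> T) + 1"

definition complementary_pairs :: "nat \<Rightarrow> ('v set \<times> 'v set) set" where
  "complementary_pairs k =
     {(S, U). S \<in> grassmannian k \<and> U \<in> grassmannian (dim UNIV - k) \<and>
              {x + y | x y. x \<in> S \<and> y \<in> U} = UNIV}"

definition adjacent :: "'v set \<times> 'v set \<Rightarrow> 'v set \<times> 'v set \<Rightarrow> bool" where
  "adjacent = (\<lambda>(S, U) (S', U').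
     (S = S' \<and> subspace_adjacent U U') \<or> (subspace_adjacent S S' \<and> U = U'))"

definition semilinear_iso :: "('v \<Rightarrow> 'v) \<Rightarrow> bool" where
  "semilinear_iso l \<longleftrightarrow> bij l \<and> (\<forall>u v. l (u + v) = l u + l v) \<and>
     (\<exists>\<sigma>. ring_automorphism \<sigma> \<and> (\<forall>a v. l (a *s v) = \<sigma> a *s l v))"

definition dual :: "('v \<Rightarrow> 'k) set" where
  "dual = {\<phi>. (\<forall>u v. \<phi> (u + v) = \<phi> u + \<phi> v) \<and> (\<forall>a v. \<phi> (a *s v) = a * \<phi> v)}"

(* The dual is a right vector space: addition is pointwise and the product of a functional \<phi>
   with a scalar c is \<lambda>x. \<phi> x * c. *)
definition semilinear_iso_dual :: "('v \<Rightarrow> 'v \<Rightarrow> 'k) \<Rightarrow> bool" where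
  "semilinear_iso_dual s \<longleftrightarrow> bij_betw s UNIV dual \<and>
     (\<forall>u v. s (u + v) = (\<lambda>x. s u x + s v x)) \<and>
     (\<exists>\<tau>. ring_anti_automorphism \<tau> \<and> (\<forall>a v. s (a *s v) = (\<lambda>x. s v x * \<tau> a)))"

end

end

theory Submission
  imports Defs
begin

text \<open>Write \<open>Gr k\<close> for the set of \<open>k\<close>-dimensional subspaces.  The pairs with a fixed first component, and
those with a fixed second component, are the rows and columns of the closeness relation, and they
are its maximal cliques.  A closeness preserving bijection permutes these cliques.  Two elements of
a Grassmannian always have a common complement, so any two rows meet a common column, and therefore
either all rows go to rows or all rows go to columns (\<open>closeness_preserving_splits\<close>).  Thus the
transformation consists of two bijections that preserve and reflect complementarity, \<open>a\<close> defined on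
\<open>Gr k\<close> and \<open>b\<close> defined on \<open>Gr (n - k)\<close>; when rows go to columns, these two Grassmannians are
exchanged.

Complementarity determines adjacency, and even the pencils, that is, the sets of all \<open>R\<close> in \<open>Gr k\<close>
with \<open>S \<inter> T \<subseteq> R \<subseteq> S \<oplus> T\<close> for adjacent \<open>S\<close> and \<open>T\<close>: for \<open>R\<close> distinct from \<open>S\<close> and \<open>T\<close>, it
is the case that \<open>S\<close> and \<open>T\<close> are adjacent and \<open>R\<close> is on their pencil if and only if every complement
of \<open>R\<close> is a complement of \<open>S\<close> or of \<open>T\<close> (\<open>pencil_iff_complements\<close>).  Hence \<open>a\<close> and \<open>b\<close> preserve adjacency, and this already gives the last
assertion of the theorem.

The rest is Chow's theorem.  The triangles of \<open>Gr k\<close>, three pairwise adjacent elements that are not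
on a pencil, are of two kinds: they have a common intersection of dimension \<open>k - 1\<close> (they lie in a
star) or a common sum of dimension \<open>k + 1\<close> (they lie in a top).  The map \<open>a\<close> either preserves the two
kinds everywhere or interchanges them everywhere (\<open>straight_or_twisted_everywhere\<close>).  If it
interchanges them, it is replaced by its composition with a duality from \<open>V\<close> onto its dual space.  If
it preserves them, then it maps stars to stars, and so it induces a map on \<open>Gr (k - 1)\<close> that again
preserves stars.  Continuing downwards, one arrives at a collineation of the points
(\<open>straight_induced_by_points\<close>), and the fundamental theorem of projective geometry
(\<open>fundamental_theorem\<close>) provides a semilinear map.  A subspace is determined by its complements, so
\<open>b\<close> is induced by the same map (\<open>second_map_determined\<close>).  For \<open>n = 2\<close>, complementary means distinct,
and the pair consists of two copies of one arbitrary bijection of the points.\<close>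

section \<open>Linear algebra over a division ring\<close>

definition ssum :: "'v::plus set \<Rightarrow> 'v set \<Rightarrow> 'v set" (infixl \<open>\<oplus>\<close> 65) where
  "S \<oplus> U = {x + y | x y. x \<in> S \<and> y \<in> U}"

lemma ssum_mono: "S \<subseteq> S' \<Longrightarrow> U \<subseteq> U' \<Longrightarrow> S \<oplus> U \<subseteq> S' \<oplus> U'"
  unfolding ssum_def by blast

lemma ssum_commute: "S \<oplus> U = U \<oplus> (S :: 'v::ab_semigroup_add set)"
  unfolding ssum_def by (auto; metis add.commute)

lemma ssum_assoc: "(S \<oplus> U) \<oplus> W = S \<oplus> (U \<oplus> (W :: 'v::ab_semigroup_add set))"
  unfolding ssum_def by (auto; metis add.assoc)

lemma ssumI: "x \<in> S \<Longrightarrow> y \<in> U \<Longrightarrow> x + y \<in> S \<oplus> U"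
  unfolding ssum_def by blast

lemma ssumE:
  assumes "z \<in> S \<oplus> U"
  obtains x y where "x \<in> S" "y \<in> U" "z = x + y"
  using assms unfolding ssum_def by blast

context left_vector_space
begin

abbreviation Gr :: "nat \<Rightarrow> 'v set set" where
  "Gr \<equiv> grassmannian"

lemma scale_zero_left [simp]: "0 *s x = 0"
  using scale_left_distrib[of 0 0 x] by simp

lemma scale_zero_right [simp]: "a *s 0 = 0"
  using scale_right_distrib[of a 0 0] by simp

lemma scale_minus_left: "(- a) *s x = - (a *s x)"
  using scale_left_distrib[of a "- a" x] by (simp add: eq_neg_iff_add_eq_0 add.commute)

lemma scale_minus_right: "a *s (- x) = - (a *s x)"
  using scale_right_distrib[of a x "- x"] by (simp add: eq_neg_iff_add_eq_0 add.commute)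

lemma scale_right_diff: "a *s (x - y) = a *s x - a *s y"
  using scale_right_distrib[of a x "- y"] by (simp add: scale_minus_right)

lemma scale_left_diff: "(a - b) *s x = a *s x - b *s x"
  using scale_left_distrib[of a "- b" x] by (simp add: scale_minus_left)

lemma scale_inverse_left: "a \<noteq> 0 \<Longrightarrow> inverse a *s a *s x = x"
  by (simp add: scale_scale scale_one)

lemma scale_eq_0_iff: "a *s x = 0 \<longleftrightarrow> a = 0 \<or> x = 0"
  by (metis scale_inverse_left scale_zero_left scale_zero_right)

lemma scale_right_sum: "a *s (\<Sum>i\<in>T. g i) = (\<Sum>i\<in>T. a *s g i)"
  by (induction T rule: infinite_finite_induct) (simp_all add: scale_right_distrib)

definition line :: "'v \<Rightarrow> 'v set" where
  "line v = range (\<lambda>a. a *s v)"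

lemma line_mem [simp]: "a *s v \<in> line v"
  unfolding line_def by blast

lemma line_self [simp]: "v \<in> line v"
  using line_mem[of 1 v] by (simp add: scale_one)

lemma line_memE:
  assumes "x \<in> line v" obtains a where "x = a *s v"
  using assms unfolding line_def by blast

lemma subspace_0: "subspace S \<Longrightarrow> 0 \<in> S"
  and subspace_add: "subspace S \<Longrightarrow> x \<in> S \<Longrightarrow> y \<in> S \<Longrightarrow> x + y \<in> S"
  and subspace_scale: "subspace S \<Longrightarrow> x \<in> S \<Longrightarrow> a *s x \<in> S"
  unfolding subspace_def by blast+

lemma subspace_neg: "subspace S \<Longrightarrow> x \<in> S \<Longrightarrow> - x \<in> S"
  using subspace_scale[of S x "-1"] by (simp add: scale_minus_left scale_one)

lemma subspace_diff: "subspace S \<Longrightarrow> x \<in> S \<Longrightarrow> y \<in> S \<Longrightarrow> x - y \<in> S"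
  using subspace_add[of S x "- y"] subspace_neg by simp

lemma subspace_scale_iff: "subspace S \<Longrightarrow> a \<noteq> 0 \<Longrightarrow> a *s x \<in> S \<longleftrightarrow> x \<in> S"
  by (metis scale_inverse_left subspace_scale)

lemma subspace_add_iff: "subspace S \<Longrightarrow> x \<in> S \<Longrightarrow> x + y \<in> S \<longleftrightarrow> y \<in> S"
  by (metis add_diff_cancel_left' subspace_add subspace_diff)

lemma subspace_add_iff2: "subspace S \<Longrightarrow> y \<in> S \<Longrightarrow> x + y \<in> S \<longleftrightarrow> x \<in> S"
  by (metis add.commute subspace_add_iff)

lemma subspace_zero [simp]: "subspace {0}"
  unfolding subspace_def by simp

lemma subspace_UNIV [simp]: "subspace UNIV"
  unfolding subspace_def by simp

lemma subspace_Int [simp]: "subspace S \<Longrightarrow> subspace U \<Longrightarrow> subspace (S \<inter> U)"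
  unfolding subspace_def by blast

lemma subspace_line [simp]: "subspace (line v)"
proof -
  have "a *s v + b *s v \<in> line v" for a b
    by (metis line_mem scale_left_distrib)
  moreover have "c *s a *s v \<in> line v" for a c
    by (simp add: scale_scale)
  moreover have "0 \<in> line v"
    using line_mem[of 0 v] by simp
  ultimately show ?thesis
    unfolding subspace_def by (auto elim!: line_memE)
qed

lemma subspace_ssum [simp]:
  assumes S: "subspace S" and U: "subspace U"
  shows "subspace (S \<oplus> U)"
  unfolding subspace_def
proof (intro conjI ballI allI)
  show "0 \<in> S \<oplus> U"
    using ssumI[OF subspace_0[OF S] subspace_0[OF U]] by simp
next
  fix x y assume "x \<in> S \<oplus> U" "y \<in> S \<oplus> U"
  then obtain a b c d where "a \<in> S" "b \<in> U" "x = a + b" "c \<in> S" "d \<in> U" "y = c + d"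
    by (elim ssumE)
  then show "x + y \<in> S \<oplus> U"
    using ssumI[OF subspace_add[OF S, of a c] subspace_add[OF U, of b d]]
    by (simp add: algebra_simps)
next
  fix c x assume "x \<in> S \<oplus> U"
  then obtain a b where "a \<in> S" "b \<in> U" "x = a + b"
    by (elim ssumE)
  then show "c *s x \<in> S \<oplus> U"
    using ssumI[OF subspace_scale[OF S, of a c] subspace_scale[OF U, of b c]]
    by (simp add: scale_right_distrib)
qed

lemma ssum_upper1: "subspace U \<Longrightarrow> S \<subseteq> S \<oplus> U"
  using ssumI[of _ S 0 U] subspace_0[of U] by fastforce

lemma ssum_upper2: "subspace S \<Longrightarrow> U \<subseteq> S \<oplus> U"
  using ssum_upper1 ssum_commute by metis

lemma ssum_least: "subspace W \<Longrightarrow> S \<subseteq> W \<Longrightarrow> U \<subseteq> W \<Longrightarrow> S \<oplus> U \<subseteq> W"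
  by (auto elim!: ssumE intro: subspace_add)

lemma ssum_absorb: "subspace S \<Longrightarrow> subspace U \<Longrightarrow> U \<subseteq> S \<Longrightarrow> S \<oplus> U = S"
  by (simp add: ssum_least ssum_upper1 subset_antisym)

lemma line_least: "subspace W \<Longrightarrow> line v \<subseteq> W \<longleftrightarrow> v \<in> W"
  by (auto elim!: line_memE intro: subspace_scale)

lemma ssum_line_least: "subspace W \<Longrightarrow> S \<subseteq> W \<Longrightarrow> v \<in> W \<Longrightarrow> S \<oplus> line v \<subseteq> W"
  by (simp add: line_least ssum_least)

lemma ssum_line_self: "subspace S \<Longrightarrow> v \<in> S \<oplus> line v"
  using ssum_upper2 line_self by blast

lemma zero_ssum: "{0} \<oplus> S = (S :: 'v set)"
  unfolding ssum_def by simp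

lemma line_0 [simp]: "line 0 = {0}"
  unfolding line_def by auto

text \<open>The coefficient of \<open>v\<close> in \<open>w\<close> is not zero, so \<open>v\<close> can be expressed by \<open>w\<close> and \<open>S\<close>.\<close>

lemma ssum_line_exchange:
  assumes S: "subspace S" and w: "w \<in> S \<oplus> line v" and "w \<notin> S"
  shows "S \<oplus> line w = S \<oplus> line v"
proof -
  obtain s a where s: "s \<in> S" and ws: "w = s + a *s v"
    using w by (auto elim!: ssumE line_memE)
  have a: "a \<noteq> 0"
    using assms(3) s ws by auto
  have "v = - (inverse a *s s) + inverse a *s w"
    using scale_inverse_left[OF a, of v] by (simp add: ws scale_right_distrib)
  then have "v \<in> S \<oplus> line w"
    by (metis S line_mem s ssumI subspace_neg subspace_scale)
  then show ?thesis
    using w by (meson S ssum_line_least ssum_upper1 subset_antisym subspace_line subspace_ssum)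
qed

text \<open>The rank of a subspace is the number of vectors adjoined to the zero space one after another,
  each outside the span of the preceding ones.  Dealing with subspaces instead of bases makes the
  invariance of this number a statement about chains of subspaces.\<close>

inductive rank :: "'v set \<Rightarrow> nat \<Rightarrow> bool" where
  rank_0: "rank {0} 0"
| rank_Suc: "rank S d \<Longrightarrow> v \<notin> S \<Longrightarrow> rank (S \<oplus> line v) (Suc d)"

lemma rank_subspace: "rank S d \<Longrightarrow> subspace S"
  by (induction rule: rank.induct) auto

text \<open>If \<open>S\<close> contains a vector outside \<open>T\<close>, then the modular law makes \<open>S\<close> the sum of \<open>S \<inter> T\<close> and
the line of this vector, and induction applies to \<open>S \<inter> T\<close>.\<close>

lemma rank_of_subset:
  assumes "rank T d" "subspace S" "S \<subseteq> T"
  shows "\<exists>e. rank S e \<and> e \<le> d \<and> (S \<noteq> T \<longrightarrow> e < d)"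
  using assms
proof (induction arbitrary: S rule: rank.induct)
  case rank_0
  then have "S = {0}"
    using subspace_0 by blast
  then show ?case
    using rank.rank_0 by blast
next
  case (rank_Suc T d v)
  have T: "subspace T"
    using rank_Suc.hyps(1) by (rule rank_subspace)
  show ?case
  proof (cases "S \<subseteq> T")
    case True
    then obtain e where "rank S e" "e \<le> d"
      using rank_Suc.IH rank_Suc.prems(1) by blast
    then show ?thesis
      by (meson le_SucI le_imp_less_Suc)
  next
    case False
    then obtain s where s: "s \<in> S" "s \<notin> T"
      by blast
    have ex: "T \<oplus> line s = T \<oplus> line v"
      using ssum_line_exchange[OF T _ s(2)] s(1) rank_Suc.prems(2) by blast
    obtain e where e: "rank (S \<inter> T) e" "e \<le> d" "S \<inter> T \<noteq> T \<longrightarrow> e < d"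
      using rank_Suc.IH[of "S \<inter> T"] rank_Suc.prems(1) T by auto
    have "S = (S \<inter> T) \<oplus> line s"
    proof
      show "(S \<inter> T) \<oplus> line s \<subseteq> S"
        using s(1) rank_Suc.prems(1) by (intro ssum_line_least) auto
      show "S \<subseteq> (S \<inter> T) \<oplus> line s"
      proof
        fix x assume x: "x \<in> S"
        then have "x \<in> T \<oplus> line s"
          using rank_Suc.prems(2) ex by blast
        then obtain t a where t: "t \<in> T" "x = t + a *s s"
          by (auto elim!: ssumE line_memE)
        have "t = x - a *s s"
          using t by simp
        then have "t \<in> S"
          using x s(1) rank_Suc.prems(1) subspace_diff subspace_scale by blast
        then show "x \<in> (S \<inter> T) \<oplus> line s"
          using t by (simp add: ssumI)
      qed
    qed
    then have "rank S (Suc e)"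
      using rank.rank_Suc[OF e(1), of s] s(2) by simp
    moreover have "Suc e < Suc d" if "S \<noteq> T \<oplus> line v"
    proof -
      have "\<not> T \<subseteq> S"
      proof
        assume "T \<subseteq> S"
        then have "T \<oplus> line s \<subseteq> S"
          using s(1) rank_Suc.prems(1) by (simp add: ssum_line_least)
        then show False
          using that ex rank_Suc.prems(2) by blast
      qed
      then show ?thesis
        using e(3) by auto
    qed
    ultimately show ?thesis
      using e(2) by auto
  qed
qed

lemma rank_le:
  assumes "rank S e" "rank T d" "S \<subseteq> T"
  shows "e \<le> d"
  using assms
proof (induction arbitrary: T d rule: rank.induct)
  case (rank_Suc S e v)
  have S: "subspace S"
    using rank_Suc.hyps(1) by (rule rank_subspace)
  have "S \<subseteq> T" "S \<noteq> T"
    using rank_Suc.prems(2) rank_Suc.hyps(2) ssum_upper1[of "line v" S] ssum_line_self[OF S, of v]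
    by auto
  then obtain d' where d': "rank S d'" "d' < d"
    using rank_of_subset[OF rank_Suc.prems(1) S] by blast
  have "e \<le> d'"
    using rank_Suc.IH[OF d'(1)] by simp
  then show ?case
    using d'(2) by simp
qed simp

lemma rank_unique: "rank S d \<Longrightarrow> rank S e \<Longrightarrow> d = e"
  by (simp add: le_antisym rank_le)

subsection \<open>Rank and dimension\<close>

lemma span_mem: "finite T \<Longrightarrow> T \<subseteq> B \<Longrightarrow> (\<Sum>a\<in>T. r a *s a) \<in> span B"
  unfolding span_def by blast

lemma span_finite:
  assumes "finite B"
  shows "span B = {\<Sum>a\<in>B. r a *s a | r. True}"
proof
  show "span B \<subseteq> {\<Sum>a\<in>B. r a *s a | r. True}"
  proof
    fix x assume "x \<in> span B"
    then obtain T r where T: "finite T" "T \<subseteq> B" "x = (\<Sum>a\<in>T. r a *s a)"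
      unfolding span_def by blast
    have "(\<Sum>a\<in>B. (if a \<in> T then r a else 0) *s a) = (\<Sum>a\<in>T. (if a \<in> T then r a else 0) *s a)"
      by (rule sum.mono_neutral_right) (use assms T in auto)
    also have "\<dots> = x"
      using T(3) by simp
    finally show "x \<in> {\<Sum>a\<in>B. r a *s a | r. True}"
      by (intro CollectI exI[of _ "\<lambda>a. if a \<in> T then r a else 0"]) simp
  qed
  show "{\<Sum>a\<in>B. r a *s a | r. True} \<subseteq> span B"
    using assms span_mem by blast
qed

lemma span_insert:
  assumes "finite B" "b \<notin> B"
  shows "span (insert b B) = span B \<oplus> line b"
proof
  show "span (insert b B) \<subseteq> span B \<oplus> line b"
  proof
    fix x assume "x \<in> span (insert b B)"
    then obtain r where "x = (\<Sum>a\<in>insert b B. r a *s a)"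
      using assms by (auto simp: span_finite)
    then have "x = (\<Sum>a\<in>B. r a *s a) + r b *s b"
      using assms by (simp add: add.commute)
    then show "x \<in> span B \<oplus> line b"
      using assms(1) by (metis line_mem span_mem ssumI subset_refl)
  qed
  show "span B \<oplus> line b \<subseteq> span (insert b B)"
  proof
    fix x assume "x \<in> span B \<oplus> line b"
    then obtain r c where x: "x = (\<Sum>a\<in>B. r a *s a) + c *s b"
      using assms(1) by (auto simp: span_finite elim!: ssumE line_memE)
    define r' where "r' = r(b := c)"
    have "(\<Sum>a\<in>B. r' a *s a) = (\<Sum>a\<in>B. r a *s a)"
      by (rule sum.cong) (use assms(2) r'_def in auto)
    then have "x = (\<Sum>a\<in>insert b B. r' a *s a)"
      using assms x by (simp add: add.commute r'_def)
    then show "x \<in> span (insert b B)"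
      using assms(1) span_mem[of "insert b B" "insert b B" r'] by simp
  qed
qed

lemma span_empty [simp]: "span {} = {0}"
  by (simp add: span_finite)

lemma subspace_span_finite: "finite B \<Longrightarrow> subspace (span B)"
  by (induction rule: finite_induct) (simp_all add: span_insert)

lemma span_superset: "B \<subseteq> span B"
proof
  fix b assume "b \<in> B"
  then show "b \<in> span B"
    using span_mem[of "{b}" B "\<lambda>_. 1"] by (simp add: scale_one)
qed

lemma span_least:
  assumes "subspace S" "B \<subseteq> S"
  shows "span B \<subseteq> S"
proof
  fix x assume "x \<in> span B"
  then obtain T r where T: "finite T" "T \<subseteq> B" "x = (\<Sum>a\<in>T. r a *s a)"
    unfolding span_def by blast
  have "(\<Sum>a\<in>T. r a *s a) \<in> S"
    using T(1) T(2) assms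
    by (induction T rule: finite_induct) (auto simp: subspace_0 subspace_add subspace_scale)
  then show "x \<in> S"
    using T(3) by simp
qed

lemma span_subspace: "subspace S \<Longrightarrow> span S = S"
  by (simp add: span_least span_superset subset_antisym)

lemma independent_subset: "independent B \<Longrightarrow> A \<subseteq> B \<Longrightarrow> independent A"
  unfolding independent_def by blast

lemma independent_insertD:
  assumes "independent (insert b B)" "finite B" "b \<notin> B"
  shows "b \<notin> span B"
proof
  assume "b \<in> span B"
  then obtain r where r: "b = (\<Sum>a\<in>B. r a *s a)"
    using assms(2) by (auto simp: span_finite)
  define u where "u = (\<lambda>a. if a = b then - 1 else r a)"
  have "(\<Sum>a\<in>B. u a *s a) = (\<Sum>a\<in>B. r a *s a)"
    by (rule sum.cong) (use assms(3) u_def in auto)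
  then have "(\<Sum>a\<in>insert b B. u a *s a) = 0"
    using assms r by (simp add: u_def scale_minus_left scale_one)
  then have "u b = 0"
    using assms(1,2) unfolding independent_def by blast
  then show False
    by (simp add: u_def)
qed

lemma independent_insertI:
  assumes B: "independent B" "finite B" and b: "b \<notin> span B"
  shows "independent (insert b B)"
  unfolding independent_def
proof (intro allI impI ballI; elim conjE)
  fix T u v assume T: "finite T" "T \<subseteq> insert b B" and s: "(\<Sum>v\<in>T. u v *s v) = 0" and v: "v \<in> T"
  have sub: "T - {b} \<subseteq> B"
    using T(2) by blast
  show "u v = 0"
  proof (cases "b \<in> T")
    case True
    have eq: "u b *s b + (\<Sum>v\<in>T - {b}. u v *s v) = 0"
      using s T(1) True by (simp add: sum.remove)
    have span: "(\<Sum>v\<in>T - {b}. u v *s v) \<in> span B"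
      using T(1) sub by (simp add: span_mem)
    then have "u b *s b \<in> span B"
      by (metis B(2) eq eq_neg_iff_add_eq_0 subspace_neg subspace_span_finite)
    then have ub: "u b = 0"
      using b subspace_scale_iff[OF subspace_span_finite[OF B(2)]] by blast
    then have "(\<Sum>v\<in>T - {b}. u v *s v) = 0"
      using eq by simp
    then have "\<forall>v\<in>T - {b}. u v = 0"
      using B(1) sub T(1) unfolding independent_def by blast
    then show ?thesis
      using ub v by blast
  next
    case False
    then have "T \<subseteq> B"
      using T(2) by blast
    then show ?thesis
      using B(1) T(1) s v unfolding independent_def by blast
  qed
qed

lemma rank_span:
  assumes "finite B" "independent B"
  shows "rank (span B) (card B)"
  using assms
proof (induction rule: finite_induct)
  case (insert b B)
  have "independent B" "b \<notin> span B"
    using insert independent_subset independent_insertD by blast+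
  then show ?case
    using insert by (simp add: span_insert rank_Suc)
qed (simp add: rank_0)

lemma rank_basis:
  assumes "rank S d"
  shows "\<exists>B. finite B \<and> card B = d \<and> independent B \<and> span B = S"
  using assms
proof (induction rule: rank.induct)
  case rank_0
  have "independent {}"
    by (simp add: independent_def)
  then show ?case
    using span_empty by force
next
  case (rank_Suc S d v)
  then obtain B where B: "finite B" "card B = d" "independent B" "span B = S"
    by blast
  have "v \<notin> B"
    using B(4) rank_Suc.hyps(2) span_superset by blast
  then show ?case
    using B rank_Suc.hyps(2) independent_insertI[of B v]
    by (intro exI[of _ "insert v B"]) (simp add: span_insert)
qed

lemma independent_finite_of_rank:
  assumes "independent B" "span B = S" "rank S d"
  shows "finite B"
proof (rule ccontr)
  assume "infinite B"
  then obtain C where C: "C \<subseteq> B" "finite C" "card C = Suc d"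
    using infinite_arbitrarily_large by blast
  have "rank (span C) (Suc d)"
    using rank_span[OF C(2)] independent_subset[OF assms(1) C(1)] C(3) by simp
  moreover have "span C \<subseteq> S"
    using span_least[OF rank_subspace[OF assms(3)], of C] C(1) span_superset[of B] assms(2) by simp
  ultimately show False
    using rank_le[of "span C" "Suc d" S d] assms(3) by simp
qed

lemma dim_rank:
  assumes "rank S d"
  shows "dim S = d"
proof -
  have S: "span S = S"
    using assms rank_subspace span_subspace by blast
  let ?P = "\<lambda>B. independent B \<and> span B = span S"
  have ex: "\<exists>B. ?P B"
    using rank_basis[OF assms] S by auto
  define B where "B = (SOME B. ?P B)"
  have B: "independent B" "span B = S"
    using someI_ex[OF ex] S B_def by auto
  have "rank S (card B)"
    using rank_span[of B] B independent_finite_of_rank[OF B assms] by simp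
  then have "card B = d"
    using assms rank_unique by blast
  then show ?thesis
    using ex unfolding dim_def B_def by simp
qed

lemma rank_UNIV_of_dim:
  assumes "dim UNIV = n" "0 < n"
  shows "rank UNIV n"
proof -
  let ?P = "\<lambda>B. independent B \<and> span B = span UNIV"
  have ex: "\<exists>B. ?P B"
    using assms unfolding dim_def by (metis less_numeral_extra(3))
  define B where "B = (SOME B. ?P B)"
  have B: "independent B" "span B = UNIV"
    using someI_ex[OF ex] B_def span_subspace[OF subspace_UNIV] by auto
  have "card B = n"
    using ex assms(1) unfolding dim_def B_def by simp
  then show ?thesis
    using rank_span[of B] B assms(2) card_ge_0_finite[of B] by simp
qed

end

section \<open>Subspaces of a finite-dimensional space\<close>

locale finite_dim_space = left_vector_space scale
  for scale :: "'k::division_ring \<Rightarrow> 'v::ab_group_add \<Rightarrow> 'v" (infixr \<open>*s\<close> 75) +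
  fixes n :: nat
  assumes rank_UNIV: "rank UNIV n"
begin

lemma rank_dim: "subspace S \<Longrightarrow> rank S (dim S)"
  using rank_of_subset[OF rank_UNIV] dim_rank by blast

lemma dim_UNIV: "dim UNIV = n"
  using rank_UNIV dim_rank by blast

lemma dim_0: "dim {0} = 0"
  using rank_0 dim_rank by blast

lemma dim_mono: "subspace S \<Longrightarrow> subspace T \<Longrightarrow> S \<subseteq> T \<Longrightarrow> dim S \<le> dim T"
  using rank_dim rank_le by blast

lemma dim_le_n: "subspace S \<Longrightarrow> dim S \<le> n"
  using dim_mono[of S UNIV] dim_UNIV by simp

lemma dim_ssum_line: "subspace S \<Longrightarrow> v \<notin> S \<Longrightarrow> dim (S \<oplus> line v) = Suc (dim S)"
  using rank_dim rank_Suc dim_rank by blast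

lemma dim_subset_eq:
  assumes "subspace S" "subspace T" "S \<subseteq> T" "dim T \<le> dim S"
  shows "S = T"
proof (rule ccontr)
  assume "S \<noteq> T"
  then obtain e where "rank S e" "e < dim T"
    using rank_of_subset[OF rank_dim[OF assms(2)] assms(1,3)] by blast
  then show False
    using assms(4) dim_rank by force
qed

lemma dim_eq_0: "subspace S \<Longrightarrow> dim S = 0 \<longleftrightarrow> S = {0}"
  using dim_subset_eq[of "{0}" S] dim_0 subspace_0 by force

lemma dim_eq_n: "subspace S \<Longrightarrow> dim S = n \<longleftrightarrow> S = UNIV"
  using dim_subset_eq[of S UNIV] dim_UNIV by force

lemma dim_line: "v \<noteq> 0 \<Longrightarrow> dim (line v) = 1"
  using dim_ssum_line[of "{0}" v] dim_0 by (simp add: zero_ssum)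

lemma subspace_induct [consumes 3, case_names base step]:
  assumes XY: "subspace X" "subspace Y" "X \<subseteq> Y"
    and base: "P X"
    and step: "\<And>Z v. subspace Z \<Longrightarrow> X \<subseteq> Z \<Longrightarrow> Z \<subseteq> Y \<Longrightarrow> P Z \<Longrightarrow> v \<in> Y \<Longrightarrow> v \<notin> Z \<Longrightarrow>
      P (Z \<oplus> line v)"
  shows "P Y"
proof -
  have "P Y" if "subspace Z" "X \<subseteq> Z" "Z \<subseteq> Y" "P Z" for Z
    using that
  proof (induction "n - dim Z" arbitrary: Z rule: less_induct)
    case less
    show ?case
    proof (cases "Z = Y")
      case False
      then obtain v where v: "v \<in> Y" "v \<notin> Z"
        using less.prems(3) by blast
      have sub: "subspace (Z \<oplus> line v)" "X \<subseteq> Z \<oplus> line v" "Z \<oplus> line v \<subseteq> Y"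
        using less.prems v XY(2) ssum_upper1[of "line v" Z] ssum_line_least[of Y Z v] by auto
      have "dim (Z \<oplus> line v) = Suc (dim Z)"
        using dim_ssum_line less.prems(1) v(2) by blast
      moreover have "dim (Z \<oplus> line v) \<le> n"
        using dim_le_n sub(1) by blast
      ultimately show ?thesis
        using less.hyps[OF _ sub] step[OF less.prems v] by simp
    qed (use less.prems in simp)
  qed
  then show ?thesis
    using XY base by blast
qed

lemma dim_ssum_Int:
  assumes S: "subspace S" and T: "subspace T"
  shows "dim (S \<oplus> T) + dim (S \<inter> T) = dim S + dim T"
proof -
  obtain X where X: "X = S \<inter> T"
    by blast
  have "subspace X" "subspace T" "X \<subseteq> T"
    using S T X by auto
  then have "dim (S \<oplus> T) + dim X = dim S + dim T"
  proof (induction rule: subspace_induct)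
    case base
    then show ?case
      using S T X by (simp add: ssum_absorb)
  next
    case (step Z v)
    have "v \<notin> S \<oplus> Z"
    proof
      assume "v \<in> S \<oplus> Z"
      then obtain s z where sz: "s \<in> S" "z \<in> Z" "v = s + z"
        by (elim ssumE)
      then have "s = v - z"
        by simp
      then have "s \<in> X"
        using sz step T X subspace_diff by blast
      then show False
        using sz step subspace_add by blast
    qed
    then have "dim (S \<oplus> (Z \<oplus> line v)) = Suc (dim (S \<oplus> Z))"
      using dim_ssum_line[of "S \<oplus> Z" v] S step by (simp flip: ssum_assoc)
    then show ?case
      using step dim_ssum_line[of Z v] by simp
  qed
  then show ?thesis
    using X by simp
qed

end

context finite_dim_space
begin

lemma ex_complement_in:
  assumes X: "subspace X" and Y: "subspace Y" and XY: "X \<subseteq> Y"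
  shows "\<exists>C. subspace C \<and> X \<oplus> C = Y \<and> dim X + dim C = dim Y"
  using X Y XY
proof (induction rule: subspace_induct)
  case base
  have "X \<oplus> {0} = X"
    using zero_ssum ssum_commute by metis
  then show ?case
    using dim_0 subspace_zero by fastforce
next
  case (step Z v)
  then obtain C where C: "subspace C" "X \<oplus> C = Z" "dim X + dim C = dim Z"
    by blast
  have "v \<notin> C"
    using C(2) step.hyps ssum_upper2[OF X, of C] by blast
  then have "dim (C \<oplus> line v) = Suc (dim C)" "dim (Z \<oplus> line v) = Suc (dim Z)"
    using C(1) step dim_ssum_line by blast+
  then show ?case
    using C by (intro exI[of _ "C \<oplus> line v"]) (simp flip: ssum_assoc)
qed

lemma ex_subspace_between:
  assumes "subspace X" "subspace Y" "X \<subseteq> Y" "dim X \<le> d" "d \<le> dim Y"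
  shows "\<exists>Z. subspace Z \<and> X \<subseteq> Z \<and> Z \<subseteq> Y \<and> dim Z = d"
proof -
  have "\<forall>d. dim X \<le> d \<and> d \<le> dim Y \<longrightarrow> (\<exists>Z. subspace Z \<and> X \<subseteq> Z \<and> Z \<subseteq> Y \<and> dim Z = d)"
    using assms(1-3)
  proof (induction rule: subspace_induct)
    case base
    then show ?case
      using assms(1) by auto
  next
    case (step Z v)
    have "dim (Z \<oplus> line v) = Suc (dim Z)" "Z \<subseteq> Z \<oplus> line v" "subspace (Z \<oplus> line v)"
      using step dim_ssum_line ssum_upper1 by auto
    then show ?case
      using step by (metis le_SucE order_refl order_trans)
  qed
  then show ?thesis
    using assms by blast
qed

lemma dim_ssum_le: "subspace S \<Longrightarrow> subspace T \<Longrightarrow> dim (S \<oplus> T) \<le> dim S + dim T"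
  using dim_ssum_Int[of S T] by simp

lemma dim_ssum_disjoint:
  "subspace S \<Longrightarrow> subspace T \<Longrightarrow> S \<inter> T = {0} \<Longrightarrow> dim (S \<oplus> T) = dim S + dim T"
  using dim_ssum_Int[of S T] dim_0 by simp

lemma grassmannian_iff: "S \<in> Gr k \<longleftrightarrow> subspace S \<and> dim S = k"
  by (simp add: grassmannian_def)

lemma complementary_iff:
  assumes "S \<in> Gr k" "U \<in> Gr (n - k)" "k \<le> n"
  shows "S \<oplus> U = UNIV \<longleftrightarrow> S \<inter> U = {0}"
  using assms dim_ssum_Int[of S U] dim_eq_n[of "S \<oplus> U"] dim_eq_0[of "S \<inter> U"]
  by (auto simp: grassmannian_iff)

lemma complement_dim:
  assumes "S \<in> Gr k" "subspace U" "S \<oplus> U = UNIV" "dim U \<le> n - k"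
  shows "U \<in> Gr (n - k)"
  using assms dim_ssum_le[of S U] dim_UNIV by (auto simp: grassmannian_iff)

text \<open>This produces complements of \<open>R\<close> with prescribed vectors, the means by which statements about
complements are turned into statements about vectors.\<close>

lemma ex_complement_extending:
  assumes R: "R \<in> Gr k" and X: "subspace X" and RX: "R \<inter> X = {0}"
  shows "\<exists>U \<in> Gr (n - k). R \<oplus> U = UNIV \<and> X \<subseteq> U"
proof -
  have subR: "subspace R" "dim R = k"
    using R by (auto simp: grassmannian_iff)
  obtain C where C: "subspace C" "(R \<oplus> X) \<oplus> C = UNIV" "dim (R \<oplus> X) + dim C = n"
    using ex_complement_in[of "R \<oplus> X" UNIV] subR X dim_UNIV by auto
  have "dim (X \<oplus> C) \<le> n - k"
    using dim_ssum_le[OF X C(1)] C(3) dim_ssum_disjoint[OF subR(1) X RX] subR(2) by simp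
  then show ?thesis
    using complement_dim[OF R, of "X \<oplus> C"] C X by (auto simp: ssum_assoc ssum_upper1[THEN subsetD])
qed

lemma line_Int_zero: "subspace S \<Longrightarrow> v \<notin> S \<Longrightarrow> S \<inter> line v = {0}"
  by (auto elim!: line_memE simp: subspace_scale_iff scale_eq_0_iff subspace_0)
     (metis scale_zero_left subspace_scale_iff)

lemma ex_complement_mem:
  assumes "R \<in> Gr k" "v \<notin> R"
  shows "\<exists>U \<in> Gr (n - k). R \<oplus> U = UNIV \<and> v \<in> U"
proof -
  have "R \<inter> line v = {0}"
    using assms line_Int_zero by (simp add: grassmannian_iff)
  then obtain U where "U \<in> Gr (n - k)" "R \<oplus> U = UNIV" "line v \<subseteq> U"
    using ex_complement_extending[OF assms(1), of "line v"] by auto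
  then show ?thesis
    using line_self[of v] by blast
qed

text \<open>Two proper subspaces never cover the whole space, so a common complement of two subspaces of
  the same dimension can be built up one vector at a time.\<close>

lemma subspaces_not_cover:
  assumes "subspace S" "subspace T" "S \<noteq> UNIV" "T \<noteq> UNIV"
  shows "\<exists>v. v \<notin> S \<and> v \<notin> T"
proof (rule ccontr)
  assume a: "\<not> ?thesis"
  obtain s t where "s \<notin> T" "t \<notin> S"
    using assms by blast
  then have "s \<in> S" "t \<in> T"
    using a by blast+
  then have "s + t \<notin> S" "s + t \<notin> T"
    using \<open>s \<notin> T\<close> \<open>t \<notin> S\<close> assms by (simp_all add: subspace_add_iff subspace_add_iff2)
  then show False
    using a by blast
qed

lemma common_complement:
  assumes "S \<in> Gr k" "T \<in> Gr k" "k \<le> n"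
  shows "\<exists>U \<in> Gr (n - k). S \<oplus> U = UNIV \<and> T \<oplus> U = UNIV"
  using assms
proof (induction "n - k" arbitrary: k S T)
  case 0
  then have "S = UNIV" "T = UNIV" "{0} \<in> Gr (n - k)"
    using dim_eq_n dim_0 by (auto simp: grassmannian_iff)
  then show ?case
    by (metis subspace_UNIV subspace_zero ssum_upper1 top.extremum_uniqueI)
next
  case (Suc j)
  have sub: "subspace S" "subspace T" "dim S = k" "dim T = k"
    using Suc.prems by (auto simp: grassmannian_iff)
  then have "S \<noteq> UNIV" "T \<noteq> UNIV"
    using Suc.hyps(2) dim_UNIV by auto
  then obtain v where v: "v \<notin> S" "v \<notin> T"
    using subspaces_not_cover sub by blast
  have "S \<oplus> line v \<in> Gr (Suc k)" "T \<oplus> line v \<in> Gr (Suc k)"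
    using sub v by (auto simp: grassmannian_iff dim_ssum_line)
  moreover have "j = n - Suc k" "Suc k \<le> n"
    using Suc.hyps(2) by auto
  ultimately obtain U where U: "U \<in> Gr (n - Suc k)"
    "S \<oplus> line v \<oplus> U = UNIV" "T \<oplus> line v \<oplus> U = UNIV"
    using Suc.hyps(1)[of "Suc k" "S \<oplus> line v" "T \<oplus> line v"] by blast
  have subU: "subspace U" "dim U = n - Suc k"
    using U by (auto simp: grassmannian_iff)
  have "v \<noteq> 0"
    using v sub subspace_0 by blast
  then have "dim (line v \<oplus> U) \<le> n - k"
    using dim_ssum_le[of "line v" U] subU Suc.hyps(2) dim_line by simp
  then have "line v \<oplus> U \<in> Gr (n - k)"
    using complement_dim[OF Suc.prems(1), of "line v \<oplus> U"] U subU by (simp add: ssum_assoc)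
  then show ?case
    using U by (auto simp: ssum_assoc)
qed

section \<open>Adjacency and pencils in a Grassmannian\<close>

lemma adjacent_iff:
  assumes "S \<in> Gr k" "T \<in> Gr k"
  shows "subspace_adjacent S T \<longleftrightarrow> Suc (dim (S \<inter> T)) = k"
  using assms by (auto simp: subspace_adjacent_def grassmannian_iff)

lemma adjacent_iff_ssum:
  assumes "S \<in> Gr k" "T \<in> Gr k"
  shows "subspace_adjacent S T \<longleftrightarrow> dim (S \<oplus> T) = Suc k"
  using assms dim_ssum_Int[of S T] by (auto simp: adjacent_iff grassmannian_iff)

lemma adjacent_commute: "subspace_adjacent S T \<longleftrightarrow> subspace_adjacent T S"
  by (auto simp: subspace_adjacent_def Int_commute)

lemma adjacent_not_refl: "\<not> subspace_adjacent S S"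
  by (simp add: subspace_adjacent_def)

lemma adjacent_of_Int:
  assumes S: "S \<in> Gr k" and T: "T \<in> Gr k" and "S \<noteq> T"
    and M: "subspace M" "M \<subseteq> S" "M \<subseteq> T" "Suc (dim M) = k"
  shows "subspace_adjacent S T \<and> S \<inter> T = M"
proof -
  have sub: "subspace S" "subspace T" "dim S = k" "dim T = k" "subspace (S \<inter> T)"
    using S T by (auto simp: grassmannian_iff)
  have "\<not> dim S \<le> dim (S \<inter> T)"
    using dim_subset_eq[of "S \<inter> T" S] dim_subset_eq[of "S \<inter> T" T] sub \<open>S \<noteq> T\<close> by auto
  then have le: "dim (S \<inter> T) \<le> dim M"
    using sub M by simp
  then have "M = S \<inter> T"
    using dim_subset_eq[of M "S \<inter> T"] sub M by blast
  then show ?thesis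
    using S T M(4) by (simp add: adjacent_iff)
qed

lemma adjacent_of_ssum:
  assumes S: "S \<in> Gr k" and T: "T \<in> Gr k" and "S \<noteq> T"
    and W: "subspace W" "S \<subseteq> W" "T \<subseteq> W" "dim W = Suc k"
  shows "subspace_adjacent S T \<and> S \<oplus> T = W"
proof -
  have sub: "subspace S" "subspace T" "dim S = k" "dim T = k" "subspace (S \<oplus> T)"
    using S T by (auto simp: grassmannian_iff)
  have "\<not> dim (S \<oplus> T) \<le> dim S"
    using dim_subset_eq[of S "S \<oplus> T"] dim_subset_eq[of T "S \<oplus> T"] sub \<open>S \<noteq> T\<close>
      ssum_upper1[of T S] ssum_upper2[of S T] by auto
  then have "S \<oplus> T = W"
    using dim_subset_eq[of "S \<oplus> T" W] sub W ssum_least by auto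
  then show ?thesis
    using S T W(4) by (simp add: adjacent_iff_ssum)
qed

text \<open>Pencils are recognised by complementarity alone.  If \<open>R\<close> lies between \<open>S \<inter> T\<close> and
  \<open>S \<oplus> T\<close>, then a complement of \<open>R\<close> meets \<open>S \<oplus> T\<close> in a line only, which cannot lie
  in both \<open>S\<close> and \<open>T\<close>.  Conversely, if \<open>s \<in> S - R\<close> and \<open>t \<in> T - R\<close> spanned a subspace having only
  \<open>0\<close> in common with \<open>R\<close>, then it would extend to a complement of \<open>R\<close> meeting both \<open>S\<close> and
  \<open>T\<close>; hence modulo \<open>R\<close> all these vectors are proportional, and \<open>S\<close> and \<open>T\<close> are hyperplanes of
  one subspace \<open>R \<oplus> line t\<close>.\<close>

lemma pencil_iff_complements:
  assumes S: "S \<in> Gr k" and T: "T \<in> Gr k" and R: "R \<in> Gr k"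
    and k: "k \<le> n" and RS: "R \<noteq> S" and RT: "R \<noteq> T"
  shows "(\<forall>U \<in> Gr (n - k). R \<oplus> U = UNIV \<longrightarrow> S \<oplus> U = UNIV \<or> T \<oplus> U = UNIV)
    \<longleftrightarrow> subspace_adjacent S T \<and> S \<inter> T \<subseteq> R \<and> R \<subseteq> S \<oplus> T"
    (is "?compl \<longleftrightarrow> ?pencil")
proof
  have sub: "subspace S" "subspace T" "subspace R" "dim S = k" "dim T = k" "dim R = k"
    using S T R by (auto simp: grassmannian_iff)
  show ?compl if pencil: ?pencil
  proof (intro ballI impI, rule ccontr)
    fix U assume U: "U \<in> Gr (n - k)" and RU: "R \<oplus> U = UNIV"
      and "\<not> (S \<oplus> U = UNIV \<or> T \<oplus> U = UNIV)"
    then have nz: "S \<inter> U \<noteq> {0}" "T \<inter> U \<noteq> {0}"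
      using S T k complementary_iff by blast+
    have subU: "subspace U" "dim U = n - k"
      using U by (auto simp: grassmannian_iff)
    let ?L = "(S \<oplus> T) \<inter> U"
    have "dim (S \<oplus> T) = Suc k"
      using pencil S T adjacent_iff_ssum by blast
    moreover have "(S \<oplus> T) \<oplus> U = UNIV"
      using pencil RU ssum_mono[of R "S \<oplus> T" U U] by auto
    ultimately have L: "dim ?L = 1"
      using dim_ssum_Int[of "S \<oplus> T" U] sub subU k dim_UNIV by simp
    have "X \<inter> U = ?L" if X: "subspace X" "X \<subseteq> S \<oplus> T" "X \<inter> U \<noteq> {0}" for X
    proof (rule dim_subset_eq)
      have "dim (X \<inter> U) \<noteq> 0"
        using X subU dim_eq_0 by simp
      then show "dim ?L \<le> dim (X \<inter> U)"
        using L by simp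
    qed (use X sub subU in auto)
    then have "S \<inter> U = T \<inter> U"
      using nz sub ssum_upper1[of T S] ssum_upper2[of S T] by metis
    then have "S \<inter> U \<subseteq> R \<inter> U"
      using pencil by blast
    moreover have "R \<inter> U = {0}"
      using RU R U k complementary_iff by blast
    ultimately show False
      using nz sub subU subspace_0 by blast
  qed
  show ?pencil if compl: ?compl
  proof -
    have not_subset: "\<not> X \<subseteq> R" if "X \<in> {S, T}" for X
      using that sub RS RT dim_subset_eq[of X R] by auto
    have key: "R \<inter> (line s \<oplus> line t) \<noteq> {0}" if st: "s \<in> S" "s \<notin> R" "t \<in> T" "t \<notin> R" for s t
    proof
      assume "R \<inter> (line s \<oplus> line t) = {0}"
      then obtain U where U: "U \<in> Gr (n - k)" "R \<oplus> U = UNIV" "line s \<oplus> line t \<subseteq> U"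
        using ex_complement_extending[OF R, of "line s \<oplus> line t"] by auto
      have "s \<in> U" "t \<in> U"
        using U(3) ssum_upper1[of "line t" "line s"] ssum_upper2[of "line s" "line t"]
          line_self[of s] line_self[of t] by (auto simp del: line_self)
      moreover have "s \<noteq> 0" "t \<noteq> 0"
        using st sub subspace_0 by auto
      ultimately have "S \<inter> U \<noteq> {0}" "T \<inter> U \<noteq> {0}"
        using st by auto
      then show False
        using bspec[OF compl U(1)] U(2) complementary_iff[OF S U(1) k]
          complementary_iff[OF T U(1) k] by simp
    qed
    have proportional: "s \<in> R \<oplus> line t \<and> t \<in> R \<oplus> line s \<and> s \<notin> line t"
      if st: "s \<in> S" "s \<notin> R" "t \<in> T" "t \<notin> R" for s t
    proof -
      obtain r where r: "r \<in> R" "r \<in> line s \<oplus> line t" "r \<noteq> 0"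
        using key[OF st] subspace_0[OF sub(3)] subspace_0[of "line s \<oplus> line t"] by auto
      then obtain a b where ab: "r = a *s s + b *s t"
        by (auto elim!: ssumE line_memE)
      have "a \<noteq> 0" if "b \<noteq> 0"
        using ab r that st sub by (auto simp: subspace_scale_iff)
      moreover have "b \<noteq> 0"
        using ab r st sub by (cases "a = 0") (auto simp: subspace_scale_iff)
      ultimately have ab0: "a \<noteq> 0" "b \<noteq> 0"
        by auto
      have s: "s = inverse a *s r + - (inverse a * b) *s t"
        using scale_inverse_left[OF ab0(1), of s]
        by (simp add: ab scale_right_distrib scale_scale scale_minus_left)
      have t: "t = inverse b *s r + - (inverse b * a) *s s"
        using scale_inverse_left[OF ab0(2), of t]
        by (simp add: ab scale_right_distrib scale_scale scale_minus_left)
      have "s \<in> R \<oplus> line t" "t \<in> R \<oplus> line s"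
        using s t r sub by (metis line_mem ssumI subspace_scale)+
      moreover have "s \<notin> line t"
      proof
        assume "s \<in> line t"
        then have "line s \<oplus> line t = line t"
          by (metis line_least ssum_absorb ssum_commute subspace_line)
        then show False
          using key[OF st] line_Int_zero[of R t] st sub by simp
      qed
      ultimately show ?thesis
        by blast
    qed
    obtain s0 t0 where s0: "s0 \<in> S" "s0 \<notin> R" and t0: "t0 \<in> T" "t0 \<notin> R"
      using not_subset[of S] not_subset[of T] by auto
    define W where "W = R \<oplus> line t0"
    have W: "subspace W" "dim W = Suc k" "R \<subseteq> W"
      using sub t0 dim_ssum_line ssum_upper1 by (auto simp: W_def)
    have SW: "S \<subseteq> W"
    proof
      fix x assume "x \<in> S"
      then show "x \<in> W"
        using proportional[of x t0] t0 W(3) by (cases "x \<in> R") (auto simp: W_def)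
    qed
    have "R \<oplus> line s0 \<subseteq> W"
      using ssum_line_least[OF W(1,3), of s0] s0 SW by blast
    have TW: "T \<subseteq> W"
    proof
      fix x assume "x \<in> T"
      then show "x \<in> W"
        using proportional[of s0 x] s0 W(3) \<open>R \<oplus> line s0 \<subseteq> W\<close> by (cases "x \<in> R") auto
    qed
    have ST: "S \<inter> T \<subseteq> R"
      using proportional line_self by blast
    then have "S \<noteq> T"
      using not_subset by auto
    then show ?thesis
      using adjacent_of_ssum[OF S T _ W(1) SW TW W(2)] ST W(3) by simp
  qed
qed

text \<open>A pencil has a third element, even over the field with two elements: a vector \<open>s + t\<close> with
\<open>s \<in> S - T\<close> and \<open>t \<in> T - S\<close> is in neither \<open>S\<close> nor \<open>T\<close>.\<close>

lemma adjacent_ex_third: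
  assumes S: "S \<in> Gr k" and T: "T \<in> Gr k" and adj: "subspace_adjacent S T"
  shows "\<exists>R \<in> Gr k. R \<noteq> S \<and> R \<noteq> T \<and> S \<inter> T \<subseteq> R \<and> R \<subseteq> S \<oplus> T"
proof -
  have sub: "subspace S" "subspace T" "dim S = k" "dim T = k"
    using S T by (auto simp: grassmannian_iff)
  have d: "Suc (dim (S \<inter> T)) = k"
    using assms adjacent_iff by blast
  then have "\<not> S \<subseteq> T" "\<not> T \<subseteq> S"
    using sub by (metis Int_absorb1 Int_absorb2 n_not_Suc_n)+
  then obtain s t where st: "s \<in> S" "s \<notin> T" "t \<in> T" "t \<notin> S"
    by blast
  define R where "R = (S \<inter> T) \<oplus> line (s + t)"
  have notin: "s + t \<notin> S" "s + t \<notin> T"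
    using st sub by (simp_all add: subspace_add_iff subspace_add_iff2)
  have stR: "s + t \<in> R"
    using sub by (simp add: R_def ssum_line_self)
  have "R \<in> Gr k"
    using sub d notin dim_ssum_line[of "S \<inter> T" "s + t"] by (simp add: R_def grassmannian_iff)
  moreover have "R \<noteq> S" "R \<noteq> T"
    using notin stR by auto
  moreover have "S \<inter> T \<subseteq> R"
    by (simp add: R_def ssum_upper1)
  moreover have "R \<subseteq> S \<oplus> T"
    unfolding R_def using sub ssum_upper1[of T S] st
    by (intro ssum_line_least) (auto intro: ssumI)
  ultimately show ?thesis
    by blast
qed

lemma ex_not_complementary:
  assumes "U \<in> Gr (n - k)" "1 \<le> k" "k < n"
  shows "\<exists>S \<in> Gr k. S \<oplus> U \<noteq> UNIV"
proof -
  have U: "subspace U" "dim U = n - k"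
    using assms by (auto simp: grassmannian_iff)
  then have "U \<noteq> {0}"
    using assms(3) dim_0 by auto
  then obtain u where u: "u \<in> U" "u \<noteq> 0"
    using U subspace_0 by blast
  obtain S where S: "subspace S" "line u \<subseteq> S" "dim S = k"
    using ex_subspace_between[of "line u" UNIV k] dim_line[OF u(2)] dim_UNIV assms by auto
  then have "S \<in> Gr k" "u \<in> S \<inter> U"
    using u line_self by (auto simp: grassmannian_iff)
  then show ?thesis
    using u complementary_iff[of S k U] assms by auto
qed

lemma complements_determine:
  assumes "X \<in> Gr j" "Y \<in> Gr j" "j \<le> n"
    and "\<And>Z. Z \<in> Gr (n - j) \<Longrightarrow> X \<oplus> Z = UNIV \<Longrightarrow> Y \<oplus> Z = UNIV"
  shows "X = Y"
proof (rule ccontr)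
  assume "X \<noteq> Y"
  then have "\<not> Y \<subseteq> X"
    using assms dim_subset_eq[of Y X] by (auto simp: grassmannian_iff)
  then obtain y where y: "y \<in> Y" "y \<notin> X"
    by blast
  then obtain Z where Z: "Z \<in> Gr (n - j)" "X \<oplus> Z = UNIV" "y \<in> Z"
    using ex_complement_mem[OF assms(1)] by blast
  then have "Y \<inter> Z = {0}"
    using assms complementary_iff by blast
  then have "y = 0"
    using y Z by blast
  then show False
    using y assms subspace_0 by (auto simp: grassmannian_iff)
qed

end

section \<open>Closeness preserving bijections split into two factors\<close>

lemma close_clique:
  assumes "\<And>p q. p \<in> P \<Longrightarrow> q \<in> P \<Longrightarrow> p \<noteq> q \<Longrightarrow> close_pairs p q"
  shows "(\<forall>p\<in>P. \<forall>q\<in>P. fst p = fst q) \<or> (\<forall>p\<in>P. \<forall>q\<in>P. snd p = snd q)"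
proof (rule disjCI)
  assume "\<not> (\<forall>p\<in>P. \<forall>q\<in>P. snd p = snd q)"
  then obtain p q where pq: "p \<in> P" "q \<in> P" "snd p \<noteq> snd q"
    by blast
  have close: "fst p = fst q \<and> snd p \<noteq> snd q \<or> fst p \<noteq> fst q \<and> snd p = snd q"
    if "p \<in> P" "q \<in> P" "p \<noteq> q" for p q
    using assms[OF that] by (auto simp: close_pairs_def split: prod.splits)
  have "fst r = fst p" if r: "r \<in> P" for r
    using close[OF r pq(1)] close[OF r pq(2)] close[OF pq(1,2)] pq(3) by metis
  then show "\<forall>p\<in>P. \<forall>q\<in>P. fst p = fst q"
    by simp
qed

definition incidence_pairs :: "'a set \<Rightarrow> 'b set \<Rightarrow> ('a \<Rightarrow> 'b \<Rightarrow> bool) \<Rightarrow> ('a \<times> 'b) set" where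
  "incidence_pairs A B C = {(x, y). x \<in> A \<and> y \<in> B \<and> C x y}"

lemma incidence_pairs_iff [simp]:
  "(x, y) \<in> incidence_pairs A B C \<longleftrightarrow> x \<in> A \<and> y \<in> B \<and> C x y"
  by (simp add: incidence_pairs_def)

lemma product_form:
  assumes bij: "bij_betw f (incidence_pairs A B C) (incidence_pairs A' B' C')"
    and rows: "\<And>x y y'. x \<in> A \<Longrightarrow> y \<in> B \<Longrightarrow> y' \<in> B \<Longrightarrow> C x y \<Longrightarrow> C x y' \<Longrightarrow>
      fst (f (x, y)) = fst (f (x, y'))"
    and cols: "\<And>x x' y. x \<in> A \<Longrightarrow> x' \<in> A \<Longrightarrow> y \<in> B \<Longrightarrow> C x y \<Longrightarrow> C x' y \<Longrightarrow>
      snd (f (x, y)) = snd (f (x', y))"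
    and commonA: "\<And>x x'. x \<in> A \<Longrightarrow> x' \<in> A \<Longrightarrow> \<exists>y\<in>B. C x y \<and> C x' y"
    and commonB: "\<And>y y'. y \<in> B \<Longrightarrow> y' \<in> B \<Longrightarrow> \<exists>x\<in>A. C x y \<and> C x y'"
    and nbA: "\<And>u. u \<in> A' \<Longrightarrow> \<exists>v\<in>B'. C' u v"
    and nbB: "\<And>v. v \<in> B' \<Longrightarrow> \<exists>u\<in>A'. C' u v"
  shows "\<exists>a b. bij_betw a A A' \<and> bij_betw b B B' \<and>
    (\<forall>x\<in>A. \<forall>y\<in>B. C x y \<longleftrightarrow> C' (a x) (b y)) \<and>
    (\<forall>(x, y) \<in> incidence_pairs A B C. f (x, y) = (a x, b y))"
proof -
  define a where "a x = fst (f (x, SOME y. y \<in> B \<and> C x y))" for x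
  define b where "b y = snd (f (SOME x. x \<in> A \<and> C x y, y))" for y
  have f_eq: "f (x, y) = (a x, b y)" if xy: "x \<in> A" "y \<in> B" "C x y" for x y
  proof -
    have "(SOME y. y \<in> B \<and> C x y) \<in> B \<and> C x (SOME y. y \<in> B \<and> C x y)"
      by (rule someI[of "\<lambda>y. y \<in> B \<and> C x y" y]) (use xy in simp)
    moreover have "(SOME x. x \<in> A \<and> C x y) \<in> A \<and> C (SOME x. x \<in> A \<and> C x y) y"
      by (rule someI[of "\<lambda>x. x \<in> A \<and> C x y" x]) (use xy in simp)
    ultimately have "fst (f (x, y)) = a x" "snd (f (x, y)) = b y"
      using rows[of x y] cols[of x _ y] xy unfolding a_def b_def by blast+
    then show ?thesis
      by (simp add: prod_eq_iff)
  qed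
  have into: "a x \<in> A' \<and> b y \<in> B' \<and> C' (a x) (b y)" if "x \<in> A" "y \<in> B" "C x y" for x y
    using bij_betwE[OF bij, rule_format, of "(x, y)"] f_eq[OF that] that by simp
  have onto: "\<exists>x\<in>A. \<exists>y\<in>B. C x y \<and> a x = u \<and> b y = v" if "u \<in> A'" "v \<in> B'" "C' u v" for u v
  proof -
    have "(u, v) \<in> f ` incidence_pairs A B C"
      using bij that by (simp add: bij_betw_def)
    then show ?thesis
      using f_eq by force
  qed
  have inj: "x = x' \<and> y = y'"
    if "x \<in> A" "y \<in> B" "C x y" "x' \<in> A" "y' \<in> B" "C x' y'" "a x = a x'" "b y = b y'" for x x' y y'
  proof -
    have "f (x, y) = f (x', y')"
      using f_eq[of x y] f_eq[of x' y'] that by simp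
    then have "(x, y) = (x', y')"
      using bij that by (intro inj_onD[of f "incidence_pairs A B C"]) (auto simp: bij_betw_def)
    then show ?thesis
      by simp
  qed
  have inja: "x = x'" if eq: "x \<in> A" "x' \<in> A" "a x = a x'" for x x'
  proof -
    obtain y where "y \<in> B" "C x y" "C x' y"
      using commonA[OF eq(1,2)] by blast
    then show ?thesis
      using inj eq by blast
  qed
  have injb: "y = y'" if eq: "y \<in> B" "y' \<in> B" "b y = b y'" for y y'
  proof -
    obtain x where "x \<in> A" "C x y" "C x y'"
      using commonB[OF eq(1,2)] by blast
    then show ?thesis
      using inj eq by blast
  qed
  have "bij_betw a A A'"
    unfolding bij_betw_def
  proof
    show "inj_on a A"
      using inja by (rule inj_onI)
    show "a ` A = A'"
      using commonA into onto nbA by blast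
  qed
  moreover have "bij_betw b B B'"
    unfolding bij_betw_def
  proof
    show "inj_on b B"
      using injb by (rule inj_onI)
    show "b ` B = B'"
      using commonB into onto nbB by blast
  qed
  moreover have "C x y \<longleftrightarrow> C' (a x) (b y)" if "x \<in> A" "y \<in> B" for x y
  proof
    assume "C' (a x) (b y)"
    moreover have "a x \<in> A'" "b y \<in> B'"
      using that commonA[of x x] commonB[of y y] into by blast+
    ultimately obtain x' y' where "x' \<in> A" "y' \<in> B" "C x' y'" "a x' = a x" "b y' = b y"
      using onto by blast
    then show "C x y"
      using inja injb that by blast
  qed (use into that in blast)
  ultimately show ?thesis
    using f_eq by (intro exI[of _ a] exI[of _ b]) (auto simp: incidence_pairs_def)
qed

text \<open>A set of pairwise close pairs agrees in one coordinate, so \<open>f\<close> maps every row and every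
  column into a row or a column.  A row and a column through the same pair cannot both go to rows,
  because then pairs that are not close would become close.  Since any two rows meet a common
  column, all rows go to rows, or all go to columns.\<close>

lemma closeness_preserving_splits:
  fixes A B :: "'a set" and C :: "'a \<Rightarrow> 'a \<Rightarrow> bool"
  assumes pres: "preserving_transformation close_pairs (incidence_pairs A B C) f"
    and commonA: "\<And>x x'. x \<in> A \<Longrightarrow> x' \<in> A \<Longrightarrow> \<exists>y\<in>B. C x y \<and> C x' y"
    and commonB: "\<And>y y'. y \<in> B \<Longrightarrow> y' \<in> B \<Longrightarrow> \<exists>x\<in>A. C x y \<and> C x y'"
    and nonA: "\<And>x. x \<in> A \<Longrightarrow> \<exists>y\<in>B. \<not> C x y"
    and nonB: "\<And>y. y \<in> B \<Longrightarrow> \<exists>x\<in>A. \<not> C x y"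
  shows "(\<exists>a b. bij_betw a A A \<and> bij_betw b B B \<and>
      (\<forall>x\<in>A. \<forall>y\<in>B. C x y \<longleftrightarrow> C (a x) (b y)) \<and>
      (\<forall>(x, y) \<in> incidence_pairs A B C. f (x, y) = (a x, b y)))
    \<or> (\<exists>a b. bij_betw a A B \<and> bij_betw b B A \<and>
      (\<forall>x\<in>A. \<forall>y\<in>B. C x y \<longleftrightarrow> C (b y) (a x)) \<and>
      (\<forall>(x, y) \<in> incidence_pairs A B C. f (x, y) = (b y, a x)))"
proof -
  let ?G = "incidence_pairs A B C"
  have bij: "bij_betw f ?G ?G"
    using pres by (simp add: preserving_transformation_def)
  have close_iff: "close_pairs (f p) (f q) \<longleftrightarrow> close_pairs p q" if "p \<in> ?G" "q \<in> ?G" for p q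
  proof
    assume "close_pairs (f p) (f q)"
    moreover have "f p \<in> ?G" "f q \<in> ?G"
      using bij that bij_betwE by blast+
    ultimately have "close_pairs (inv_into ?G f (f p)) (inv_into ?G f (f q))"
      using pres by (simp add: preserving_transformation_def)
    then show "close_pairs p q"
      using bij that by (simp add: bij_betw_inv_into_left)
  qed (use pres that in \<open>simp add: preserving_transformation_def\<close>)
  have inj: "f p = f q \<longleftrightarrow> p = q" if "p \<in> ?G" "q \<in> ?G" for p q
    using bij that by (auto simp: bij_betw_def inj_on_def)
  have otherA: "\<exists>y'\<in>B. C x y' \<and> y' \<noteq> y" if xy: "x \<in> A" "y \<in> B" for x y
    using nonB[OF xy(2)] commonA[OF xy(1)] by blast
  have otherB: "\<exists>x'\<in>A. C x' y \<and> x' \<noteq> x" if xy: "x \<in> A" "y \<in> B" for x y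
    using nonA[OF xy(1)] commonB[OF xy(2)] by blast
  define row where "row g x \<longleftrightarrow> (\<forall>y\<in>B. \<forall>y'\<in>B. C x y \<longrightarrow> C x y' \<longrightarrow> g (f (x, y)) = g (f (x, y')))"
    for g :: "'a \<times> 'a \<Rightarrow> 'a" and x
  define col where "col g y \<longleftrightarrow> (\<forall>x\<in>A. \<forall>x'\<in>A. C x y \<longrightarrow> C x' y \<longrightarrow> g (f (x, y)) = g (f (x', y)))"
    for g :: "'a \<times> 'a \<Rightarrow> 'a" and y
  have row: "row fst x \<or> row snd x" if x: "x \<in> A" for x
  proof -
    obtain P where P: "P = f ` {p \<in> ?G. fst p = x}"
      by blast
    have "close_pairs p q" if "p \<in> P" "q \<in> P" "p \<noteq> q" for p q
      using that close_iff unfolding P by (force simp: close_pairs_def)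
    then have agree: "(\<forall>p\<in>P. \<forall>q\<in>P. fst p = fst q) \<or> (\<forall>p\<in>P. \<forall>q\<in>P. snd p = snd q)"
      by (rule close_clique)
    have "f (x, y) \<in> P" if "y \<in> B" "C x y" for y
      using x that unfolding P by auto
    with agree show ?thesis
      unfolding row_def by blast
  qed
  have col: "col fst y \<or> col snd y" if y: "y \<in> B" for y
  proof -
    obtain P where P: "P = f ` {p \<in> ?G. snd p = y}"
      by blast
    have "close_pairs p q" if "p \<in> P" "q \<in> P" "p \<noteq> q" for p q
      using that close_iff unfolding P by (force simp: close_pairs_def)
    then have agree: "(\<forall>p\<in>P. \<forall>q\<in>P. fst p = fst q) \<or> (\<forall>p\<in>P. \<forall>q\<in>P. snd p = snd q)"
      by (rule close_clique)
    have "f (x, y) \<in> P" if "x \<in> A" "C x y" for x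
      using y that unfolding P by auto
    with agree show ?thesis
      unfolding col_def by blast
  qed
  have not_both: "\<not> (row g x \<and> col g y)"
    if xy: "x \<in> A" "y \<in> B" "C x y" and g: "g = fst \<or> g = snd" for g :: "'a \<times> 'a \<Rightarrow> 'a" and x y
  proof
    assume rc: "row g x \<and> col g y"
    obtain x' y' where x'y': "x' \<in> A" "C x' y" "x' \<noteq> x" "y' \<in> B" "C x y'" "y' \<noteq> y"
      using otherA otherB xy by metis
    have "g (f (x', y)) = g (f (x, y'))"
      using rc x'y' xy unfolding row_def col_def by metis
    moreover have "f (x', y) \<noteq> f (x, y')"
      using inj[of "(x', y)" "(x, y')"] xy x'y' by simp
    ultimately have "close_pairs (f (x', y)) (f (x, y'))"
      using g by (auto simp: close_pairs_def prod_eq_iff split: prod.splits)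
    then show False
      using close_iff[of "(x', y)" "(x, y')"] xy x'y' by (simp add: close_pairs_def)
  qed
  have spread: "row g x'"
    if gh: "g = fst \<and> h = snd \<or> g = snd \<and> h = fst" and x: "x \<in> A" "x' \<in> A" "row g x" for g h :: "'a \<times> 'a \<Rightarrow> 'a" and x x'
  proof -
    obtain y where y: "y \<in> B" "C x y" "C x' y"
      using commonA x by blast
    then have "col h y"
      using not_both[of x y g] gh x col by blast
    then show ?thesis
      using not_both[of x' y h] gh x y row by blast
  qed
  show ?thesis
  proof (cases "\<forall>x\<in>A. row fst x")
    case True
    then have "col snd y" if "y \<in> B" for y
      using that not_both[of _ y fst] col commonB by metis
    then have "\<exists>a b. bij_betw a A A \<and> bij_betw b B B \<and>
      (\<forall>x\<in>A. \<forall>y\<in>B. C x y \<longleftrightarrow> C (a x) (b y)) \<and>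
      (\<forall>(x, y) \<in> ?G. f (x, y) = (a x, b y))"
      using True commonA commonB unfolding row_def col_def
      by (intro product_form[OF bij]) blast+
    then show ?thesis
      by blast
  next
    case False
    then have rows: "row snd x" if "x \<in> A" for x
      using that spread[of fst snd] row by blast
    then have cols: "col fst y" if "y \<in> B" for y
      using that not_both[of _ y snd] col commonB by metis
    let ?f = "prod.swap \<circ> f"
    have "bij_betw prod.swap ?G (incidence_pairs B A (\<lambda>y x. C x y))"
      by (auto simp: bij_betw_def inj_on_def incidence_pairs_def image_iff)
    then have bij': "bij_betw ?f ?G (incidence_pairs B A (\<lambda>y x. C x y))"
      using bij bij_betw_trans by blast
    have rows': "fst (?f (x, y)) = fst (?f (x, y'))"
      if "x \<in> A" "y \<in> B" "y' \<in> B" "C x y" "C x y'" for x y y'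
    proof -
      have "snd (f (x, y)) = snd (f (x, y'))"
        using rows[OF that(1)] that unfolding row_def by blast
      then show ?thesis
        by simp
    qed
    have cols': "snd (?f (x, y)) = snd (?f (x', y))"
      if "x \<in> A" "x' \<in> A" "y \<in> B" "C x y" "C x' y" for x x' y
    proof -
      have "fst (f (x, y)) = fst (f (x', y))"
        using cols[OF that(3)] that unfolding col_def by blast
      then show ?thesis
        by simp
    qed
    have "\<exists>a b. bij_betw a A B \<and> bij_betw b B A \<and>
      (\<forall>x\<in>A. \<forall>y\<in>B. C x y \<longleftrightarrow> C (b y) (a x)) \<and>
      (\<forall>(x, y) \<in> ?G. ?f (x, y) = (a x, b y))"
      by (rule product_form[OF bij' rows' cols' commonA commonB])
        (use commonA commonB in blast)+
    then obtain a b where ab: "bij_betw a A B" "bij_betw b B A"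
      "\<forall>x\<in>A. \<forall>y\<in>B. C x y \<longleftrightarrow> C (b y) (a x)" and fab: "\<forall>(x, y) \<in> ?G. ?f (x, y) = (a x, b y)"
      by blast
    have "\<forall>(x, y) \<in> ?G. f (x, y) = (b y, a x)"
      using fab by (auto simp: prod_eq_iff)
    then show ?thesis
      using ab by blast
  qed
qed

section \<open>Complementarity determines adjacency\<close>

context finite_dim_space
begin

text \<open>The right-hand side of \<open>pencil_iff_complements\<close> is stated for elements distinct from \<open>S\<close> and \<open>T\<close>.
Adjacency itself is recovered as the existence of such an element.\<close>

lemma complementarity_preserves_pencils:
  assumes k: "k \<le> n" and m: "m \<le> n"
    and a: "bij_betw a (Gr k) (Gr m)"
    and b: "bij_betw b (Gr (n - k)) (Gr (n - m))"
    and ab: "\<And>S U. S \<in> Gr k \<Longrightarrow> U \<in> Gr (n - k) \<Longrightarrow>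
      a S \<oplus> b U = UNIV \<longleftrightarrow> S \<oplus> U = UNIV"
    and S: "S \<in> Gr k" and T: "T \<in> Gr k"
  shows "subspace_adjacent (a S) (a T) \<longleftrightarrow> subspace_adjacent S T" (is ?adj)
    and "R \<in> Gr k \<Longrightarrow> subspace_adjacent S T \<Longrightarrow>
      a S \<inter> a T \<subseteq> a R \<and> a R \<subseteq> a S \<oplus> a T \<longleftrightarrow> S \<inter> T \<subseteq> R \<and> R \<subseteq> S \<oplus> T"
proof -
  have a_in: "a X \<in> Gr m" if "X \<in> Gr k" for X
    using a that bij_betwE by blast
  have a_eq: "a X = a Y \<longleftrightarrow> X = Y" if "X \<in> Gr k" "Y \<in> Gr k" for X Y
    using a that by (auto simp: bij_betw_def inj_on_def)
  have b_onto: "b ` Gr (n - k) = Gr (n - m)"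
    using b by (simp add: bij_betw_def)
  have pencil: "subspace_adjacent (a S) (a T) \<and> a S \<inter> a T \<subseteq> a R \<and> a R \<subseteq> a S \<oplus> a T
      \<longleftrightarrow> subspace_adjacent S T \<and> S \<inter> T \<subseteq> R \<and> R \<subseteq> S \<oplus> T"
    if R: "R \<in> Gr k" "R \<noteq> S" "R \<noteq> T" for R
  proof -
    have "subspace_adjacent (a S) (a T) \<and> a S \<inter> a T \<subseteq> a R \<and> a R \<subseteq> a S \<oplus> a T \<longleftrightarrow>
      (\<forall>W\<in>Gr (n - m). a R \<oplus> W = UNIV \<longrightarrow> a S \<oplus> W = UNIV \<or> a T \<oplus> W = UNIV)"
      using pencil_iff_complements[of "a S" m "a T" "a R"] a_in a_eq R S T m by simp
    also have "\<dots> \<longleftrightarrow> (\<forall>U\<in>Gr (n - k).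
        a R \<oplus> b U = UNIV \<longrightarrow> a S \<oplus> b U = UNIV \<or> a T \<oplus> b U = UNIV)"
      unfolding b_onto[symmetric] by blast
    also have "\<dots> \<longleftrightarrow> (\<forall>U\<in>Gr (n - k). R \<oplus> U = UNIV \<longrightarrow> S \<oplus> U = UNIV \<or> T \<oplus> U = UNIV)"
      using ab R S T by simp
    also have "\<dots> \<longleftrightarrow> subspace_adjacent S T \<and> S \<inter> T \<subseteq> R \<and> R \<subseteq> S \<oplus> T"
      using pencil_iff_complements[of S k T R] R S T k by simp
    finally show ?thesis .
  qed
  show adj: ?adj
  proof
    assume "subspace_adjacent (a S) (a T)"
    then obtain W where W: "W \<in> Gr m" "W \<noteq> a S" "W \<noteq> a T"
      "a S \<inter> a T \<subseteq> W" "W \<subseteq> a S \<oplus> a T"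
      using adjacent_ex_third[OF a_in[OF S] a_in[OF T]] by blast
    obtain R where R: "R \<in> Gr k" "W = a R"
      using a W(1) unfolding bij_betw_def by blast
    have "R \<noteq> S" "R \<noteq> T"
      using R(2) W(2,3) by auto
    then show "subspace_adjacent S T"
      using pencil[OF R(1)] W(4,5) R(2) \<open>subspace_adjacent (a S) (a T)\<close> by simp
  next
    assume "subspace_adjacent S T"
    then obtain R where "R \<in> Gr k" "R \<noteq> S" "R \<noteq> T" "S \<inter> T \<subseteq> R" "R \<subseteq> S \<oplus> T"
      using adjacent_ex_third[OF S T] by blast
    then show "subspace_adjacent (a S) (a T)"
      using pencil \<open>subspace_adjacent S T\<close> by blast
  qed
  show "a S \<inter> a T \<subseteq> a R \<and> a R \<subseteq> a S \<oplus> a T \<longleftrightarrow> S \<inter> T \<subseteq> R \<and> R \<subseteq> S \<oplus> T"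
    if "R \<in> Gr k" "subspace_adjacent S T"
  proof (cases "R = S \<or> R = T")
    case True
    have sub: "subspace S" "subspace T" "subspace (a S)" "subspace (a T)"
      using S T a_in by (auto simp: grassmannian_iff)
    then have "S \<subseteq> S \<oplus> T" "T \<subseteq> S \<oplus> T" "a S \<subseteq> a S \<oplus> a T" "a T \<subseteq> a S \<oplus> a T"
      by (simp_all add: ssum_upper1 ssum_upper2)
    then show ?thesis
      using True by auto
  next
    case False
    then show ?thesis
      using pencil that adj by blast
  qed
qed

end

section \<open>Triangles in a Grassmannian\<close>

context finite_dim_space
begin

text \<open>A hyperplane of \<open>S\<close> containing \<open>S \<inter> T\<close>, together with a vector \<open>t\<close> of \<open>T - S\<close>, spans a neighbour of
\<open>S\<close> that has a larger intersection with \<open>T\<close>.\<close>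

lemma grassmannian_connected [consumes 2, case_names start step]:
  assumes "S \<in> Gr k" "T \<in> Gr k"
    and "P S"
    and step: "\<And>X Y. X \<in> Gr k \<Longrightarrow> Y \<in> Gr k \<Longrightarrow> subspace_adjacent X Y \<Longrightarrow> P X \<Longrightarrow> P Y"
  shows "P T"
  using assms(1,3)
proof (induction "k - dim (S \<inter> T)" arbitrary: S rule: less_induct)
  case less
  have sub: "subspace S" "subspace T" "dim S = k" "dim T = k"
    using less.prems(1) assms(2) by (simp_all add: grassmannian_iff)
  show ?case
  proof (cases "T \<subseteq> S")
    case True
    then have "T = S"
      using dim_subset_eq[of T S] sub by simp
    then show ?thesis
      using less.prems(2) by simp
  next
    case False
    then obtain t where t: "t \<in> T" "t \<notin> S"
      by blast
    have "\<not> S \<subseteq> T"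
      using dim_subset_eq[of S T] sub False by auto
    then have "dim (S \<inter> T) < k"
      using dim_subset_eq[of "S \<inter> T" S] dim_mono[of "S \<inter> T" S] sub by fastforce
    moreover from this have "dim (S \<inter> T) \<le> k - 1" "k - 1 \<le> dim S"
      using sub by simp_all
    ultimately obtain N where N: "subspace N" "S \<inter> T \<subseteq> N" "N \<subseteq> S" "dim N = k - 1"
      using ex_subspace_between[OF subspace_Int[OF sub(1,2)] sub(1) Int_lower1, of "k - 1"] by auto
    define S1 where "S1 = N \<oplus> line t"
    have "t \<notin> N"
      using N t by blast
    then have S1: "S1 \<in> Gr k"
      using N \<open>dim (S \<inter> T) < k\<close> by (simp add: S1_def grassmannian_iff dim_ssum_line)
    have tS1: "t \<in> S1"
      using N by (simp add: S1_def ssum_line_self)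
    have adj: "subspace_adjacent S S1"
      using adjacent_of_Int[OF less.prems(1) S1 _ N(1,3)] ssum_upper1[of "line t" N] N(4) tS1 t
        \<open>dim (S \<inter> T) < k\<close> unfolding S1_def by auto
    have subS1: "subspace S1"
      using S1 by (simp add: grassmannian_iff)
    have "(S \<inter> T) \<oplus> line t \<subseteq> S1 \<inter> T"
    proof (rule ssum_line_least)
      show "S \<inter> T \<subseteq> S1 \<inter> T"
        using N(2) ssum_upper1[of "line t" N] unfolding S1_def by auto
    qed (use sub subS1 tS1 t in auto)
    then have "dim ((S \<inter> T) \<oplus> line t) \<le> dim (S1 \<inter> T)"
      using sub subS1 by (intro dim_mono) auto
    then have "dim (S \<inter> T) < dim (S1 \<inter> T)"
      using dim_ssum_line[of "S \<inter> T" t] sub t by simp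
    then have "k - dim (S1 \<inter> T) < k - dim (S \<inter> T)"
      using \<open>dim (S \<inter> T) < k\<close> by simp
    then show ?thesis
      using less.hyps[OF _ S1] step[OF less.prems(1) S1 adj less.prems(2)] by blast
  qed
qed

text \<open>The star of adjacent \<open>S\<close> and \<open>T\<close> consists of the elements of \<open>Gr k\<close> containing \<open>S \<inter> T\<close>, their top
of those contained in \<open>S \<oplus> T\<close>, and their pencil is the intersection of the two.  The common
neighbours of \<open>S\<close> and \<open>T\<close> are in one of them: if the hyperplanes \<open>S \<inter> R\<close> and \<open>T \<inter> R\<close> of \<open>R\<close> are
distinct, then they span \<open>R\<close>, and \<open>R\<close> is in the top; otherwise they equal \<open>S \<inter> T\<close>.\<close>

lemma adjacent_third_iff:
  assumes S: "S \<in> Gr k" and T: "T \<in> Gr k" and R: "R \<in> Gr k"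
    and ST: "subspace_adjacent S T" and ne: "R \<noteq> S" "R \<noteq> T"
  shows "subspace_adjacent S R \<and> subspace_adjacent T R \<longleftrightarrow> S \<inter> T \<subseteq> R \<or> R \<subseteq> S \<oplus> T"
proof
  have sub: "subspace S" "subspace T" "subspace R" "dim S = k" "dim T = k" "dim R = k"
    using S T R by (simp_all add: grassmannian_iff)
  have dims: "Suc (dim (S \<inter> T)) = k" "dim (S \<oplus> T) = Suc k"
    using ST adjacent_iff[OF S T] adjacent_iff_ssum[OF S T] by simp_all
  show "subspace_adjacent S R \<and> subspace_adjacent T R" if "S \<inter> T \<subseteq> R \<or> R \<subseteq> S \<oplus> T"
    using that
  proof
    assume "S \<inter> T \<subseteq> R"
    then show ?thesis
      using adjacent_of_Int[OF S R _ _ _ _ dims(1)] adjacent_of_Int[OF T R _ _ _ _ dims(1)] ne sub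
      by auto
  next
    assume "R \<subseteq> S \<oplus> T"
    then show ?thesis
      using adjacent_of_ssum[OF S R _ _ _ _ dims(2)] adjacent_of_ssum[OF T R _ _ _ _ dims(2)] ne sub
        ssum_upper1[of T S] ssum_upper2[of S T] by auto
  qed
  assume adj: "subspace_adjacent S R \<and> subspace_adjacent T R"
  then have d: "Suc (dim (S \<inter> R)) = k" "Suc (dim (T \<inter> R)) = k"
    using adjacent_iff[OF S R] adjacent_iff[OF T R] by simp_all
  show "S \<inter> T \<subseteq> R \<or> R \<subseteq> S \<oplus> T"
  proof (cases "T \<inter> R \<subseteq> S \<inter> R")
    case True
    then have "T \<inter> R = S \<inter> T"
      using sub dims d by (intro dim_subset_eq) auto
    then show ?thesis
      by blast
  next
    case False
    let ?Q = "(S \<inter> R) \<oplus> (T \<inter> R)"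
    have up: "S \<inter> R \<subseteq> ?Q" "T \<inter> R \<subseteq> ?Q"
      using sub by (simp_all add: ssum_upper1 ssum_upper2)
    then have "dim ?Q \<noteq> dim (S \<inter> R)"
      using dim_subset_eq[of "S \<inter> R" ?Q] False sub by auto
    moreover have "dim (S \<inter> R) \<le> dim ?Q"
      using up sub by (intro dim_mono) auto
    ultimately have "k \<le> dim ?Q"
      using d by simp
    moreover have "?Q \<subseteq> R"
      using sub by (intro ssum_least) auto
    ultimately have "?Q = R"
      using dim_subset_eq[of ?Q R] sub by simp
    then show ?thesis
      using ssum_mono[of "S \<inter> R" S "T \<inter> R" T] by auto
  qed
qed

lemma same_star_adjacent:
  assumes "S \<in> Gr k" "T \<in> Gr k" "subspace_adjacent S T"
    and "A \<in> Gr k" "B \<in> Gr k" "S \<inter> T \<subseteq> A" "S \<inter> T \<subseteq> B" "A \<noteq> B"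
  shows "subspace_adjacent A B \<and> A \<inter> B = S \<inter> T"
  using adjacent_of_Int[of A k B "S \<inter> T"] adjacent_iff[of S k T] assms
  by (simp add: grassmannian_iff)

lemma same_top_adjacent:
  assumes "S \<in> Gr k" "T \<in> Gr k" "subspace_adjacent S T"
    and "A \<in> Gr k" "B \<in> Gr k" "A \<subseteq> S \<oplus> T" "B \<subseteq> S \<oplus> T" "A \<noteq> B"
  shows "subspace_adjacent A B \<and> A \<oplus> B = S \<oplus> T"
  using adjacent_of_ssum[of A k B "S \<oplus> T"] adjacent_iff_ssum[of S k T] assms
  by (simp add: grassmannian_iff)

lemma ex_star_only:
  assumes S: "S \<in> Gr k" and T: "T \<in> Gr k" and ST: "subspace_adjacent S T"
    and k: "Suc k < n"
  shows "\<exists>A \<in> Gr k. S \<inter> T \<subseteq> A \<and> \<not> A \<subseteq> S \<oplus> T"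
proof -
  have sub: "subspace S" "subspace T" "Suc (dim (S \<inter> T)) = k" "dim (S \<oplus> T) = Suc k"
    using S T ST adjacent_iff[OF S T] adjacent_iff_ssum[OF S T] by (simp_all add: grassmannian_iff)
  then have "S \<oplus> T \<noteq> UNIV"
    using k dim_UNIV by auto
  then obtain v where v: "v \<notin> S \<oplus> T"
    by blast
  then have "v \<notin> S \<inter> T"
    using sub ssum_upper1[of T S] by blast
  then have "(S \<inter> T) \<oplus> line v \<in> Gr k"
    using sub by (simp add: grassmannian_iff dim_ssum_line)
  moreover have "v \<in> (S \<inter> T) \<oplus> line v" "S \<inter> T \<subseteq> (S \<inter> T) \<oplus> line v"
    using sub by (simp_all add: ssum_line_self ssum_upper1)
  ultimately show ?thesis
    using v by blast
qed

lemma ex_top_only: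
  assumes S: "S \<in> Gr k" and T: "T \<in> Gr k" and ST: "subspace_adjacent S T"
    and k: "2 \<le> k"
  shows "\<exists>B \<in> Gr k. B \<subseteq> S \<oplus> T \<and> \<not> S \<inter> T \<subseteq> B"
proof -
  have sub: "subspace S" "subspace T" "Suc (dim (S \<inter> T)) = k" "dim (S \<oplus> T) = Suc k"
    using S T ST adjacent_iff[OF S T] adjacent_iff_ssum[OF S T] by (simp_all add: grassmannian_iff)
  then have "S \<inter> T \<noteq> {0}"
    using k dim_0 by auto
  then obtain m where m: "m \<in> S \<inter> T" "m \<noteq> 0"
    using sub subspace_0 by blast
  have mW: "m \<in> S \<oplus> T"
    using m sub ssum_upper1[of T S] by blast
  obtain C where C: "subspace C" "line m \<oplus> C = S \<oplus> T" "dim (line m) + dim C = dim (S \<oplus> T)"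
    using ex_complement_in[of "line m" "S \<oplus> T"] sub mW by (auto simp: line_least)
  have "C \<in> Gr k"
    using C sub dim_line[OF m(2)] by (simp add: grassmannian_iff)
  moreover have "C \<subseteq> S \<oplus> T"
    using C(2) ssum_upper2[of "line m" C] by simp
  moreover have "m \<notin> C"
  proof
    assume "m \<in> C"
    then have "line m \<oplus> C = C"
      using C(1) ssum_commute ssum_absorb line_least subspace_line by metis
    then show False
      using C(2,3) dim_line[OF m(2)] by simp
  qed
  ultimately show ?thesis
    using m by blast
qed

text \<open>An element \<open>A\<close> of the star outside the top meets \<open>S \<oplus> T\<close> in \<open>S \<inter> T\<close>, so for \<open>B\<close> in the top the
intersection with \<open>A\<close> is inside \<open>S \<inter> T \<inter> B\<close>, which is too small.  This fact keeps stars and tops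
apart: two members of the same star or of the same top are adjacent.\<close>

lemma star_only_top_only_not_adjacent:
  assumes S: "S \<in> Gr k" and T: "T \<in> Gr k" and ST: "subspace_adjacent S T"
    and A: "A \<in> Gr k" "S \<inter> T \<subseteq> A" "\<not> A \<subseteq> S \<oplus> T"
    and B: "B \<in> Gr k" "B \<subseteq> S \<oplus> T" "\<not> S \<inter> T \<subseteq> B"
  shows "A \<noteq> B \<and> \<not> subspace_adjacent A B"
proof
  show "A \<noteq> B"
    using A B by blast
  show "\<not> subspace_adjacent A B"
  proof
    assume "subspace_adjacent A B"
    then have AB: "Suc (dim (A \<inter> B)) = k"
      using adjacent_iff[OF A(1) B(1)] by simp
    have sub: "subspace S" "subspace T" "subspace A" "subspace B" "dim A = k"
      "Suc (dim (S \<inter> T)) = k"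
      using S T A(1) B(1) ST adjacent_iff[OF S T] by (simp_all add: grassmannian_iff)
    let ?Q = "A \<inter> (S \<oplus> T)"
    have "S \<inter> T \<subseteq> ?Q"
      using A(2) sub ssum_upper1[of T S] by blast
    moreover have "dim ?Q \<noteq> k"
      using dim_subset_eq[of ?Q A] A(3) sub by auto
    then have "dim ?Q < k"
      using dim_mono[of ?Q A] sub by simp
    ultimately have "S \<inter> T = ?Q"
      using sub by (intro dim_subset_eq) auto
    then have "A \<inter> B \<subseteq> S \<inter> T"
      using B(2) by blast
    then have "A \<inter> B = S \<inter> T"
      using AB sub by (intro dim_subset_eq) auto
    then show False
      using B(3) by blast
  qed
qed

lemma star_iff_Int_eq:
  assumes "S \<in> Gr k" "T \<in> Gr k" "R \<in> Gr k"
    "subspace_adjacent S T" "subspace_adjacent S R"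
  shows "S \<inter> T \<subseteq> R \<longleftrightarrow> S \<inter> T = S \<inter> R"
proof
  assume "S \<inter> T \<subseteq> R"
  then show "S \<inter> T = S \<inter> R"
    using adjacent_iff[of S k T] adjacent_iff[of S k R] assms
    by (intro dim_subset_eq) (auto simp: grassmannian_iff)
qed blast

lemma top_iff_ssum_eq:
  assumes "S \<in> Gr k" "T \<in> Gr k" "R \<in> Gr k"
    "subspace_adjacent S T" "subspace_adjacent S R"
  shows "R \<subseteq> S \<oplus> T \<longleftrightarrow> S \<oplus> R = S \<oplus> T"
proof
  have sub: "subspace S" "subspace T" "subspace R"
    using assms by (simp_all add: grassmannian_iff)
  assume "R \<subseteq> S \<oplus> T"
  then have "S \<oplus> R \<subseteq> S \<oplus> T"
    using sub by (simp add: ssum_least ssum_upper1)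
  then show "S \<oplus> R = S \<oplus> T"
    using adjacent_iff_ssum[of S k T] adjacent_iff_ssum[of S k R] assms sub
    by (intro dim_subset_eq) simp_all
next
  have "subspace S"
    using assms by (simp add: grassmannian_iff)
  then show "R \<subseteq> S \<oplus> T" if "S \<oplus> R = S \<oplus> T"
    using that ssum_upper2[of S R] by simp
qed

lemma ex_adjacent_with_Int:
  assumes X: "X \<in> Gr j" and j: "Suc j < n"
  shows "\<exists>S \<in> Gr (Suc j). \<exists>T \<in> Gr (Suc j). subspace_adjacent S T \<and> S \<inter> T = X"
proof -
  have subX: "subspace X" "dim X = j"
    using X by (simp_all add: grassmannian_iff)
  then have "X \<noteq> UNIV"
    using j dim_UNIV by auto
  then obtain x where x: "x \<notin> X"
    by blast
  define S where "S = X \<oplus> line x"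
  have S: "subspace S" "dim S = Suc j" "X \<subseteq> S"
    using subX x by (simp_all add: S_def dim_ssum_line ssum_upper1)
  then have "S \<noteq> UNIV"
    using j dim_UNIV by auto
  then obtain y where y: "y \<notin> S"
    by blast
  define T where "T = X \<oplus> line y"
  have "y \<notin> X"
    using S y by blast
  then have T: "subspace T" "dim T = Suc j" "X \<subseteq> T" "y \<in> T"
    using subX by (simp_all add: T_def dim_ssum_line ssum_upper1 ssum_line_self)
  have "S \<in> Gr (Suc j)" "T \<in> Gr (Suc j)" "S \<noteq> T"
    using S T y by (auto simp: grassmannian_iff)
  then show ?thesis
    using adjacent_of_Int[of S "Suc j" T X] S T subX by blast
qed

lemma adjacent_iff_common_superspace:
  assumes "S \<in> Gr j" "T \<in> Gr j"
  shows "subspace_adjacent S T \<longleftrightarrow> S \<noteq> T \<and> (\<exists>Y \<in> Gr (Suc j). S \<subseteq> Y \<and> T \<subseteq> Y)"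
proof
  assume adj: "subspace_adjacent S T"
  have "S \<oplus> T \<in> Gr (Suc j)" "S \<subseteq> S \<oplus> T" "T \<subseteq> S \<oplus> T"
    using assms adj by (simp_all add: adjacent_iff_ssum grassmannian_iff ssum_upper1 ssum_upper2)
  then show "S \<noteq> T \<and> (\<exists>Y \<in> Gr (Suc j). S \<subseteq> Y \<and> T \<subseteq> Y)"
    using adj adjacent_not_refl by blast
next
  assume "S \<noteq> T \<and> (\<exists>Y \<in> Gr (Suc j). S \<subseteq> Y \<and> T \<subseteq> Y)"
  then obtain Y where "S \<noteq> T" "Y \<in> Gr (Suc j)" "S \<subseteq> Y" "T \<subseteq> Y"
    by blast
  then show "subspace_adjacent S T"
    using adjacent_of_ssum[OF assms, of Y] by (simp add: grassmannian_iff)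
qed

lemma grassmannian_0: "Gr 0 = {{0}}"
  using dim_eq_0 dim_0 by (auto simp: grassmannian_iff)

lemma ex_grassmannian: "j \<le> n \<Longrightarrow> \<exists>X. X \<in> Gr j"
  using ex_subspace_between[of "{0}" UNIV j] dim_0 dim_UNIV by (auto simp: grassmannian_iff)

lemma grassmannian_ex_other:
  assumes Z: "Z \<in> Gr i" and i: "0 < i" "i < n"
  shows "\<exists>Z' \<in> Gr i. Z' \<noteq> Z"
proof -
  have "Z \<noteq> UNIV" "subspace Z"
    using Z i dim_UNIV by (auto simp: grassmannian_iff)
  then obtain v where v: "v \<notin> Z" "v \<noteq> 0"
    using subspace_0 by blast
  then obtain Z' where Z': "subspace Z'" "line v \<subseteq> Z'" "dim Z' = i"
    using ex_subspace_between[of "line v" UNIV i] dim_line[OF v(2)] dim_UNIV i by auto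
  then have "v \<in> Z'"
    using line_least by blast
  then show ?thesis
    using Z' v(1) by (auto simp: grassmannian_iff)
qed

end

section \<open>Maps between Grassmannians that preserve pencils\<close>

locale two_spaces =
  V: finite_dim_space scale1 n + W: finite_dim_space scale2 n
  for scale1 :: "'k::division_ring \<Rightarrow> 'v::ab_group_add \<Rightarrow> 'v"  (infixr \<open>*\<^sub>1\<close> 75)
    and scale2 :: "'l::division_ring \<Rightarrow> 'w::ab_group_add \<Rightarrow> 'w"  (infixr \<open>*\<^sub>2\<close> 75)
    and n :: nat
begin

text \<open>Near the pair \<open>S\<close>, \<open>T\<close> a straight map sends star to star and top to top; a twisted map interchanges
them.\<close>

definition straight :: "nat \<Rightarrow> ('v set \<Rightarrow> 'w set) \<Rightarrow> 'v set \<Rightarrow> 'v set \<Rightarrow> bool" where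
  "straight k a S T \<longleftrightarrow> (\<forall>R \<in> V.Gr k.
     (S \<inter> T \<subseteq> R \<longleftrightarrow> a S \<inter> a T \<subseteq> a R) \<and> (R \<subseteq> S \<oplus> T \<longleftrightarrow> a R \<subseteq> a S \<oplus> a T))"

definition twisted :: "nat \<Rightarrow> ('v set \<Rightarrow> 'w set) \<Rightarrow> 'v set \<Rightarrow> 'v set \<Rightarrow> bool" where
  "twisted k a S T \<longleftrightarrow> (\<forall>R \<in> V.Gr k.
     (S \<inter> T \<subseteq> R \<longleftrightarrow> a R \<subseteq> a S \<oplus> a T) \<and> (R \<subseteq> S \<oplus> T \<longleftrightarrow> a S \<inter> a T \<subseteq> a R))"

lemma straight_commute: "straight k a S T \<longleftrightarrow> straight k a T S"
  by (simp add: straight_def Int_commute ssum_commute)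

end

locale pencil_map = two_spaces scale1 scale2 n
  for scale1 :: "'k::division_ring \<Rightarrow> 'v::ab_group_add \<Rightarrow> 'v"  (infixr \<open>*\<^sub>1\<close> 75)
    and scale2 :: "'l::division_ring \<Rightarrow> 'w::ab_group_add \<Rightarrow> 'w"  (infixr \<open>*\<^sub>2\<close> 75)
    and n :: nat +
  fixes k m :: nat and a :: "'v set \<Rightarrow> 'w set"
  assumes bij: "bij_betw a (V.Gr k) (W.Gr m)"
    and adj: "\<And>S T. S \<in> V.Gr k \<Longrightarrow> T \<in> V.Gr k \<Longrightarrow>
      W.subspace_adjacent (a S) (a T) \<longleftrightarrow> V.subspace_adjacent S T"
    and pencil: "\<And>S T R. S \<in> V.Gr k \<Longrightarrow> T \<in> V.Gr k \<Longrightarrow>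
      R \<in> V.Gr k \<Longrightarrow> V.subspace_adjacent S T \<Longrightarrow>
      a S \<inter> a T \<subseteq> a R \<and> a R \<subseteq> a S \<oplus> a T \<longleftrightarrow> S \<inter> T \<subseteq> R \<and> R \<subseteq> S \<oplus> T"
begin

lemma a_in: "S \<in> V.Gr k \<Longrightarrow> a S \<in> W.Gr m"
  using bij bij_betwE by blast

lemma a_eq: "S \<in> V.Gr k \<Longrightarrow> T \<in> V.Gr k \<Longrightarrow> a S = a T \<longleftrightarrow> S = T"
  using bij by (auto simp: bij_betw_def inj_on_def)

lemma star_or_top:
  assumes "S \<in> V.Gr k" "T \<in> V.Gr k" "R \<in> V.Gr k"
    "V.subspace_adjacent S T"
  shows "a S \<inter> a T \<subseteq> a R \<or> a R \<subseteq> a S \<oplus> a T \<longleftrightarrow> S \<inter> T \<subseteq> R \<or> R \<subseteq> S \<oplus> T"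
proof (cases "R = S \<or> R = T")
  case True
  then show ?thesis
    by auto
next
  case False
  then have "a R \<noteq> a S" "a R \<noteq> a T"
    using assms a_eq by simp_all
  then show ?thesis
    using V.adjacent_third_iff[of S k T R] W.adjacent_third_iff[of "a S" m "a T" "a R"] False
      assms a_in adj by simp
qed

text \<open>The image of the union of star and top, and of the pencil, is known.  So every element of the
star outside the pencil goes to exactly one of star and top.  It cannot go to the same side as an
element of the top outside the pencil, as these two are not adjacent.  Both kinds of elements exist,
and a single one of them decides where all the others go.\<close>

lemma straight_or_twisted:
  assumes S: "S \<in> V.Gr k" and T: "T \<in> V.Gr k" and ST: "V.subspace_adjacent S T"
    and k: "2 \<le> k" "Suc k < n"
  shows "straight k a S T \<noteq> twisted k a S T"
proof -
  let ?s = "\<lambda>R. S \<inter> T \<subseteq> R" and ?t = "\<lambda>R. R \<subseteq> S \<oplus> T"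
  let ?s' = "\<lambda>R. a S \<inter> a T \<subseteq> a R" and ?t' = "\<lambda>R. a R \<subseteq> a S \<oplus> a T"
  obtain A where A: "A \<in> V.Gr k" "?s A" "\<not> ?t A"
    using V.ex_star_only[OF S T ST k(2)] by blast
  obtain B where B: "B \<in> V.Gr k" "?t B" "\<not> ?s B"
    using V.ex_top_only[OF S T ST k(1)] by blast
  have both: "?s' R \<and> ?t' R \<longleftrightarrow> ?s R \<and> ?t R" and any: "?s' R \<or> ?t' R \<longleftrightarrow> ?s R \<or> ?t R"
    if "R \<in> V.Gr k" for R
    using pencil[OF S T that ST] star_or_top[OF S T that ST] by simp_all
  have apart: "\<not> (?s' R \<and> ?s' Q) \<and> \<not> (?t' R \<and> ?t' Q)"
    if R: "R \<in> V.Gr k" "?s R" "\<not> ?t R" and Q: "Q \<in> V.Gr k" "?t Q" "\<not> ?s Q" for R Q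
  proof -
    have RQ: "R \<noteq> Q" "\<not> V.subspace_adjacent R Q"
      using V.star_only_top_only_not_adjacent[OF S T ST R Q] by simp_all
    then have "a R \<noteq> a Q" "\<not> W.subspace_adjacent (a R) (a Q)"
      using adj[OF R(1) Q(1)] a_eq[OF R(1) Q(1)] by simp_all
    then show ?thesis
      using W.same_star_adjacent[OF a_in[OF S] a_in[OF T] _ a_in[OF R(1)] a_in[OF Q(1)]]
        W.same_top_adjacent[OF a_in[OF S] a_in[OF T] _ a_in[OF R(1)] a_in[OF Q(1)]] adj[OF S T] ST
      by blast
  qed
  show ?thesis
  proof (cases "?s' A")
    case True
    then have "\<not> ?t' A" "\<not> ?s' B" "?t' B"
      using both[OF A(1)] apart[OF A B] any[OF B(1)] A B by simp_all
    have "(?s R \<longleftrightarrow> ?s' R) \<and> (?t R \<longleftrightarrow> ?t' R)" if R: "R \<in> V.Gr k" for R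
      using both[OF R] any[OF R] apart[OF A R] apart[OF R _ _ B] True \<open>?t' B\<close> by argo
    then have "straight k a S T"
      by (simp add: straight_def)
    moreover have "\<not> twisted k a S T"
      using A \<open>\<not> ?t' A\<close> by (auto simp: twisted_def)
    ultimately show ?thesis
      by simp
  next
    case False
    then have "?t' A" "\<not> ?t' B" "?s' B"
      using any[OF A(1)] apart[OF A B] any[OF B(1)] A B by simp_all
    have "(?s R \<longleftrightarrow> ?t' R) \<and> (?t R \<longleftrightarrow> ?s' R)" if R: "R \<in> V.Gr k" for R
      using both[OF R] any[OF R] apart[OF A R] apart[OF R _ _ B] \<open>?t' A\<close> \<open>?s' B\<close> by argo
    then have "twisted k a S T"
      by (simp add: twisted_def)
    moreover have "\<not> straight k a S T"
      using A False by (auto simp: straight_def)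
    ultimately show ?thesis
      by simp
  qed
qed

text \<open>The relations of star and top among three pairwise adjacent elements are symmetric.  A map that is
straight at one side of a triangle and twisted at another would therefore identify the two
relations, so that all three are on one pencil; but the sides of such a triangle have the same star
and the same top.\<close>

lemma straight_triangle:
  assumes S: "S \<in> V.Gr k" and T: "T \<in> V.Gr k" and R: "R \<in> V.Gr k"
    and ST: "V.subspace_adjacent S T" and SR: "V.subspace_adjacent S R"
    and TR: "V.subspace_adjacent T R"
    and k: "2 \<le> k" "Suc k < n" and straight: "straight k a S T"
  shows "straight k a S R"
proof (rule ccontr)
  assume not_straight: "\<not> straight k a S R"
  then have twisted: "twisted k a S R"
    using straight_or_twisted[OF S R SR k] by blast
  note aS = a_in[OF S] and aT = a_in[OF T] and aR = a_in[OF R]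
  have aST: "W.subspace_adjacent (a S) (a T)" and aSR: "W.subspace_adjacent (a S) (a R)"
    using adj S T R ST SR by simp_all
  have star: "S \<inter> T \<subseteq> R \<longleftrightarrow> S \<inter> R \<subseteq> T" and top: "R \<subseteq> S \<oplus> T \<longleftrightarrow> T \<subseteq> S \<oplus> R"
    using V.star_iff_Int_eq[OF S T R ST SR] V.star_iff_Int_eq[OF S R T SR ST]
      V.top_iff_ssum_eq[OF S T R ST SR] V.top_iff_ssum_eq[OF S R T SR ST] by metis+
  have star': "a S \<inter> a T \<subseteq> a R \<longleftrightarrow> a S \<inter> a R \<subseteq> a T"
    and top': "a R \<subseteq> a S \<oplus> a T \<longleftrightarrow> a T \<subseteq> a S \<oplus> a R"
    using W.star_iff_Int_eq[OF aS aT aR aST aSR] W.star_iff_Int_eq[OF aS aR aT aSR aST]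
      W.top_iff_ssum_eq[OF aS aT aR aST aSR] W.top_iff_ssum_eq[OF aS aR aT aSR aST] by metis+
  have "R \<noteq> S" "R \<noteq> T"
    using SR TR V.adjacent_not_refl by blast+
  then have "S \<inter> T \<subseteq> R \<or> R \<subseteq> S \<oplus> T"
    using V.adjacent_third_iff[OF S T R ST] SR TR by simp
  moreover have "S \<inter> T \<subseteq> R \<longleftrightarrow> a S \<inter> a T \<subseteq> a R" "R \<subseteq> S \<oplus> T \<longleftrightarrow> a R \<subseteq> a S \<oplus> a T"
    using straight R by (simp_all add: straight_def)
  moreover have "S \<inter> R \<subseteq> T \<longleftrightarrow> a T \<subseteq> a S \<oplus> a R" "T \<subseteq> S \<oplus> R \<longleftrightarrow> a S \<inter> a R \<subseteq> a T"
    using twisted T by (simp_all add: twisted_def)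
  ultimately have "S \<inter> T \<subseteq> R" "R \<subseteq> S \<oplus> T" "a S \<inter> a T \<subseteq> a R" "a R \<subseteq> a S \<oplus> a T"
    using star top star' top' by argo+
  then have "S \<inter> R = S \<inter> T" "S \<oplus> R = S \<oplus> T" "a S \<inter> a R = a S \<inter> a T" "a S \<oplus> a R = a S \<oplus> a T"
    using V.star_iff_Int_eq[OF S T R ST SR] V.top_iff_ssum_eq[OF S T R ST SR]
      W.star_iff_Int_eq[OF aS aT aR aST aSR] W.top_iff_ssum_eq[OF aS aT aR aST aSR] by simp_all
  then show False
    using straight not_straight by (simp add: straight_def)
qed

text \<open>The pairs \<open>S\<close>, \<open>T\<close> and \<open>S\<close>, \<open>T'\<close> are joined by two triangles, with an element \<open>Q\<close> that lies both in
the top of the first pair and in the star of the second.\<close>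

lemma straight_neighbours:
  assumes S: "S \<in> V.Gr k" and T: "T \<in> V.Gr k" and T': "T' \<in> V.Gr k"
    and ST: "V.subspace_adjacent S T" and ST': "V.subspace_adjacent S T'"
    and k: "2 \<le> k" "Suc k < n" and straight: "straight k a S T"
  shows "straight k a S T'"
proof -
  have sub: "V.subspace S" "V.subspace T" "V.subspace T'" "V.dim S = k"
    using S T T' by (simp_all add: V.grassmannian_iff)
  have "\<not> S \<oplus> T \<subseteq> S"
    using V.dim_mono[of "S \<oplus> T" S] V.adjacent_iff_ssum[OF S T] ST sub by auto
  then obtain x where x: "x \<in> S \<oplus> T" "x \<notin> S"
    by blast
  define Q where "Q = (S \<inter> T') \<oplus> V.line x"
  have Q: "Q \<in> V.Gr k"
    using V.adjacent_iff[OF S T'] ST' sub x by (simp add: Q_def V.grassmannian_iff V.dim_ssum_line)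
  have star: "S \<inter> T' \<subseteq> Q" "x \<in> Q"
    using sub by (simp_all add: Q_def V.ssum_upper1 V.ssum_line_self)
  have "S \<inter> T' \<subseteq> S \<oplus> T"
    using V.ssum_upper1[of T S] sub by blast
  then have top: "Q \<subseteq> S \<oplus> T"
    unfolding Q_def using sub x by (intro V.ssum_line_least) simp_all
  have "S \<noteq> Q"
    using star x by blast
  then have SQ: "V.subspace_adjacent S Q"
    using V.same_star_adjacent[OF S T' ST' S Q] star by simp
  have "straight k a S Q"
  proof (cases "Q = T")
    case False
    then have "V.subspace_adjacent T Q"
      using V.same_top_adjacent[OF S T ST T Q] top V.ssum_upper2[of S T] sub by simp
    then show ?thesis
      using straight_triangle[OF S T Q ST SQ _ k straight] by simp
  qed (use straight in simp)
  show ?thesis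
  proof (cases "Q = T'")
    case False
    then have "V.subspace_adjacent Q T'"
      using V.same_star_adjacent[OF S T' ST' Q T'] star by simp
    then show ?thesis
      using straight_triangle[OF S Q T' SQ ST' _ k \<open>straight k a S Q\<close>] by simp
  qed (use \<open>straight k a S Q\<close> in simp)
qed

lemma straight_spreads:
  assumes S: "S \<in> V.Gr k" and T: "T \<in> V.Gr k"
    and ST: "V.subspace_adjacent S T" and k: "2 \<le> k" "Suc k < n" and straight: "straight k a S T"
    and S': "S' \<in> V.Gr k"
  shows "\<forall>T' \<in> V.Gr k. V.subspace_adjacent S' T' \<longrightarrow> straight k a S' T'"
  using S S'
proof (induction rule: V.grassmannian_connected)
  case start
  show ?case
    using straight_neighbours[OF S T _ ST _ k straight] by blast
next
  case (step X Y)
  then have "straight k a Y X"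
    using straight_commute by blast
  then show ?case
    using straight_neighbours[OF step(2,1) _ _ _ k] step(3) V.adjacent_commute by blast
qed

text \<open>For points the star is everything and the top is the pencil, and for hyperplanes it is the other
way round; so here the pencils alone decide.\<close>

lemma extremal_straight_or_twisted:
  assumes n: "2 \<le> n" and k: "k = 1 \<or> Suc k = n" and m: "m = k \<or> m = n - k"
    and S: "S \<in> V.Gr k" and T: "T \<in> V.Gr k" and ST: "V.subspace_adjacent S T"
  shows "if m = k then straight k a S T else twisted k a S T"
proof -
  have aST: "W.subspace_adjacent (a S) (a T)"
    using adj[OF S T] ST by simp
  have sub: "V.subspace S" "V.subspace T" "W.subspace (a S)" "W.subspace (a T)"
    using S T a_in[OF S] a_in[OF T] by (simp_all add: V.grassmannian_iff W.grassmannian_iff)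
  have V1: "S \<inter> T = {0}" if "k = 1"
    using V.adjacent_iff[OF S T] ST that sub V.dim_eq_0[of "S \<inter> T"] by simp
  have W1: "a S \<inter> a T = {0}" if "m = 1"
    using W.adjacent_iff[OF a_in[OF S] a_in[OF T]] aST that sub W.dim_eq_0[of "a S \<inter> a T"] by simp
  have Vn: "S \<oplus> T = UNIV" if "Suc k = n"
    using V.adjacent_iff_ssum[OF S T] ST that sub V.dim_eq_n[of "S \<oplus> T"] by simp
  have Wn: "a S \<oplus> a T = UNIV" if "Suc m = n"
    using W.adjacent_iff_ssum[OF a_in[OF S] a_in[OF T]] aST that sub W.dim_eq_n[of "a S \<oplus> a T"]
    by simp
  have zero: "{0} \<subseteq> R" "{0} \<subseteq> a R" if "R \<in> V.Gr k" for R
    using that a_in[OF that] V.subspace_0 W.subspace_0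
    by (simp_all add: V.grassmannian_iff W.grassmannian_iff)
  show ?thesis
  proof (cases "m = k")
    case True
    have "(S \<inter> T \<subseteq> R \<longleftrightarrow> a S \<inter> a T \<subseteq> a R) \<and> (R \<subseteq> S \<oplus> T \<longleftrightarrow> a R \<subseteq> a S \<oplus> a T)"
      if R: "R \<in> V.Gr k" for R
      using k
    proof
      assume "k = 1"
      then show ?thesis
        using True V1 W1 pencil[OF S T R ST] zero[OF R] by simp
    next
      assume "Suc k = n"
      then show ?thesis
        using True Vn Wn pencil[OF S T R ST] by simp
    qed
    then show ?thesis
      using True by (simp add: straight_def)
  next
    case False
    then have km: "k = 1 \<and> Suc m = n \<or> Suc k = n \<and> m = 1"
      using k m n by auto
    have "(S \<inter> T \<subseteq> R \<longleftrightarrow> a R \<subseteq> a S \<oplus> a T) \<and> (R \<subseteq> S \<oplus> T \<longleftrightarrow> a S \<inter> a T \<subseteq> a R)"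
      if R: "R \<in> V.Gr k" for R
      using km
    proof
      assume "k = 1 \<and> Suc m = n"
      then show ?thesis
        using V1 Wn pencil[OF S T R ST] zero[OF R] by simp
    next
      assume "Suc k = n \<and> m = 1"
      then show ?thesis
        using Vn W1 pencil[OF S T R ST] zero[OF R] by simp
    qed
    then show ?thesis
      using False by (simp add: twisted_def)
  qed
qed

lemma straight_or_twisted_everywhere:
  assumes k: "1 \<le> k" "k < n" and n: "2 \<le> n" and m: "m = k \<or> m = n - k"
  shows "(\<forall>S \<in> V.Gr k. \<forall>T \<in> V.Gr k. V.subspace_adjacent S T \<longrightarrow> straight k a S T)
    \<or> (\<forall>S \<in> V.Gr k. \<forall>T \<in> V.Gr k. V.subspace_adjacent S T \<longrightarrow> twisted k a S T)"
proof (cases "k = 1 \<or> Suc k = n")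
  case True
  then show ?thesis
    using extremal_straight_or_twisted[OF n _ m] by (cases "m = k") auto
next
  case False
  then have k2: "2 \<le> k" "Suc k < n"
    using k by simp_all
  then show ?thesis
    using straight_or_twisted straight_spreads by blast
qed

end

section \<open>Descent to points\<close>

context two_spaces
begin

text \<open>Only the behaviour on stars is carried along in the descent, because stars in \<open>Gr j\<close>
correspond to the elements of \<open>Gr (j - 1)\<close>.\<close>

definition star_map :: "nat \<Rightarrow> nat \<Rightarrow> ('v set \<Rightarrow> 'w set) \<Rightarrow> bool" where
  "star_map j i c \<longleftrightarrow> bij_betw c (V.Gr j) (W.Gr i) \<and>
     (\<forall>S \<in> V.Gr j. \<forall>T \<in> V.Gr j.
        W.subspace_adjacent (c S) (c T) \<longleftrightarrow> V.subspace_adjacent S T) \<and>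
     (\<forall>S \<in> V.Gr j. \<forall>T \<in> V.Gr j. \<forall>R \<in> V.Gr j.
        V.subspace_adjacent S T \<longrightarrow> (c S \<inter> c T \<subseteq> c R \<longleftrightarrow> S \<inter> T \<subseteq> R))"

definition preserves_incidence ::
    "nat \<Rightarrow> nat \<Rightarrow> ('v set \<Rightarrow> 'w set) \<Rightarrow> ('v set \<Rightarrow> 'w set) \<Rightarrow> bool" where
  "preserves_incidence j j' c d \<longleftrightarrow>
     (\<forall>X \<in> V.Gr j. \<forall>Y \<in> V.Gr j'. X \<subseteq> Y \<longleftrightarrow> c X \<subseteq> d Y)"

text \<open>The star of \<open>X\<close> is that of any two adjacent \<open>S\<close>, \<open>T\<close> with intersection \<open>X\<close>, so its image is the star
of \<open>c S \<inter> c T\<close>, whatever the choice of \<open>S\<close> and \<open>T\<close>.\<close>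

lemma star_map_descend:
  assumes star: "star_map (Suc j) i c" and j: "Suc j < n"
  shows "\<exists>i' c'. i = Suc i' \<and> bij_betw c' (V.Gr j) (W.Gr i') \<and>
    preserves_incidence j (Suc j) c' c"
proof -
  have bij: "bij_betw c (V.Gr (Suc j)) (W.Gr i)"
    using star by (simp add: star_map_def)
  have adj: "W.subspace_adjacent (c S) (c T) \<longleftrightarrow> V.subspace_adjacent S T"
      if "S \<in> V.Gr (Suc j)" "T \<in> V.Gr (Suc j)" for S T
    using star that by (auto simp: star_map_def)
  have c_in: "c S \<in> W.Gr i" if "S \<in> V.Gr (Suc j)" for S
    using bij that bij_betwE by blast
  let ?Q = "\<lambda>X S T. S \<in> V.Gr (Suc j) \<and> T \<in> V.Gr (Suc j) \<and>
    V.subspace_adjacent S T \<and> S \<inter> T = X"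
  have "\<forall>X. \<exists>S T. X \<in> V.Gr j \<longrightarrow> ?Q X S T"
    using V.ex_adjacent_with_Int[OF _ j] by blast
  then obtain s t where "\<forall>X. X \<in> V.Gr j \<longrightarrow> ?Q X (s X) (t X)"
    by metis
  then have st: "s X \<in> V.Gr (Suc j)" "t X \<in> V.Gr (Suc j)"
    "V.subspace_adjacent (s X) (t X)" "s X \<inter> t X = X" if "X \<in> V.Gr j" for X
    using that by simp_all
  define c' where "c' X = c (s X) \<inter> c (t X)" for X
  have dim_Int: "Suc (W.dim (c S \<inter> c T)) = i"
    if "S \<in> V.Gr (Suc j)" "T \<in> V.Gr (Suc j)" "V.subspace_adjacent S T" for S T
    using W.adjacent_iff[OF c_in[OF that(1)] c_in[OF that(2)]] adj that by simp
  have "\<exists>X. X \<in> V.Gr j"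
    using V.ex_grassmannian j by simp
  then obtain i' where i': "i = Suc i'"
    using dim_Int st by metis
  have subc: "W.subspace (c S)" if "S \<in> V.Gr (Suc j)" for S
    using c_in[OF that] by (simp add: W.grassmannian_iff)
  have c'_in: "c' X \<in> W.Gr i'" if "X \<in> V.Gr j" for X
    using dim_Int[OF st(1-3)[OF that]] st[OF that] subc i' by (simp add: c'_def W.grassmannian_iff)
  have inc: "X \<subseteq> R \<longleftrightarrow> c' X \<subseteq> c R" if "X \<in> V.Gr j" "R \<in> V.Gr (Suc j)" for X R
    using star st[OF that(1)] that(2) unfolding c'_def star_map_def by metis
  have "inj_on c' (V.Gr j)"
  proof (rule inj_onI)
    fix X Y assume X: "X \<in> V.Gr j" and Y: "Y \<in> V.Gr j" and eq: "c' X = c' Y"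
    have "c' X \<subseteq> c (s Y)" "c' X \<subseteq> c (t Y)"
      unfolding eq by (simp_all add: c'_def)
    then have "X \<subseteq> Y"
      using inc[OF X] st[OF Y] by blast
    then show "X = Y"
      using V.dim_subset_eq[of X Y] X Y by (simp add: V.grassmannian_iff)
  qed
  moreover have "c' ` V.Gr j = W.Gr i'"
  proof
    show "c' ` V.Gr j \<subseteq> W.Gr i'"
      using c'_in by blast
    show "W.Gr i' \<subseteq> c' ` V.Gr j"
    proof
      fix Y assume Y: "Y \<in> W.Gr i'"
      have "\<exists>S T. S \<in> V.Gr (Suc j) \<and> T \<in> V.Gr (Suc j) \<and> V.subspace_adjacent S T"
        using \<open>\<exists>X. X \<in> V.Gr j\<close> st by blast
      then obtain S T where ST: "S \<in> V.Gr (Suc j)" "T \<in> V.Gr (Suc j)"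
        "V.subspace_adjacent S T"
        by blast
      then have "W.dim (c S \<oplus> c T) = Suc i"
        using W.adjacent_iff_ssum[OF c_in[OF ST(1)] c_in[OF ST(2)]] adj by simp
      then have "Suc i' < n"
        using W.dim_le_n[of "c S \<oplus> c T"] subc ST i' by simp
      then obtain S' T' where S'T': "S' \<in> W.Gr i" "T' \<in> W.Gr i"
        "W.subspace_adjacent S' T'" "S' \<inter> T' = Y"
        using W.ex_adjacent_with_Int[OF Y] i' by blast
      moreover have "W.Gr i = c ` V.Gr (Suc j)"
        using bij by (simp add: bij_betw_def)
      ultimately obtain S T where ST: "S \<in> V.Gr (Suc j)" "T \<in> V.Gr (Suc j)"
        "S' = c S" "T' = c T"
        by (metis imageE)
      have adjST: "V.subspace_adjacent S T"
        using adj[OF ST(1,2)] S'T' ST by simp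
      have subST: "V.subspace S" "V.subspace T"
        using ST by (simp_all add: V.grassmannian_iff)
      have X: "S \<inter> T \<in> V.Gr j"
        using V.adjacent_iff[OF ST(1,2)] adjST subST by (simp add: V.grassmannian_iff)
      have "c' (S \<inter> T) \<subseteq> Y"
        using inc[OF X ST(1)] inc[OF X ST(2)] ST S'T'(4) by blast
      then have "c' (S \<inter> T) = Y"
        using W.dim_subset_eq[of "c' (S \<inter> T)" Y] c'_in[OF X] Y by (simp add: W.grassmannian_iff)
      then show "Y \<in> c' ` V.Gr j"
        using X by blast
    qed
  qed
  ultimately have "bij_betw c' (V.Gr j) (W.Gr i')"
    by (simp add: bij_betw_def)
  then show ?thesis
    using i' inc unfolding preserves_incidence_def by blast
qed

text \<open>Incidence with the next Grassmannian determines adjacency, because adjacent means having a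
  common superspace one dimension larger, and it separates stars from tops: an element \<open>R\<close> of
  the star of \<open>S \<inter> T\<close> outside the top of \<open>S \<oplus> T\<close> forms a triangle with \<open>S\<close> and \<open>T\<close> whose image
  is not in a top, hence is in a star.  The elements of the star inside the top are reached with
  \<open>T\<close> replaced by some \<open>A\<close> outside it.\<close>

lemma preserves_incidence_star_map:
  assumes c: "bij_betw c (V.Gr j) (W.Gr i)"
    and d: "bij_betw d (V.Gr (Suc j)) (W.Gr (Suc i))"
    and inc: "preserves_incidence j (Suc j) c d" and j: "Suc j < n"
  shows "star_map j i c"
proof -
  have c_in: "c S \<in> W.Gr i" if "S \<in> V.Gr j" for S
    using c that bij_betwE by blast
  have d_in: "d Y \<in> W.Gr (Suc i)" if "Y \<in> V.Gr (Suc j)" for Y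
    using d that bij_betwE by blast
  have c_eq: "c S = c T \<longleftrightarrow> S = T" if "S \<in> V.Gr j" "T \<in> V.Gr j" for S T
    using c that by (auto simp: bij_betw_def inj_on_def)
  have d_onto: "d ` V.Gr (Suc j) = W.Gr (Suc i)"
    using d by (simp add: bij_betw_def)
  have inc': "X \<subseteq> Y \<longleftrightarrow> c X \<subseteq> d Y" if "X \<in> V.Gr j" "Y \<in> V.Gr (Suc j)" for X Y
    using inc that by (simp add: preserves_incidence_def)
  have adj: "W.subspace_adjacent (c S) (c T) \<longleftrightarrow> V.subspace_adjacent S T"
    if "S \<in> V.Gr j" "T \<in> V.Gr j" for S T
    using V.adjacent_iff_common_superspace[OF that]
      W.adjacent_iff_common_superspace[OF c_in[OF that(1)] c_in[OF that(2)]]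
      c_eq[OF that] inc' that unfolding d_onto[symmetric] by simp
  have outside: "c S \<inter> c T \<subseteq> c R"
    if S: "S \<in> V.Gr j" and T: "T \<in> V.Gr j" and R: "R \<in> V.Gr j"
      and ST: "V.subspace_adjacent S T" and star: "S \<inter> T \<subseteq> R" and top: "\<not> R \<subseteq> S \<oplus> T" for S T R
  proof -
    have sub: "V.subspace S" "V.subspace T"
      using S T by (simp_all add: V.grassmannian_iff)
    have Y: "S \<oplus> T \<in> V.Gr (Suc j)"
      using V.adjacent_iff_ssum[OF S T] ST sub by (simp add: V.grassmannian_iff)
    have ne: "R \<noteq> S" "R \<noteq> T"
      using top sub V.ssum_upper1[of T S] V.ssum_upper2[of S T] by auto
    then have "V.subspace_adjacent S R \<and> V.subspace_adjacent T R"
      using V.adjacent_third_iff[OF S T R ST] star by simp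
    moreover have cne: "c R \<noteq> c S" "c R \<noteq> c T" "c S \<noteq> c T"
      using ne c_eq S T R ST V.adjacent_not_refl by auto
    ultimately have "c S \<inter> c T \<subseteq> c R \<or> c R \<subseteq> c S \<oplus> c T"
      using W.adjacent_third_iff[OF c_in[OF S] c_in[OF T] c_in[OF R]] adj S T R ST by simp
    moreover have "c S \<subseteq> d (S \<oplus> T)" "c T \<subseteq> d (S \<oplus> T)"
      using inc'[OF S Y] inc'[OF T Y] sub by (simp_all add: V.ssum_upper1 V.ssum_upper2)
    then have "c S \<oplus> c T = d (S \<oplus> T)"
      using W.adjacent_of_ssum[OF c_in[OF S] c_in[OF T] cne(3)] d_in[OF Y]
      by (simp add: W.grassmannian_iff)
    ultimately show ?thesis
      using inc'[OF R Y] top by simp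
  qed
  have star: "c S \<inter> c T \<subseteq> c R \<longleftrightarrow> S \<inter> T \<subseteq> R"
    if S: "S \<in> V.Gr j" and T: "T \<in> V.Gr j" and R: "R \<in> V.Gr j"
      and ST: "V.subspace_adjacent S T" for S T R
  proof -
    have cST: "W.subspace_adjacent (c S) (c T)"
      using adj[OF S T] ST by simp
    obtain A where A: "A \<in> V.Gr j" "S \<inter> T \<subseteq> A" "\<not> A \<subseteq> S \<oplus> T"
      using V.ex_star_only[OF S T ST j] by blast
    have cA: "c S \<inter> c T \<subseteq> c A"
      using outside[OF S T A(1) ST A(2,3)] .
    have sub: "V.subspace S" "V.subspace T" "V.subspace A"
      using S T A by (simp_all add: V.grassmannian_iff)
    show ?thesis
    proof (cases "R = S \<or> R = T")
      case True
      then show ?thesis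
        by auto
    next
      case False
      show ?thesis
      proof
        assume star: "S \<inter> T \<subseteq> R"
        show "c S \<inter> c T \<subseteq> c R"
        proof (cases "R \<subseteq> S \<oplus> T")
          case True
          have "S \<noteq> A"
            using A(3) sub V.ssum_upper1 by blast
          then have SA: "V.subspace_adjacent S A" "S \<inter> A = S \<inter> T"
            using V.same_star_adjacent[OF S T ST S A(1)] A(2) by simp_all
          have "\<not> R \<subseteq> S \<oplus> A"
          proof
            assume RSA: "R \<subseteq> S \<oplus> A"
            have SR: "V.subspace_adjacent S R"
              using V.same_star_adjacent[OF S T ST S R] star False by auto
            have "S \<oplus> R = S \<oplus> A" "S \<oplus> R = S \<oplus> T"
              using V.top_iff_ssum_eq[OF S A(1) R SA(1) SR] V.top_iff_ssum_eq[OF S T R ST SR]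
                RSA True by simp_all
            then show False
              using A(3) V.ssum_upper2[of S A] sub by simp
          qed
          then have "c S \<inter> c A \<subseteq> c R"
            using outside[OF S A(1) R SA(1)] SA(2) star by simp
          then show ?thesis
            using cA by blast
        qed (use outside[OF S T R ST star] in blast)
      next
        assume cstar: "c S \<inter> c T \<subseteq> c R"
        show "S \<inter> T \<subseteq> R"
        proof (rule ccontr)
          assume not_star: "\<not> S \<inter> T \<subseteq> R"
          have "c R \<noteq> c S" "c R \<noteq> c T"
            using False c_eq S T R by auto
          then have "V.subspace_adjacent S R \<and> V.subspace_adjacent T R"
            using W.adjacent_third_iff[OF c_in[OF S] c_in[OF T] c_in[OF R] cST] cstar adj S T R
            by simp
          then have "R \<subseteq> S \<oplus> T"
            using V.adjacent_third_iff[OF S T R ST] False not_star by simp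
          then have "A \<noteq> R" "\<not> V.subspace_adjacent A R"
            using V.star_only_top_only_not_adjacent[OF S T ST A R _ not_star] by simp_all
          moreover have "c A \<noteq> c R"
            using c_eq[OF A(1) R] \<open>A \<noteq> R\<close> by simp
          ultimately show False
            using W.same_star_adjacent[OF c_in[OF S] c_in[OF T] cST c_in[OF A(1)] c_in[OF R] cA cstar]
              adj[OF A(1) R] by simp
        qed
      qed
    qed
  qed
  show ?thesis
    unfolding star_map_def using c adj star by blast
qed

text \<open>Besides the map on \<open>Gr j\<close>, the induction retains the map on \<open>Gr (Suc j)\<close>, which
\<open>preserves_incidence_star_map\<close> needs in order to make the next step, and the incidence with the
original Grassmannian.\<close>

lemma descend:
  assumes star: "star_map k m a" and k: "k < n" and j: "j < k"
  shows "\<exists>i c d. bij_betw c (V.Gr j) (W.Gr i) \<and>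
    bij_betw d (V.Gr (Suc j)) (W.Gr (Suc i)) \<and>
    preserves_incidence j (Suc j) c d \<and> preserves_incidence j k c a"
proof -
  have "j \<le> k - 1"
    using j by simp
  then show ?thesis
  proof (induction rule: inc_induct)
    case base
    have k': "Suc (k - 1) = k"
      using j by simp
    have "star_map (Suc (k - 1)) m a" "Suc (k - 1) < n"
      using star k k' by simp_all
    from star_map_descend[OF this] obtain i' c' where "m = Suc i'"
      "bij_betw c' (V.Gr (k - 1)) (W.Gr i')" "preserves_incidence (k - 1) k c' a"
      using k' by auto
    moreover have "bij_betw a (V.Gr k) (W.Gr m)"
      using star by (simp add: star_map_def)
    ultimately show ?case
      using k' by metis
  next
    case (step j)
    have jk: "Suc j < k"
      using step.hyps by simp
    obtain i c d where c: "bij_betw c (V.Gr (Suc j)) (W.Gr i)"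
      and d: "bij_betw d (V.Gr (Suc (Suc j))) (W.Gr (Suc i))"
      and cd: "preserves_incidence (Suc j) (Suc (Suc j)) c d"
      and ca: "preserves_incidence (Suc j) k c a"
      using step.IH by blast
    have "star_map (Suc j) i c"
      using preserves_incidence_star_map[OF c d cd] jk k by simp
    then obtain i' c' where i': "i = Suc i'"
      and c': "bij_betw c' (V.Gr j) (W.Gr i')"
      and c'c: "preserves_incidence j (Suc j) c' c"
      using star_map_descend[of j i c] jk k by auto
    have "X \<subseteq> S \<longleftrightarrow> c' X \<subseteq> a S" if X: "X \<in> V.Gr j" and S: "S \<in> V.Gr k" for X S
    proof
      assume "X \<subseteq> S"
      then obtain Y where Y: "V.subspace Y" "X \<subseteq> Y" "Y \<subseteq> S" "V.dim Y = Suc j"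
        using V.ex_subspace_between[of X S "Suc j"] X S jk by (auto simp: V.grassmannian_iff)
      then have "Y \<in> V.Gr (Suc j)"
        by (simp add: V.grassmannian_iff)
      then have "c' X \<subseteq> c Y" "c Y \<subseteq> a S"
        using c'c ca Y X S unfolding preserves_incidence_def by blast+
      then show "c' X \<subseteq> a S"
        by blast
    next
      assume le: "c' X \<subseteq> a S"
      have aS: "a S \<in> W.Gr m"
        using star S by (auto simp: star_map_def dest: bij_betwE)
      have c'X: "c' X \<in> W.Gr i'"
        using c' X bij_betwE by blast
      obtain Y where Y: "V.subspace Y" "Y \<subseteq> S" "V.dim Y = Suc j"
        using V.ex_subspace_between[of "{0}" S "Suc j"] S jk V.dim_0 V.subspace_0
        by (auto simp: V.grassmannian_iff)
      then have "Y \<in> V.Gr (Suc j)"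
        by (simp add: V.grassmannian_iff)
      then have "c Y \<in> W.Gr i" "c Y \<subseteq> a S"
        using c ca Y S unfolding preserves_incidence_def by (blast dest: bij_betwE)+
      then have "i \<le> m"
        using W.dim_mono[of "c Y" "a S"] aS by (simp add: W.grassmannian_iff)
      then obtain Z where Z: "W.subspace Z" "c' X \<subseteq> Z" "Z \<subseteq> a S" "W.dim Z = i"
        using W.ex_subspace_between[of "c' X" "a S" i] c'X aS le i' by (auto simp: W.grassmannian_iff)
      then have "Z \<in> W.Gr i"
        by (simp add: W.grassmannian_iff)
      then obtain Q where Q: "Q \<in> V.Gr (Suc j)" "Z = c Q"
        using c by (auto simp: bij_betw_def)
      then have "X \<subseteq> Q" "Q \<subseteq> S"
        using c'c ca Z X S unfolding preserves_incidence_def by blast+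
      then show "X \<subseteq> S"
        by blast
    qed
    then have "preserves_incidence j k c' a"
      by (simp add: preserves_incidence_def)
    then show ?case
      using c' c c'c i' by blast
  qed
qed

text \<open>One further step leads to a bijection from \<open>Gr 0\<close> onto \<open>Gr (i - 1)\<close>.  The former has one element
only, and the latter has several unless \<open>i - 1\<close> is \<open>0\<close>.\<close>

lemma star_map_points:
  assumes star: "star_map 1 i c" and n: "2 \<le> n"
  shows "i = 1"
proof -
  obtain i' c' where i': "i = Suc i'" and c': "bij_betw c' (V.Gr 0) (W.Gr i')"
    using star_map_descend[of 0 i c] star n by auto
  obtain P where P: "P \<in> V.Gr 1"
    using V.ex_grassmannian[of 1] n by auto
  then have "c P \<in> W.Gr i"
    using star by (auto simp: star_map_def dest: bij_betwE)
  then have "i' < n"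
    using W.dim_le_n[of "c P"] i' by (simp add: W.grassmannian_iff)
  moreover have eq: "W.Gr i' = {c' {0}}"
    using c' by (simp add: V.grassmannian_0 bij_betw_def)
  ultimately have "i' = 0"
    using W.grassmannian_ex_other[of "c' {0}" i'] by auto
  then show ?thesis
    using i' by simp
qed

end

context pencil_map
begin

text \<open>For \<open>k = 1\<close> the top condition is collinearity.  Otherwise the descent ends with maps on points and
on lines that preserve incidence.\<close>

lemma straight_induced_by_points:
  assumes k: "1 \<le> k" "k < n" and n: "3 \<le> n"
    and straight: "\<And>S T. S \<in> V.Gr k \<Longrightarrow> T \<in> V.Gr k \<Longrightarrow>
      V.subspace_adjacent S T \<Longrightarrow> straight k a S T"
  shows "\<exists>\<phi>. bij_betw \<phi> (V.Gr 1) (W.Gr 1) \<and> preserves_incidence 1 k \<phi> a \<and>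
    (\<forall>P \<in> V.Gr 1. \<forall>Q \<in> V.Gr 1. \<forall>R \<in> V.Gr 1. P \<noteq> Q \<longrightarrow>
      (R \<subseteq> P \<oplus> Q \<longleftrightarrow> \<phi> R \<subseteq> \<phi> P \<oplus> \<phi> Q))"
proof -
  have star: "star_map k m a"
    unfolding star_map_def using bij adj straight by (simp add: straight_def)
  have adjacent: "V.subspace_adjacent P Q"
    if "P \<in> V.Gr 1" "Q \<in> V.Gr 1" "P \<noteq> Q" for P Q
    using V.adjacent_of_Int[OF that, of "{0}"] that V.subspace_0 V.dim_0
    by (simp add: V.grassmannian_iff)
  show ?thesis
  proof (cases "k = 1")
    case True
    then have m: "m = 1"
      using star_map_points[of m a] star n by simp
    have "preserves_incidence 1 k a a"
      unfolding preserves_incidence_def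
    proof (intro ballI)
      fix X Y assume X: "X \<in> V.Gr 1" and Y: "Y \<in> V.Gr k"
      have "X \<subseteq> Y \<longleftrightarrow> X = Y"
        using V.dim_subset_eq[of X Y] X Y True by (auto simp: V.grassmannian_iff)
      moreover have "a X \<subseteq> a Y \<longleftrightarrow> a X = a Y"
        using W.dim_subset_eq[of "a X" "a Y"] a_in[of X] a_in[of Y] X Y True
        by (auto simp: W.grassmannian_iff)
      ultimately show "X \<subseteq> Y \<longleftrightarrow> a X \<subseteq> a Y"
        using a_eq X Y True by simp
    qed
    then show ?thesis
      using bij True m straight adjacent by (intro exI[of _ a]) (auto simp: straight_def)
  next
    case False
    then have "1 < k"
      using k by simp
    then obtain i c d where c: "bij_betw c (V.Gr 1) (W.Gr i)"
      and d: "bij_betw d (V.Gr 2) (W.Gr (Suc i))"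
      and cd: "preserves_incidence 1 2 c d" and ca: "preserves_incidence 1 k c a"
      using descend[OF star k(2), of 1] by (auto simp: numeral_2_eq_2)
    have "star_map 1 i c"
      using preserves_incidence_star_map[of c 1 i d] c d cd n by (simp add: numeral_2_eq_2)
    then have i: "i = 1" and adj1: "\<And>P Q. P \<in> V.Gr 1 \<Longrightarrow> Q \<in> V.Gr 1 \<Longrightarrow>
        W.subspace_adjacent (c P) (c Q) \<longleftrightarrow> V.subspace_adjacent P Q"
      using star_map_points n by (auto simp: star_map_def)
    have "R \<subseteq> P \<oplus> Q \<longleftrightarrow> c R \<subseteq> c P \<oplus> c Q"
      if P: "P \<in> V.Gr 1" and Q: "Q \<in> V.Gr 1" and R: "R \<in> V.Gr 1"
        and PQ: "P \<noteq> Q" for P Q R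
    proof -
      have sub: "V.subspace P" "V.subspace Q"
        using P Q by (simp_all add: V.grassmannian_iff)
      have Y: "P \<oplus> Q \<in> V.Gr 2"
        using V.adjacent_iff_ssum[OF P Q] adjacent[OF P Q PQ] sub by (simp add: V.grassmannian_iff)
      have inc: "X \<subseteq> P \<oplus> Q \<longleftrightarrow> c X \<subseteq> d (P \<oplus> Q)" if "X \<in> V.Gr 1" for X
        using cd Y that by (simp add: preserves_incidence_def)
      have c_in: "c X \<in> W.Gr 1" if "X \<in> V.Gr 1" for X
        using c that i by (auto dest: bij_betwE)
      have "d (P \<oplus> Q) \<in> W.Gr 2"
        using d Y i by (auto dest: bij_betwE simp: numeral_2_eq_2)
      moreover have "c P \<noteq> c Q"
        using adj1[OF P Q] adjacent[OF P Q PQ] W.adjacent_not_refl by auto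
      ultimately have "c P \<oplus> c Q = d (P \<oplus> Q)"
        using W.adjacent_of_ssum[OF c_in[OF P] c_in[OF Q], of "d (P \<oplus> Q)"] inc[OF P] inc[OF Q] sub
        by (simp add: W.grassmannian_iff V.ssum_upper1 V.ssum_upper2)
      then show ?thesis
        using inc[OF R] by simp
    qed
    then show ?thesis
      using c i ca by blast
  qed
qed

end

section \<open>The fundamental theorem of projective geometry\<close>

context left_vector_space
begin

definition independent2 :: "'v \<Rightarrow> 'v \<Rightarrow> bool" where
  "independent2 x y \<longleftrightarrow> (\<forall>a b. a *s x + b *s y = 0 \<longrightarrow> a = 0 \<and> b = 0)"

definition independent3 :: "'v \<Rightarrow> 'v \<Rightarrow> 'v \<Rightarrow> bool" where
  "independent3 x y z \<longleftrightarrow>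
     (\<forall>a b c. a *s x + b *s y + c *s z = 0 \<longrightarrow> a = 0 \<and> b = 0 \<and> c = 0)"

lemma independent2_commute: "independent2 x y \<longleftrightarrow> independent2 y x"
  unfolding independent2_def by (metis add.commute)

lemma independent3_swap12: "independent3 x y z \<longleftrightarrow> independent3 y x z"
  unfolding independent3_def by (metis add.commute)

lemma independent3_swap23: "independent3 x y z \<longleftrightarrow> independent3 x z y"
proof -
  have "independent3 x z y" if xyz: "independent3 x y z" for y z
    unfolding independent3_def
  proof (intro allI impI)
    fix a b c assume "a *s x + b *s z + c *s y = 0"
    then have "a *s x + c *s y + b *s z = 0"
      by (simp add: ac_simps)
    then show "a = 0 \<and> b = 0 \<and> c = 0"
      using xyz unfolding independent3_def by blast
  qed
  then show ?thesis
    by blast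
qed

lemma independent2_iff: "independent2 x y \<longleftrightarrow> x \<noteq> 0 \<and> y \<notin> line x"
proof
  assume ind: "independent2 x y"
  have "x \<noteq> 0"
  proof
    assume "x = 0"
    then have "1 *s x + 0 *s y = 0"
      by simp
    then show False
      using ind unfolding independent2_def by (metis one_neq_zero)
  qed
  moreover have "y \<notin> line x"
  proof
    assume "y \<in> line x"
    then obtain a where "y = a *s x"
      by (rule line_memE)
    then have "a *s x + (- 1) *s y = 0"
      by (simp add: scale_minus_left scale_one)
    then show False
      using ind unfolding independent2_def by (metis neg_equal_0_iff_equal one_neq_zero)
  qed
  ultimately show "x \<noteq> 0 \<and> y \<notin> line x"
    by simp
next
  assume xy: "x \<noteq> 0 \<and> y \<notin> line x"
  show "independent2 x y"
    unfolding independent2_def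
  proof (intro allI impI)
    fix a b assume eq: "a *s x + b *s y = 0"
    have "b *s y = (- a) *s x"
      using eq by (simp add: scale_minus_left eq_neg_iff_add_eq_0 add.commute)
    then have "b *s y \<in> line x"
      by simp
    then have "b = 0"
      using xy subspace_scale_iff[OF subspace_line] by blast
    then show "a = 0 \<and> b = 0"
      using eq xy scale_eq_0_iff by simp
  qed
qed

lemma independent3_iff: "independent3 x y z \<longleftrightarrow> independent2 x y \<and> z \<notin> line x \<oplus> line y"
proof
  assume ind: "independent3 x y z"
  have "independent2 x y"
    unfolding independent2_def
  proof (intro allI impI)
    fix a b assume "a *s x + b *s y = 0"
    then have "a *s x + b *s y + 0 *s z = 0"
      by simp
    then show "a = 0 \<and> b = 0"
      using ind unfolding independent3_def by blast
  qed
  moreover have "z \<notin> line x \<oplus> line y"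
  proof
    assume "z \<in> line x \<oplus> line y"
    then obtain a b where "z = a *s x + b *s y"
      by (auto elim!: ssumE line_memE)
    then have "a *s x + b *s y + (- 1) *s z = 0"
      by (simp add: scale_minus_left scale_one)
    then show False
      using ind unfolding independent3_def by (metis neg_equal_0_iff_equal one_neq_zero)
  qed
  ultimately show "independent2 x y \<and> z \<notin> line x \<oplus> line y"
    by simp
next
  assume ind: "independent2 x y \<and> z \<notin> line x \<oplus> line y"
  show "independent3 x y z"
    unfolding independent3_def
  proof (intro allI impI)
    fix a b c assume eq: "a *s x + b *s y + c *s z = 0"
    have "c *s z = - (a *s x + b *s y)"
      using eq add_eq_0_iff by blast
    then have "c *s z \<in> line x \<oplus> line y"
      using ssumI[of "a *s x" "line x" "b *s y" "line y"]
        subspace_neg[of "line x \<oplus> line y" "a *s x + b *s y"] by simp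
    then have "c = 0"
      using ind subspace_scale_iff[of "line x \<oplus> line y" c z] by auto
    then show "a = 0 \<and> b = 0 \<and> c = 0"
      using eq ind unfolding independent2_def by simp
  qed
qed

lemma independent3_mono:
  assumes "independent2 x y" "x \<in> E" "y \<in> E" "subspace E" "g \<notin> E"
  shows "independent3 x y g"
proof -
  have "line x \<oplus> line y \<subseteq> E"
    using assms by (simp add: ssum_least line_least)
  then show ?thesis
    using assms independent3_iff by blast
qed

lemma independent2_nonzero: "independent2 x y \<Longrightarrow> x \<noteq> 0 \<and> y \<noteq> 0"
  using independent2_iff independent2_commute by blast

lemma independent2_combination:
  assumes "independent2 x y" "a *s x + b *s y = c *s x + d *s y"
  shows "a = c \<and> b = d"
proof -
  have "(a - c) *s x + (b - d) *s y = 0"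
    using assms(2) by (simp add: scale_left_diff algebra_simps)
  then show ?thesis
    using assms(1) unfolding independent2_def by fastforce
qed

lemma line_eq_of_mem: "w \<in> line v \<Longrightarrow> w \<noteq> 0 \<Longrightarrow> line w = line v"
  using ssum_line_exchange[of "{0}" w v] by (simp add: zero_ssum)

lemma scale_right_cancel: "x \<noteq> 0 \<Longrightarrow> a *s x = b *s x \<longleftrightarrow> a = b"
  using scale_eq_0_iff[of "a - b" x] by (auto simp: scale_left_diff)

lemma line_minus_commute: "line (x - y) = line (y - x)"
proof -
  have "line (- v) \<subseteq> line v" for v
    by (simp add: line_least subspace_neg)
  then have "line (- v) = line v" for v
    by (metis minus_minus subset_antisym)
  then show ?thesis
    by (metis minus_diff_eq)
qed

end

context finite_dim_space
begin

lemma point_iff: "P \<in> Gr 1 \<longleftrightarrow> (\<exists>v. v \<noteq> 0 \<and> P = line v)"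
proof
  assume P: "P \<in> Gr 1"
  then have "P \<noteq> {0}" "subspace P"
    using dim_0 by (auto simp: grassmannian_iff)
  then obtain v where v: "v \<in> P" "v \<noteq> 0"
    using subspace_0 by blast
  then have "line v = P"
    using dim_subset_eq[of "line v" P] dim_line[OF v(2)] P by (simp add: grassmannian_iff line_least)
  then show "\<exists>v. v \<noteq> 0 \<and> P = line v"
    using v by blast
qed (auto simp: grassmannian_iff dim_line)

lemma ex_outside_plane:
  assumes "3 \<le> n"
  shows "\<exists>g. g \<notin> line x \<oplus> line y"
proof -
  have "dim (line v) \<le> 1" for v
    using dim_line[of v] dim_0 by (cases "v = 0") simp_all
  then have "dim (line x \<oplus> line y) \<le> 2"
    using dim_ssum_le[of "line x" "line y"] by (metis add_mono one_add_one order_trans subspace_line)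
  then have "line x \<oplus> line y \<noteq> UNIV"
    using assms dim_UNIV by auto
  then show ?thesis
    by blast
qed

lemma ex_independent2:
  assumes "3 \<le> n"
  shows "\<exists>x y. independent2 x y"
proof -
  obtain x where x: "x \<notin> line 0 \<oplus> line 0"
    using ex_outside_plane[OF assms] by blast
  then have "x \<noteq> 0"
    using subspace_0[of "line 0 \<oplus> line 0"] by auto
  moreover obtain y where "y \<notin> line x \<oplus> line x"
    using ex_outside_plane[OF assms] by blast
  then have "y \<notin> line x"
    using ssum_upper1[of "line x" "line x"] by auto
  ultimately show ?thesis
    using independent2_iff by blast
qed

end

context two_spaces
begin

definition semilinear_bijection :: "('k \<Rightarrow> 'l) \<Rightarrow> ('v \<Rightarrow> 'w) \<Rightarrow> bool" where
  "semilinear_bijection \<sigma> l \<longleftrightarrow> bij l \<and> (\<forall>x y. l (x + y) = l x + l y) \<and>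
     (\<forall>a v. l (a *\<^sub>1 v) = \<sigma> a *\<^sub>2 l v) \<and> bij \<sigma> \<and> \<sigma> 1 = 1 \<and>
     (\<forall>a b. \<sigma> (a + b) = \<sigma> a + \<sigma> b) \<and> (\<forall>a b. \<sigma> (a * b) = \<sigma> a * \<sigma> b)"

end

locale collineation = two_spaces scale1 scale2 n
  for scale1 :: "'k::division_ring \<Rightarrow> 'v::ab_group_add \<Rightarrow> 'v"  (infixr \<open>*\<^sub>1\<close> 75)
    and scale2 :: "'l::division_ring \<Rightarrow> 'w::ab_group_add \<Rightarrow> 'w"  (infixr \<open>*\<^sub>2\<close> 75)
    and n :: nat +
  fixes \<phi> :: "'v set \<Rightarrow> 'w set"
  assumes bij: "bij_betw \<phi> (V.Gr 1) (W.Gr 1)"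
    and collinear: "\<And>P Q R. P \<in> V.Gr 1 \<Longrightarrow> Q \<in> V.Gr 1 \<Longrightarrow>
      R \<in> V.Gr 1 \<Longrightarrow> P \<noteq> Q \<Longrightarrow> R \<subseteq> P \<oplus> Q \<longleftrightarrow> \<phi> R \<subseteq> \<phi> P \<oplus> \<phi> Q"
    and n: "3 \<le> n"
begin

abbreviation \<Phi> :: "'v \<Rightarrow> 'w set" where
  "\<Phi> v \<equiv> \<phi> (V.line v)"

lemma line_point: "v \<noteq> 0 \<Longrightarrow> V.line v \<in> V.Gr 1"
  using V.point_iff by blast

lemma \<Phi>_point: "v \<noteq> 0 \<Longrightarrow> \<Phi> v \<in> W.Gr 1"
  using bij line_point bij_betwE by blast

lemma \<Phi>_subspace: "v \<noteq> 0 \<Longrightarrow> W.subspace (\<Phi> v)"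
  using \<Phi>_point by (simp add: W.grassmannian_iff)

lemma \<Phi>_ex: "v \<noteq> 0 \<Longrightarrow> \<exists>v' \<in> \<Phi> v. v' \<noteq> 0"
  using \<Phi>_point[of v] W.point_iff by auto

lemma \<Phi>_eq_line:
  assumes "v \<noteq> 0" "v' \<in> \<Phi> v" "v' \<noteq> 0"
  shows "\<Phi> v = W.line v'"
  using W.point_iff \<Phi>_point[OF assms(1)] W.line_eq_of_mem assms(2,3) by auto

lemma independent2_image:
  assumes xy: "V.independent2 x y" and x': "x' \<in> \<Phi> x" "x' \<noteq> 0" and y': "y' \<in> \<Phi> y" "y' \<noteq> 0"
  shows "W.independent2 x' y'"
proof -
  have nz: "x \<noteq> 0" "y \<noteq> 0"
    using xy V.independent2_nonzero by blast+
  have "V.line x \<noteq> V.line y"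
    using xy V.independent2_iff V.line_self by metis
  then have "\<Phi> x \<noteq> \<Phi> y"
    using bij nz line_point unfolding bij_betw_def inj_on_def by blast
  then have "W.line x' \<noteq> W.line y'"
    using \<Phi>_eq_line nz x' y' by simp
  then have "y' \<notin> W.line x'"
    using W.line_eq_of_mem y' by blast
  then show ?thesis
    using x' by (simp add: W.independent2_iff)
qed

lemma \<Phi>_sum_iff:
  assumes "V.independent2 x y" "z \<noteq> 0"
  shows "z \<in> V.line x \<oplus> V.line y \<longleftrightarrow> \<Phi> z \<subseteq> \<Phi> x \<oplus> \<Phi> y"
proof -
  have nz: "x \<noteq> 0" "y \<noteq> 0"
    using assms V.independent2_nonzero by blast+
  have "V.line x \<noteq> V.line y"
    using assms V.independent2_iff V.line_self by metis
  then show ?thesis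
    using collinear[of "V.line x" "V.line y" "V.line z"] line_point nz assms(2)
    by (simp add: V.line_least)
qed

lemma independent3_image:
  assumes xyz: "V.independent3 x y z" and x': "x' \<in> \<Phi> x" "x' \<noteq> 0" and y': "y' \<in> \<Phi> y" "y' \<noteq> 0"
    and z': "z' \<in> \<Phi> z" "z' \<noteq> 0"
  shows "W.independent3 x' y' z'"
proof -
  have xy: "V.independent2 x y" "z \<notin> V.line x \<oplus> V.line y"
    using xyz V.independent3_iff by blast+
  have nz: "x \<noteq> 0" "y \<noteq> 0" "z \<noteq> 0"
    using xy V.independent2_nonzero V.subspace_0[of "V.line x \<oplus> V.line y"] by auto
  have "\<not> \<Phi> z \<subseteq> \<Phi> x \<oplus> \<Phi> y"
    using \<Phi>_sum_iff[OF xy(1) nz(3)] xy(2) by simp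
  then have "\<not> W.line z' \<subseteq> W.line x' \<oplus> W.line y'"
    using \<Phi>_eq_line x' y' z' nz by simp
  then have "z' \<notin> W.line x' \<oplus> W.line y'"
    by (simp add: W.line_least)
  then show ?thesis
    using independent2_image[OF xy(1) x' y'] by (simp add: W.independent3_iff)
qed

lemma independent2_diff: "V.independent2 x y \<Longrightarrow> V.independent2 x (x - y)"
  and independent2_diff': "V.independent2 x y \<Longrightarrow> V.independent2 y (x - y)"
proof -
  assume xy: "V.independent2 x y"
  show "V.independent2 x (x - y)"
    unfolding V.independent2_def
  proof (intro allI impI)
    fix a b assume "a *\<^sub>1 x + b *\<^sub>1 (x - y) = 0"
    then have "(a + b) *\<^sub>1 x + (- b) *\<^sub>1 y = 0"
      by (simp add: V.scale_left_distrib V.scale_right_diff V.scale_minus_left algebra_simps)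
    then have "a + b = 0 \<and> - b = 0"
      using xy unfolding V.independent2_def by blast
    then show "a = 0 \<and> b = 0"
      by auto
  qed
  show "V.independent2 y (x - y)"
    unfolding V.independent2_def
  proof (intro allI impI)
    fix a b assume "a *\<^sub>1 y + b *\<^sub>1 (x - y) = 0"
    then have "b *\<^sub>1 x + (a - b) *\<^sub>1 y = 0"
      by (simp add: V.scale_left_diff V.scale_right_diff algebra_simps)
    then have "b = 0 \<and> a - b = 0"
      using xy unfolding V.independent2_def by blast
    then show "a = 0 \<and> b = 0"
      by simp
  qed
qed

lemma diff_nonzero: "V.independent2 x y \<Longrightarrow> x - y \<noteq> 0"
  using independent2_diff V.independent2_nonzero by blast

lemma diff_in_plane: "x - y \<in> V.line x \<oplus> V.line y"
  using ssumI[of x "V.line x" "- y" "V.line y"] by (simp add: V.subspace_neg)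

text \<open>A representative \<open>x'\<close> of the image of \<open>line x\<close> singles out a representative \<open>y'\<close> of the image
  of \<open>line y\<close>: the one for which \<open>x' - y'\<close> represents the image of \<open>line (x - y)\<close>.\<close>

lemma transport_ex:
  assumes xy: "V.independent2 x y" and x': "x' \<in> \<Phi> x" "x' \<noteq> 0"
  shows "\<exists>y'. y' \<in> \<Phi> y \<and> y' \<noteq> 0 \<and> x' - y' \<in> \<Phi> (x - y)"
proof -
  have nz: "x \<noteq> 0" "y \<noteq> 0" "x - y \<noteq> 0"
    using xy V.independent2_nonzero diff_nonzero by blast+
  obtain y0 where y0: "y0 \<in> \<Phi> y" "y0 \<noteq> 0"
    using \<Phi>_ex nz by blast
  obtain u where u: "u \<in> \<Phi> (x - y)" "u \<noteq> 0"
    using \<Phi>_ex nz by blast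
  have "u \<in> \<Phi> x \<oplus> \<Phi> y"
    using \<Phi>_sum_iff[OF xy nz(3)] diff_in_plane u by blast
  then have "u \<in> W.line x' \<oplus> W.line y0"
    using \<Phi>_eq_line nz x' y0 by simp
  then obtain a b where ab: "u = a *\<^sub>2 x' + b *\<^sub>2 y0"
    by (auto elim!: ssumE W.line_memE)
  have "W.independent2 y0 u" "W.independent2 x' u"
    using independent2_image[OF independent2_diff'[OF xy] y0 u]
      independent2_image[OF independent2_diff[OF xy] x' u] by simp_all
  then have a: "a \<noteq> 0" and b: "b \<noteq> 0"
    using ab by (auto simp: W.independent2_iff)
  define y' where "y' = - ((inverse a * b) *\<^sub>2 y0)"
  have "y' \<in> \<Phi> y"
    unfolding y'_def using \<Phi>_subspace[OF nz(2)] y0(1) by (simp add: W.subspace_neg W.subspace_scale)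
  moreover have "y' \<noteq> 0"
    using a b y0(2) by (simp add: y'_def W.scale_eq_0_iff)
  moreover have "inverse a *\<^sub>2 u \<in> \<Phi> (x - y)"
    using \<Phi>_subspace[OF nz(3)] u(1) by (simp add: W.subspace_scale)
  then have "x' - y' \<in> \<Phi> (x - y)"
    using W.scale_inverse_left[OF a, of x']
    by (simp add: ab y'_def W.scale_right_distrib W.scale_scale)
  ultimately show ?thesis
    by blast
qed

lemma transport_unique:
  assumes xy: "V.independent2 x y" and "y' \<in> \<Phi> y" "y'' \<in> \<Phi> y"
    and "x' - y' \<in> \<Phi> (x - y)" "x' - y'' \<in> \<Phi> (x - y)"
  shows "y' = y''"
proof (rule ccontr)
  assume "y' \<noteq> y''"
  have nz: "y \<noteq> 0" "x - y \<noteq> 0"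
    using xy V.independent2_nonzero diff_nonzero by blast+
  have "y'' - y' \<in> \<Phi> y"
    using W.subspace_diff \<Phi>_subspace assms nz by blast
  moreover have "(x' - y') - (x' - y'') \<in> \<Phi> (x - y)"
    using W.subspace_diff \<Phi>_subspace assms nz by blast
  then have "y'' - y' \<in> \<Phi> (x - y)"
    by (simp add: algebra_simps)
  moreover have "y'' - y' \<noteq> 0"
    using \<open>y' \<noteq> y''\<close> by simp
  ultimately have "W.independent2 (y'' - y') (y'' - y')"
    using independent2_image[OF independent2_diff'[OF xy]] by blast
  then show False
    by (simp add: W.independent2_iff)
qed

text \<open>For independent \<open>x\<close>, \<open>y\<close>, \<open>z\<close> the point of \<open>x - z\<close> is the intersection of the line through the
  points of \<open>x\<close>, \<open>z\<close> and the line through the points of \<open>x - y\<close>, \<open>y - z\<close>.  The same intersection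
  computed for the images shows that transport is transitive.\<close>

lemma transport_triangle:
  assumes xyz: "V.independent3 x y z"
    and x': "x' \<in> \<Phi> x" "x' \<noteq> 0" and y': "y' \<in> \<Phi> y" "y' \<noteq> 0" and z': "z' \<in> \<Phi> z" "z' \<noteq> 0"
    and xy': "x' - y' \<in> \<Phi> (x - y)" and yz': "y' - z' \<in> \<Phi> (y - z)"
  shows "x' - z' \<in> \<Phi> (x - z)"
proof -
  have xy: "V.independent2 x y" and xz: "V.independent2 x z" and yz: "V.independent2 y z"
    using xyz V.independent3_iff V.independent3_swap12 V.independent3_swap23 by metis+
  have nz: "x \<noteq> 0" "y \<noteq> 0" "z \<noteq> 0" "x - y \<noteq> 0" "y - z \<noteq> 0" "x - z \<noteq> 0"
    using xy xz yz V.independent2_nonzero diff_nonzero by blast+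
  have ind': "W.independent3 x' y' z'"
    using independent3_image[OF xyz x' y' z'] .
  have ne: "x' - y' \<noteq> 0" "y' - z' \<noteq> 0"
    using independent2_image[OF xy x' y'] independent2_image[OF yz y' z']
      W.independent2_iff W.line_self by (metis eq_iff_diff_eq_0)+
  have ind_diff: "V.independent2 (x - y) (y - z)"
    unfolding V.independent2_def
  proof (intro allI impI)
    fix a b assume "a *\<^sub>1 (x - y) + b *\<^sub>1 (y - z) = 0"
    then have "a *\<^sub>1 x + (b - a) *\<^sub>1 y + (- b) *\<^sub>1 z = 0"
      by (simp add: V.scale_left_diff V.scale_right_diff V.scale_minus_left algebra_simps)
    then have "a = 0 \<and> b - a = 0 \<and> - b = 0"
      using xyz unfolding V.independent3_def by blast
    then show "a = 0 \<and> b = 0"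
      by simp
  qed
  obtain u where u: "u \<in> \<Phi> (x - z)" "u \<noteq> 0"
    using \<Phi>_ex nz by blast
  have "u \<in> \<Phi> x \<oplus> \<Phi> z"
    using \<Phi>_sum_iff[OF xz nz(6)] diff_in_plane u by blast
  then have "u \<in> W.line x' \<oplus> W.line z'"
    using \<Phi>_eq_line nz x' z' by simp
  then obtain a c where ac: "u = a *\<^sub>2 x' + c *\<^sub>2 z'"
    by (auto elim!: ssumE W.line_memE)
  have "x - z \<in> V.line (x - y) \<oplus> V.line (y - z)"
    using ssumI[of "x - y" "V.line (x - y)" "y - z" "V.line (y - z)"] by simp
  then have "u \<in> \<Phi> (x - y) \<oplus> \<Phi> (y - z)"
    using \<Phi>_sum_iff[OF ind_diff nz(6)] u by blast
  then have "u \<in> W.line (x' - y') \<oplus> W.line (y' - z')"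
    using \<Phi>_eq_line[OF nz(4) xy' ne(1)] \<Phi>_eq_line[OF nz(5) yz' ne(2)] by simp
  then obtain b d where bd: "u = b *\<^sub>2 (x' - y') + d *\<^sub>2 (y' - z')"
    by (auto elim!: ssumE W.line_memE)
  have "(a - b) *\<^sub>2 x' + (b - d) *\<^sub>2 y' + (c + d) *\<^sub>2 z' = u - u"
    unfolding W.scale_left_diff W.scale_left_distrib
    by (subst (2) bd, subst ac) (simp add: W.scale_right_diff algebra_simps)
  then have "(a - b) *\<^sub>2 x' + (b - d) *\<^sub>2 y' + (c + d) *\<^sub>2 z' = 0"
    by simp
  then have "a - b = 0 \<and> b - d = 0 \<and> c + d = 0"
    using ind' unfolding W.independent3_def by blast
  then have "c = - a"
    by (metis add_eq_0_iff2 eq_iff_diff_eq_0)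
  then have ua: "u = a *\<^sub>2 (x' - z')"
    using ac by (simp add: W.scale_right_diff W.scale_minus_left)
  then have "a \<noteq> 0"
    using u(2) by auto
  then show ?thesis
    using u(1) ua W.subspace_scale_iff[OF \<Phi>_subspace[OF nz(6)]] by simp
qed

text \<open>Transport from a fixed vector \<open>e\<close> defines \<open>l\<close> outside \<open>line e\<close>; on \<open>line e\<close> another vector \<open>f\<close>
  serves as the origin.  By the triangle property the choice of the origins does not matter: any two
  independent vectors are related by transport.\<close>

lemma ex_transport_map:
  "\<exists>l. l 0 = 0 \<and> (\<forall>v. v \<noteq> 0 \<longrightarrow> l v \<in> \<Phi> v \<and> l v \<noteq> 0) \<and>
    (\<forall>x y. V.independent2 x y \<longrightarrow> l x - l y \<in> \<Phi> (x - y))"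
proof -
  obtain e f where ef: "V.independent2 e f"
    using V.ex_independent2[OF n] by blast
  have e0: "e \<noteq> 0"
    using V.independent2_nonzero[OF ef] by blast
  have fe: "V.independent2 f e"
    using ef V.independent2_commute by blast
  have f0: "f \<noteq> 0"
    using V.independent2_nonzero[OF ef] by simp
  obtain e' where e': "e' \<in> \<Phi> e" "e' \<noteq> 0"
    using \<Phi>_ex e0 by blast
  obtain f' where f': "f' \<in> \<Phi> f" "f' \<noteq> 0" "e' - f' \<in> \<Phi> (e - f)"
    using transport_ex[OF ef e'] by blast
  define tr where "tr x x' y = (SOME y'. y' \<in> \<Phi> y \<and> y' \<noteq> 0 \<and> x' - y' \<in> \<Phi> (x - y))" for x x' y
  have tr: "tr x x' y \<in> \<Phi> y \<and> tr x x' y \<noteq> 0 \<and> x' - tr x x' y \<in> \<Phi> (x - y)"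
    if "V.independent2 x y" "x' \<in> \<Phi> x" "x' \<noteq> 0" for x x' y
    unfolding tr_def using someI_ex[OF transport_ex[OF that]] .
  define l where "l v = (if v = 0 then 0 else if v \<in> V.line e then tr f f' v else tr e e' v)" for v
  have f_ind: "V.independent2 f v" if "v \<in> V.line e" "v \<noteq> 0" for v
    using V.line_eq_of_mem[OF that] ef that V.independent2_iff V.independent2_commute by metis
  have e_ind: "V.independent2 e v \<longleftrightarrow> v \<notin> V.line e" for v
    using e0 by (simp add: V.independent2_iff)
  have l_in: "l v \<in> \<Phi> v" and l0: "l v \<noteq> 0" if "v \<noteq> 0" for v
    using tr[OF f_ind f'(1,2), of v] tr[OF _ e', of v] e_ind[of v] that by (auto simp: l_def)
  define K where "K x y \<longleftrightarrow> l x - l y \<in> \<Phi> (x - y)" for x y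
  have K_sym: "K y x" if "K x y" "x \<noteq> y" for x y
  proof -
    have "- (l x - l y) \<in> \<Phi> (x - y)"
      using that W.subspace_neg[OF \<Phi>_subspace] by (simp add: K_def del: minus_diff_eq)
    then show ?thesis
      by (simp add: K_def V.line_minus_commute[of y x])
  qed
  have triangle: "K x z" if "V.independent3 x y z" "K x y" "K y z" for x y z
  proof -
    have "x \<noteq> 0" "y \<noteq> 0" "z \<noteq> 0"
      using that(1) V.independent3_iff V.independent3_swap23 V.independent2_nonzero by metis+
    then show ?thesis
      using transport_triangle[OF that(1)] l_in l0 that(2,3) unfolding K_def by blast
  qed
  have ne: "x \<noteq> y" if "V.independent2 x y" for x y
    using diff_nonzero[OF that] by simp
  have plane_e: "e \<in> V.line e \<oplus> V.line v" "v \<in> V.line e \<oplus> V.line v"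
    "V.subspace (V.line e \<oplus> V.line v)" for v
    using V.ssum_upper1[of "V.line v" "V.line e"] V.ssum_upper2[of "V.line e" "V.line v"]
      V.line_self by auto
  have le: "l e = e'"
  proof -
    have "tr f f' e \<in> \<Phi> e" "f' - tr f f' e \<in> \<Phi> (f - e)"
      using tr[OF fe f'(1,2)] by blast+
    moreover have "- (e' - f') \<in> \<Phi> (e - f)"
      using f'(3) W.subspace_neg \<Phi>_subspace diff_nonzero ef by blast
    then have "f' - e' \<in> \<Phi> (f - e)"
      by (simp add: V.line_minus_commute[of f e])
    ultimately have "tr f f' e = e'"
      using transport_unique[OF fe] e'(1) by blast
    then show ?thesis
      using e0 by (simp add: l_def)
  qed
  have Ke: "K e y" if "V.independent2 e y" for y
  proof -
    have "y \<noteq> 0"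
      using that V.independent2_nonzero by blast
    then have "l y = tr e e' y"
      using e_ind that by (simp add: l_def)
    then show ?thesis
      using tr[OF that e'] le by (simp add: K_def)
  qed
  have lf: "l f = f'"
  proof -
    have "e' - l f \<in> \<Phi> (e - f)"
      using Ke[OF ef] le by (simp add: K_def)
    then show ?thesis
      using transport_unique[OF ef l_in[OF f0] f'(1) _ f'(3)] by blast
  qed
  have Kf_plane: "K f y" if "y \<notin> V.line e \<oplus> V.line f" for y
  proof -
    have "V.independent3 f e y"
      using V.independent3_mono[OF fe plane_e(2,1,3) that] .
    then show ?thesis
      using triangle Ke[OF ef] K_sym ne[OF ef] Ke[of y] V.independent3_iff V.independent3_swap12
        V.independent3_swap23 by metis
  qed
  have outside: "y \<notin> V.line e" if "y \<notin> V.line e \<oplus> V.line v" for y v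
    using that V.ssum_upper1[of "V.line v" "V.line e"] by auto
  have Kf: "K f y" if fy: "V.independent2 f y" for y
  proof (cases "y \<in> V.line e")
    case True
    have "y \<noteq> 0"
      using fy V.independent2_nonzero by blast
    then have "l y = tr f f' y"
      using True by (simp add: l_def)
    then show ?thesis
      using tr[OF fy f'(1,2)] lf by (simp add: K_def)
  next
    case False
    \<comment> \<open>Inside the plane of \<open>e\<close> and \<open>f\<close>, where \<open>e\<close>, \<open>f\<close>, \<open>y\<close> form no triangle, a detour leads through
      some \<open>g\<close> outside.\<close>
    show ?thesis
    proof (cases "y \<in> V.line e \<oplus> V.line f")
      case True
      obtain g where g: "g \<notin> V.line e \<oplus> V.line f"
        using V.ex_outside_plane[OF n] by blast
      have ey: "V.independent2 e y" "V.independent2 e g"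
        using False outside[OF g] e_ind by blast+
      have "V.independent3 e y g" "V.independent3 f y g"
        using V.independent3_mono[OF _ _ True plane_e(3) g] ey fy plane_e by blast+
      then have "V.independent3 g e y" "V.independent3 f g y"
        using V.independent3_swap12 V.independent3_swap23 by blast+
      then have "K g y"
        using triangle K_sym[OF Ke[OF ey(2)] ne[OF ey(2)]] Ke[OF ey(1)] by blast
      then show ?thesis
        using triangle \<open>V.independent3 f g y\<close> Kf_plane[OF g] by blast
    qed (use Kf_plane in blast)
  qed
  have K_line: "K x y" if x: "x \<in> V.line e" "x \<noteq> 0" and y: "y \<notin> V.line e" for x y
  proof -
    have xf: "V.independent2 x f" and fx: "V.independent2 f x"
      using f_ind[OF x] V.independent2_commute by blast+
    have Kxf: "K x f"
      using K_sym[OF Kf[OF fx] ne[OF fx]] .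
    have x_plane: "x \<in> V.line e \<oplus> V.line f" "f \<in> V.line e \<oplus> V.line f"
      using x V.ssum_upper1[of "V.line f" "V.line e"] plane_e by auto
    have far: "K x z" if z: "z \<notin> V.line e \<oplus> V.line f" for z
    proof -
      have "V.independent3 x f z"
        using V.independent3_mono[OF xf x_plane plane_e(3) z] .
      then show ?thesis
        using triangle Kxf Kf_plane[OF z] by blast
    qed
    show ?thesis
    proof (cases "y \<in> V.line e \<oplus> V.line f")
      case True
      obtain g where g: "g \<notin> V.line e \<oplus> V.line f"
        using V.ex_outside_plane[OF n] by blast
      have ey: "V.independent2 e y" "V.independent2 e g"
        using y outside[OF g] e_ind by blast+
      have xy: "V.independent2 x y"
        using V.line_eq_of_mem[OF x] x y by (simp add: V.independent2_iff)
      have "V.independent3 e y g" "V.independent3 x y g"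
        using V.independent3_mono[OF _ _ True plane_e(3) g] ey xy plane_e x_plane by blast+
      then have "V.independent3 g e y" "V.independent3 x g y"
        using V.independent3_swap12 V.independent3_swap23 by blast+
      then have "K g y"
        using triangle K_sym[OF Ke[OF ey(2)] ne[OF ey(2)]] Ke[OF ey(1)] by blast
      then show ?thesis
        using triangle \<open>V.independent3 x g y\<close> far[OF g] by blast
    qed (use far in blast)
  qed
  have "K x y" if xy: "V.independent2 x y" for x y
  proof -
    have nz: "x \<noteq> 0" "y \<noteq> 0"
      using V.independent2_nonzero[OF xy] by simp_all
    consider "x \<in> V.line e" | "x \<notin> V.line e" "y \<in> V.line e" | "x \<notin> V.line e" "y \<notin> V.line e"
      by blast
    then show ?thesis
    proof cases
      case 1
      then have "y \<notin> V.line e"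
        using V.line_eq_of_mem[OF 1 nz(1)] xy by (simp add: V.independent2_iff)
      then show ?thesis
        using K_line 1 nz by blast
    next
      case 2
      then show ?thesis
        using K_sym[OF K_line] nz ne[OF xy] by blast
    next
      case 3
      then have ex: "V.independent2 e x" "V.independent2 x e" and ey: "V.independent2 e y" "V.independent2 y e"
        using e_ind V.independent2_commute by blast+
      have Kxe: "K x e"
        using K_sym[OF Ke[OF ex(1)] ne[OF ex(1)]] .
      have x_plane: "x \<in> V.line x \<oplus> V.line z" "z \<in> V.line x \<oplus> V.line z" for z
        using V.ssum_upper1[of "V.line z" "V.line x"] V.ssum_upper2[of "V.line x" "V.line z"] by auto
      show ?thesis
      proof (cases "y \<in> V.line x \<oplus> V.line e")
        case False
        then have "V.independent3 x e y"
          using ex by (simp add: V.independent3_iff)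
        then show ?thesis
          using triangle Kxe Ke[OF ey(1)] by blast
      next
        case True
        have "y \<notin> V.line x"
          using xy by (simp add: V.independent2_iff)
        then have "V.line x \<oplus> V.line y = V.line x \<oplus> V.line e"
          using V.ssum_line_exchange[OF _ True] by simp
        then have e_plane: "e \<in> V.line x \<oplus> V.line y"
          using x_plane(2)[of e] by simp
        obtain g where g: "g \<notin> V.line x \<oplus> V.line y"
          using V.ex_outside_plane[OF n] by blast
        have sub: "V.subspace (V.line x \<oplus> V.line y)"
          by simp
        have ind: "V.independent3 x e g" "V.independent3 e y g" "V.independent3 x y g"
          using V.independent3_mono[OF ex(2) x_plane(1) e_plane sub g]
            V.independent3_mono[OF ey(1) e_plane x_plane(2) sub g]
            V.independent3_mono[OF xy x_plane sub g] by blast+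
        then have ind': "V.independent3 g e y" "V.independent3 x g y" "V.independent2 e g"
          using V.independent3_swap12 V.independent3_swap23 V.independent3_iff by blast+
        have Keg: "K e g" "K g e"
          using Ke[OF ind'(3)] K_sym ne[OF ind'(3)] by blast+
        have "K x g" "K g y"
          using triangle[OF ind(1) Kxe Keg(1)] triangle[OF ind'(1) Keg(2) Ke[OF ey(1)]] .
        then show ?thesis
          using triangle[OF ind'(2)] by blast
      qed
    qed
  qed
  then have "\<forall>x y. V.independent2 x y \<longrightarrow> l x - l y \<in> \<Phi> (x - y)"
    by (simp add: K_def)
  moreover have "l 0 = 0"
    by (simp add: l_def)
  ultimately show ?thesis
    using l_in l0 by blast
qed

text \<open>For independent \<open>x\<close> and \<open>y\<close>, the vector \<open>l (x - y)\<close> is a multiple of \<open>l x - l y\<close>, and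
\<open>l x - l (x - y)\<close> is a multiple of \<open>l y\<close>; comparing the coefficients of \<open>l x\<close> gives
\<open>l (x - y) = l x - l y\<close>.  Dependent \<open>x\<close> and \<open>y\<close> are replaced by \<open>x - g\<close> and \<open>y - g\<close> with \<open>g\<close> outside
their line.\<close>

lemma ex_additive_map:
  "\<exists>l. (\<forall>x y. l (x + y) = l x + l y) \<and> (\<forall>v. v \<noteq> 0 \<longrightarrow> l v \<in> \<Phi> v \<and> l v \<noteq> 0)"
proof -
  obtain l where l_0: "l 0 = 0" and l_in: "\<And>v. v \<noteq> 0 \<Longrightarrow> l v \<in> \<Phi> v" and l0: "\<And>v. v \<noteq> 0 \<Longrightarrow> l v \<noteq> 0"
    and K: "\<And>x y. V.independent2 x y \<Longrightarrow> l x - l y \<in> \<Phi> (x - y)"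
    using ex_transport_map by blast
  have diff2: "l (x - y) = l x - l y" if xy: "V.independent2 x y" for x y
  proof -
    let ?z = "x - y"
    have nz: "x \<noteq> 0" "y \<noteq> 0" "?z \<noteq> 0"
      using xy V.independent2_nonzero diff_nonzero by blast+
    have ind: "W.independent2 (l x) (l y)"
      using independent2_image[OF xy] l_in l0 nz by blast
    then have "l x - l y \<noteq> 0"
      using W.independent2_iff W.line_self by (metis eq_iff_diff_eq_0)
    then have "\<Phi> ?z = W.line (l x - l y)"
      using \<Phi>_eq_line[OF nz(3) K[OF xy]] by simp
    then obtain d where d: "l ?z = d *\<^sub>2 (l x - l y)"
      using l_in[OF nz(3)] by (auto elim: W.line_memE)
    have "l x - l ?z \<in> \<Phi> (x - ?z)"
      using K[OF independent2_diff[OF xy]] .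
    then have "l x - l ?z \<in> W.line (l y)"
      using \<Phi>_eq_line[OF nz(2) l_in[OF nz(2)] l0[OF nz(2)]] by simp
    then obtain c where c: "l x - l ?z = c *\<^sub>2 l y"
      by (auto elim: W.line_memE)
    have "1 *\<^sub>2 l x + (- c) *\<^sub>2 l y = d *\<^sub>2 l x + (- d) *\<^sub>2 l y"
      using c d by (simp add: W.scale_one W.scale_minus_left W.scale_right_diff algebra_simps)
    then have "d = 1"
      using W.independent2_combination[OF ind] by metis
    then show ?thesis
      using d by (simp add: W.scale_one)
  qed
  have neg: "l (- y) = - l y" if y: "y \<noteq> 0" for y
  proof -
    obtain x where "x \<notin> V.line y \<oplus> V.line y"
      using V.ex_outside_plane[OF n] by blast
    then have yx: "V.independent2 y x"
      using y V.ssum_upper1[of "V.line y" "V.line y"] by (auto simp: V.independent2_iff)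
    then have xy: "V.independent2 x y"
      by (simp add: V.independent2_commute)
    have "V.independent2 (x - y) x"
      using independent2_diff[OF xy] V.independent2_commute by blast
    then have "l ((x - y) - x) = l (x - y) - l x"
      by (rule diff2)
    then show ?thesis
      using diff2[OF xy] by simp
  qed
  have diff: "l (x - y) = l x - l y" for x y
  proof (cases "V.independent2 x y \<or> x = y \<or> x = 0 \<or> y = 0")
    case True
    then show ?thesis
      using diff2 neg[of y] l_0 by (cases "y = 0") auto
  next
    case False
    then have x: "x \<noteq> 0" and y: "y \<in> V.line x" "y \<noteq> 0" and ne: "x \<noteq> y"
      by (auto simp: V.independent2_iff)
    obtain g where "g \<notin> V.line x \<oplus> V.line x"
      using V.ex_outside_plane[OF n] by blast
    then have gx: "g \<notin> V.line x"
      using V.ssum_upper1[of "V.line x" "V.line x"] by auto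
    then have xg: "V.independent2 x g"
      using x by (simp add: V.independent2_iff)
    have yg: "V.independent2 y g"
      using V.line_eq_of_mem[OF y] gx y by (simp add: V.independent2_iff)
    obtain c where c: "y = c *\<^sub>1 x"
      using y by (auto elim: V.line_memE)
    have "V.independent2 (x - g) (y - g)"
      unfolding V.independent2_def
    proof (intro allI impI)
      fix a b assume "a *\<^sub>1 (x - g) + b *\<^sub>1 (y - g) = 0"
      then have "(a + b * c) *\<^sub>1 x + (- a - b) *\<^sub>1 g = 0"
        by (simp add: c V.scale_left_diff V.scale_left_distrib V.scale_right_diff V.scale_minus_left
            V.scale_scale algebra_simps)
      then have eqs: "a + b * c = 0 \<and> - a - b = 0"
        using xg unfolding V.independent2_def by blast
      have "b * (c - 1) = (a + b * c) + (- a - b)"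
        by (simp add: algebra_simps)
      then have "b * (c - 1) = 0"
        using eqs by simp
      moreover have "c \<noteq> 1"
        using ne c by (auto simp: V.scale_one)
      ultimately show "a = 0 \<and> b = 0"
        using eqs by simp
    qed
    then have "l ((x - g) - (y - g)) = l (x - g) - l (y - g)"
      by (rule diff2)
    then show ?thesis
      using diff2[OF xg] diff2[OF yg] by simp
  qed
  have "l (x + y) = l x + l y" for x y
  proof -
    have "l (- y) = - l y"
      using diff[of 0 y] l_0 by simp
    then show ?thesis
      using diff[of x "- y"] by simp
  qed
  then show ?thesis
    using l_in l0 by blast
qed

text \<open>The scalar \<open>c\<close> with \<open>l (a x) = c l x\<close> is the same for independent \<open>x\<close> and \<open>y\<close>, because it must also
work for \<open>x - y\<close>; hence it depends on \<open>a\<close> only.\<close>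

theorem fundamental_theorem:
  "\<exists>l \<sigma>. semilinear_bijection \<sigma> l \<and> (\<forall>v. v \<noteq> 0 \<longrightarrow> \<Phi> v = W.line (l v))"
proof -
  obtain l where add: "\<And>x y. l (x + y) = l x + l y"
    and l_in: "\<And>v. v \<noteq> 0 \<Longrightarrow> l v \<in> \<Phi> v" and l0: "\<And>v. v \<noteq> 0 \<Longrightarrow> l v \<noteq> 0"
    using ex_additive_map by blast
  have \<Phi>_l: "\<Phi> v = W.line (l v)" if "v \<noteq> 0" for v
    using \<Phi>_eq_line[OF that l_in[OF that] l0[OF that]] .
  have l_0: "l 0 = 0"
    using add[of 0 0] by simp
  have diff: "l (x - y) = l x - l y" for x y
    using add[of "x - y" y] by simp
  have ind_l: "W.independent2 (l x) (l y)" if "V.independent2 x y" for x y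
    using independent2_image[OF that] l_in l0 V.independent2_nonzero[OF that] by blast
  have ex: "\<exists>c. l (a *\<^sub>1 v) = c *\<^sub>2 l v" if "v \<noteq> 0" for a v
  proof (cases "a *\<^sub>1 v = 0")
    case True
    then show ?thesis
      using l_0 by (intro exI[of _ 0]) simp
  next
    case False
    then have "l (a *\<^sub>1 v) \<in> W.line (l v)"
      using l_in[OF False] V.line_eq_of_mem[OF _ False, of v] \<Phi>_l[OF that] by simp
    then show ?thesis
      by (auto elim: W.line_memE)
  qed
  have same: "l (a *\<^sub>1 y) = c *\<^sub>2 l y" if xy: "V.independent2 x y" and c: "l (a *\<^sub>1 x) = c *\<^sub>2 l x" for a c x y
  proof -
    have nz: "x \<noteq> 0" "y \<noteq> 0"
      using V.independent2_nonzero[OF xy] by simp_all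
    obtain d where d: "l (a *\<^sub>1 y) = d *\<^sub>2 l y"
      using ex nz by blast
    have "V.independent2 x y \<Longrightarrow> x - y \<noteq> 0"
      by (rule diff_nonzero)
    then obtain s where s: "l (a *\<^sub>1 (x - y)) = s *\<^sub>2 l (x - y)"
      using ex xy by blast
    have "s *\<^sub>2 l x + (- s) *\<^sub>2 l y = c *\<^sub>2 l x + (- d) *\<^sub>2 l y"
      using s c d by (simp add: diff V.scale_right_diff W.scale_right_diff W.scale_minus_left)
    then have "c = d"
      using W.independent2_combination[OF ind_l[OF xy]] by force
    then show ?thesis
      using d by simp
  qed
  obtain e f where ef: "V.independent2 e f"
    using V.ex_independent2[OF n] by blast
  have e0: "e \<noteq> 0"
    using V.independent2_nonzero[OF ef] by blast
  define \<sigma> where "\<sigma> a = (SOME c. l (a *\<^sub>1 e) = c *\<^sub>2 l e)" for a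
  have \<sigma>_e: "l (a *\<^sub>1 e) = \<sigma> a *\<^sub>2 l e" for a
    unfolding \<sigma>_def using someI_ex[OF ex[OF e0]] .
  have semi: "l (a *\<^sub>1 v) = \<sigma> a *\<^sub>2 l v" for a v
  proof (cases "v = 0")
    case False
    show ?thesis
    proof (cases "v \<in> V.line e")
      case True
      then have "V.independent2 v f"
        using V.line_eq_of_mem[OF True False] ef False by (simp add: V.independent2_iff)
      then have "V.independent2 f v"
        by (simp add: V.independent2_commute)
      then show ?thesis
        using same same[OF ef \<sigma>_e] by blast
    next
      case out: False
      then show ?thesis
        using same[OF _ \<sigma>_e] e0 by (simp add: V.independent2_iff)
    qed
  qed (simp add: l_0)
  have le: "l e \<noteq> 0"
    using l0 e0 by blast
  note cancel = W.scale_right_cancel[OF le]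
  have \<sigma>1: "\<sigma> 1 = 1"
    using \<sigma>_e[of 1] cancel[of "\<sigma> 1" 1] by (simp add: V.scale_one W.scale_one)
  have \<sigma>_add: "\<sigma> (a + b) = \<sigma> a + \<sigma> b" for a b
    using \<sigma>_e[of "a + b"] cancel[of "\<sigma> (a + b)" "\<sigma> a + \<sigma> b"]
    by (simp add: V.scale_left_distrib W.scale_left_distrib add \<sigma>_e)
  have \<sigma>_mult: "\<sigma> (a * b) = \<sigma> a * \<sigma> b" for a b
    using \<sigma>_e[of "a * b"] cancel[of "\<sigma> (a * b)" "\<sigma> a * \<sigma> b"]
    by (simp add: semi flip: V.scale_scale W.scale_scale)
  have \<sigma>_0: "\<sigma> a = 0 \<longleftrightarrow> a = 0" for a
    using \<sigma>_e[of a] l0[of "a *\<^sub>1 e"] l_0 le e0 V.scale_eq_0_iff[of a e] W.scale_eq_0_iff[of "\<sigma> a" "l e"]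
    by auto
  have \<sigma>_diff: "\<sigma> (a - b) = \<sigma> a - \<sigma> b" for a b
    using \<sigma>_add[of "a - b" b] by simp
  have "inj \<sigma>"
  proof (rule injI)
    fix a b assume "\<sigma> a = \<sigma> b"
    then show "a = b"
      using \<sigma>_0[of "a - b"] \<sigma>_diff[of a b] by simp
  qed
  moreover have "\<exists>a. \<sigma> a = c" for c
  proof -
    \<comment> \<open>The point of \<open>c l(e) + l(f)\<close> is the image of a point of the plane of \<open>e\<close> and \<open>f\<close>.\<close>
    let ?w = "c *\<^sub>2 l e + 1 *\<^sub>2 l f"
    have ind: "W.independent2 (l e) (l f)"
      using ind_l ef by blast
    have "?w \<noteq> 0"
      using ind unfolding W.independent2_def by (metis one_neq_zero)
    then have "W.line ?w \<in> W.Gr 1"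
      using W.point_iff by blast
    then have "W.line ?w \<in> \<phi> ` V.Gr 1"
      using bij by (simp add: bij_betw_def)
    then obtain x where x: "x \<noteq> 0" "W.line ?w = \<Phi> x"
      using V.point_iff by auto
    have "?w \<in> W.line (l e) \<oplus> W.line (l f)"
      by (intro ssumI) simp_all
    then have "\<Phi> x \<subseteq> \<Phi> e \<oplus> \<Phi> f"
      using \<Phi>_l[OF e0] \<Phi>_l[of f] V.independent2_nonzero[OF ef] x by (simp add: W.line_least flip: x(2))
    then have "x \<in> V.line e \<oplus> V.line f"
      using \<Phi>_sum_iff[OF ef x(1)] by blast
    then obtain a b where ab: "x = a *\<^sub>1 e + b *\<^sub>1 f"
      by (auto elim!: ssumE V.line_memE)
    have "l x \<in> W.line ?w"
      using l_in[OF x(1)] x(2) by simp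
    then obtain d where d: "l x = d *\<^sub>2 ?w"
      by (rule W.line_memE)
    have "\<sigma> a *\<^sub>2 l e + \<sigma> b *\<^sub>2 l f = (d * c) *\<^sub>2 l e + d *\<^sub>2 l f"
      using d by (simp add: ab add semi W.scale_right_distrib W.scale_scale)
    then have eqs: "\<sigma> a = d * c \<and> \<sigma> b = d"
      using W.independent2_combination[OF ind] by blast
    have "d \<noteq> 0"
      using d l0[OF x(1)] by auto
    then have b: "b \<noteq> 0"
      using eqs \<sigma>_0 by blast
    have "\<sigma> (inverse b) * \<sigma> b = 1"
      using b \<sigma>1 by (simp flip: \<sigma>_mult)
    then have "\<sigma> (inverse b * a) = c"
      using eqs by (simp add: \<sigma>_mult flip: mult.assoc)
    then show ?thesis
      by blast
  qed
  ultimately have bij_\<sigma>: "bij \<sigma>"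
    unfolding bij_def surj_def by metis
  have "inj l"
  proof (rule injI)
    fix x y assume "l x = l y"
    then show "x = y"
      using l0[of "x - y"] diff[of x y] by auto
  qed
  moreover have "\<exists>v. l v = w" for w
  proof (cases "w = 0")
    case True
    then show ?thesis
      using l_0 by blast
  next
    case False
    then have "W.line w \<in> W.Gr 1"
      using W.point_iff by blast
    then have "W.line w \<in> \<phi> ` V.Gr 1"
      using bij by (simp add: bij_betw_def)
    then obtain v where v: "v \<noteq> 0" "W.line w = W.line (l v)"
      using V.point_iff \<Phi>_l by auto
    then obtain c where c: "w = c *\<^sub>2 l v"
      using W.line_self[of w] by (auto elim: W.line_memE)
    obtain a where "\<sigma> a = c"
      using bij_\<sigma> by (metis bij_pointE)
    then show ?thesis
      using c semi by metis
  qed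
  ultimately have "bij l"
    unfolding bij_def surj_def by metis
  then show ?thesis
    using add semi bij_\<sigma> \<sigma>1 \<sigma>_add \<sigma>_mult \<Phi>_l unfolding semilinear_bijection_def by blast
qed

end

context two_spaces
begin

lemma additive_image_ssum:
  assumes "\<And>x y. l (x + y) = l x + l y"
  shows "l ` (S \<oplus> T) = l ` S \<oplus> l ` T"
proof
  show "l ` (S \<oplus> T) \<subseteq> l ` S \<oplus> l ` T"
    by (auto elim!: ssumE simp: assms intro!: ssumI)
  show "l ` S \<oplus> l ` T \<subseteq> l ` (S \<oplus> T)"
    by (auto elim!: ssumE simp flip: assms intro!: imageI ssumI)
qed

lemma semilinear_image_line:
  assumes "semilinear_bijection \<sigma> l"
  shows "l ` V.line v = W.line (l v)"
proof -
  have "l ` V.line v = range (\<lambda>a. \<sigma> a *\<^sub>2 l v)"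
    using assms by (simp add: semilinear_bijection_def V.line_def image_image)
  also have "\<dots> = (\<lambda>c. c *\<^sub>2 l v) ` range \<sigma>"
    by (simp add: image_image)
  also have "\<dots> = W.line (l v)"
    using assms by (simp add: semilinear_bijection_def W.line_def bij_is_surj)
  finally show ?thesis .
qed

lemma semilinear_image_rank:
  assumes l: "semilinear_bijection \<sigma> l" and "V.rank S d"
  shows "W.rank (l ` S) d"
  using assms(2)
proof (induction rule: V.rank.induct)
  case rank_0
  have "l 0 + l 0 = l 0 + 0"
    using l unfolding semilinear_bijection_def by (metis add.right_neutral)
  then have "l 0 = 0"
    by simp
  then show ?case
    by (simp add: W.rank_0)
next
  case (rank_Suc S d v)
  have "l v \<notin> l ` S"
    using l rank_Suc.hyps(2) by (simp add: semilinear_bijection_def bij_is_inj inj_image_mem_iff)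
  moreover have "l ` (S \<oplus> V.line v) = l ` S \<oplus> W.line (l v)"
    using additive_image_ssum[of l] semilinear_image_line[OF l] l
    by (simp add: semilinear_bijection_def)
  ultimately show ?case
    using W.rank_Suc[OF rank_Suc.IH] by simp
qed

lemma semilinear_image_grassmannian:
  assumes "semilinear_bijection \<sigma> l" "S \<in> V.Gr j"
  shows "l ` S \<in> W.Gr j"
proof -
  have "W.rank (l ` S) j"
    using semilinear_image_rank[OF assms(1) V.rank_dim] assms(2) by (auto simp: V.grassmannian_iff)
  then show ?thesis
    using W.rank_subspace W.dim_rank by (auto simp: W.grassmannian_iff)
qed

end

context pencil_map
begin

text \<open>A subspace is the union of its points, so the semilinear map that induces the collineation of the
points also induces \<open>a\<close>.\<close>

theorem straight_semilinear:
  assumes k: "1 \<le> k" "k < n" and n: "3 \<le> n"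
    and straight: "\<And>S T. S \<in> V.Gr k \<Longrightarrow> T \<in> V.Gr k \<Longrightarrow>
      V.subspace_adjacent S T \<Longrightarrow> straight k a S T"
  shows "\<exists>l \<sigma>. semilinear_bijection \<sigma> l \<and> m = k \<and> (\<forall>S \<in> V.Gr k. a S = l ` S)"
proof -
  obtain \<phi> where \<phi>: "bij_betw \<phi> (V.Gr 1) (W.Gr 1)"
    and inc: "preserves_incidence 1 k \<phi> a"
    and col: "\<forall>P \<in> V.Gr 1. \<forall>Q \<in> V.Gr 1. \<forall>R \<in> V.Gr 1. P \<noteq> Q \<longrightarrow>
      (R \<subseteq> P \<oplus> Q \<longleftrightarrow> \<phi> R \<subseteq> \<phi> P \<oplus> \<phi> Q)"
    using straight_induced_by_points[OF k n straight] by blast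
  interpret collineation scale1 scale2 n \<phi>
    by unfold_locales (use \<phi> col n in simp_all)
  obtain l \<sigma> where l: "semilinear_bijection \<sigma> l" and \<Phi>_l: "\<And>v. v \<noteq> 0 \<Longrightarrow> \<Phi> v = W.line (l v)"
    using fundamental_theorem by blast
  have a_l: "a S = l ` S" if S: "S \<in> V.Gr k" for S
  proof -
    have sub: "V.subspace S" "W.subspace (a S)"
      using S a_in[OF S] by (simp_all add: V.grassmannian_iff W.grassmannian_iff)
    have lS: "W.subspace (l ` S)"
      using semilinear_image_grassmannian[OF l S] by (simp add: W.grassmannian_iff)
    have mem: "v \<in> S \<longleftrightarrow> l v \<in> a S" for v
    proof (cases "v = 0")
      case True
      have "W.rank (l ` {0}) 0"
        using semilinear_image_rank[OF l V.rank_0] .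
      then have "l ` {0} = {0}"
        using W.rank_unique W.dim_rank W.rank_subspace W.dim_eq_0 by metis
      then show ?thesis
        using True sub V.subspace_0 W.subspace_0 by simp
    next
      case False
      have "v \<in> S \<longleftrightarrow> V.line v \<subseteq> S"
        using sub by (simp add: V.line_least)
      also have "\<dots> \<longleftrightarrow> \<Phi> v \<subseteq> a S"
        using inc S line_point[OF False] by (simp add: preserves_incidence_def)
      also have "\<dots> \<longleftrightarrow> l v \<in> a S"
        using sub \<Phi>_l[OF False] by (simp add: W.line_least)
      finally show ?thesis .
    qed
    have "surj l"
      using l by (simp add: semilinear_bijection_def bij_is_surj)
    show ?thesis
    proof
      show "a S \<subseteq> l ` S"
      proof
        fix w assume "w \<in> a S"
        moreover obtain v where "w = l v"
          using \<open>surj l\<close> by blast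
        ultimately show "w \<in> l ` S"
          using mem by blast
      qed
      show "l ` S \<subseteq> a S"
        using mem by blast
    qed
  qed
  obtain S where S: "S \<in> V.Gr k"
    using V.ex_grassmannian[of k] k by auto
  have "m = k"
    using a_in[OF S] semilinear_image_grassmannian[OF l S] a_l[OF S] by (simp add: W.grassmannian_iff)
  then show ?thesis
    using l a_l by blast
qed

end

section \<open>Duality\<close>

context finite_dim_space
begin

lemma dim_Int_hyperplane:
  assumes T: "subspace T" and H: "subspace H" and codim: "\<And>x y. x \<notin> H \<Longrightarrow> \<exists>c. y - c *s x \<in> H"
  shows "dim T \<le> Suc (dim (T \<inter> H))"
proof (cases "T \<subseteq> H")
  case True
  then show ?thesis
    by (simp add: Int_absorb2)
next
  case False
  then obtain x where x: "x \<in> T" "x \<notin> H"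
    by blast
  have "T \<subseteq> (T \<inter> H) \<oplus> line x"
  proof
    fix y assume y: "y \<in> T"
    obtain c where c: "y - c *s x \<in> H"
      using codim x(2) by blast
    have "y - c *s x \<in> T \<inter> H"
      using c y x(1) T subspace_diff subspace_scale by blast
    then have "(y - c *s x) + c *s x \<in> (T \<inter> H) \<oplus> line x"
      by (intro ssumI) simp_all
    then show "y \<in> (T \<inter> H) \<oplus> line x"
      by simp
  qed
  then have "dim T \<le> dim ((T \<inter> H) \<oplus> line x)"
    using T H by (intro dim_mono) simp_all
  also have "\<dots> = Suc (dim (T \<inter> H))"
    using T H x by (intro dim_ssum_line) simp_all
  finally show ?thesis .
qed

end

text \<open>A pairing of two spaces enters only through the relation that the value is \<open>0\<close>.  Stating the axioms
for this relation makes the two spaces interchangeable, although their scalars act on different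
sides of the pairing.\<close>

locale duality = two_spaces scale1 scale2 n
  for scale1 :: "'k::division_ring \<Rightarrow> 'v::ab_group_add \<Rightarrow> 'v"  (infixr \<open>*\<^sub>1\<close> 75)
    and scale2 :: "'l::division_ring \<Rightarrow> 'w::ab_group_add \<Rightarrow> 'w"  (infixr \<open>*\<^sub>2\<close> 75)
    and n :: nat +
  fixes orth :: "'v \<Rightarrow> 'w \<Rightarrow> bool"
  assumes subspace_left: "\<And>w. V.subspace {v. orth v w}"
    and subspace_right: "\<And>v. W.subspace {w. orth v w}"
    and codim_left: "\<And>x y w. \<not> orth x w \<Longrightarrow> \<exists>c. orth (y - c *\<^sub>1 x) w"
    and codim_right: "\<And>v x y. \<not> orth v x \<Longrightarrow> \<exists>c. orth v (y - c *\<^sub>2 x)"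
    and nondegenerate_left: "\<And>v. (\<And>w. orth v w) \<Longrightarrow> v = 0"
    and nondegenerate_right: "\<And>w. (\<And>v. orth v w) \<Longrightarrow> w = 0"
begin

definition perp :: "'v set \<Rightarrow> 'w set" where
  "perp S = {w. \<forall>v\<in>S. orth v w}"

lemma subspace_perp: "W.subspace (perp S)"
proof -
  have *: "0 \<in> {w. orth v w}" "x \<in> {w. orth v w} \<Longrightarrow> y \<in> {w. orth v w} \<Longrightarrow> x + y \<in> {w. orth v w}"
    "x \<in> {w. orth v w} \<Longrightarrow> c *\<^sub>2 x \<in> {w. orth v w}" for v x y c
    using W.subspace_0[OF subspace_right] W.subspace_add[OF subspace_right]
      W.subspace_scale[OF subspace_right] by blast+
  then show ?thesis
    unfolding perp_def W.subspace_def by simp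
qed

lemma perp_antimono: "S \<subseteq> T \<Longrightarrow> perp T \<subseteq> perp S"
  unfolding perp_def by blast

lemma perp_ssum_line:
  assumes "V.subspace S"
  shows "perp (S \<oplus> V.line v) = perp S \<inter> {w. orth v w}"
proof
  have "S \<subseteq> S \<oplus> V.line v" "v \<in> S \<oplus> V.line v"
    using assms by (simp_all add: V.ssum_upper1 V.ssum_line_self)
  then show "perp (S \<oplus> V.line v) \<subseteq> perp S \<inter> {w. orth v w}"
    unfolding perp_def by blast
  show "perp S \<inter> {w. orth v w} \<subseteq> perp (S \<oplus> V.line v)"
  proof
    fix w assume w: "w \<in> perp S \<inter> {w. orth v w}"
    have "S \<oplus> V.line v \<subseteq> {v. orth v w}"
      using V.ssum_line_least[OF subspace_left[of w], of S v] w by (auto simp: perp_def)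
    then show "w \<in> perp (S \<oplus> V.line v)"
      unfolding perp_def by blast
  qed
qed

text \<open>Adjoining a vector to \<open>S\<close> lowers the dimension of \<open>perp S\<close> by at most one.  On the way from the
  zero space to the whole space it falls from \<open>n\<close> to \<open>0\<close>, so it drops at every step.\<close>

lemma dim_perp:
  assumes S: "V.subspace S"
  shows "W.dim (perp S) + V.dim S = n"
proof -
  have mono: "W.dim (perp X) + V.dim X \<le> W.dim (perp Y) + V.dim Y"
    if XY: "V.subspace X" "V.subspace Y" "X \<subseteq> Y" for X Y
    using XY
  proof (induction rule: V.subspace_induct)
    case (step Z v)
    have "W.dim (perp Z) \<le> Suc (W.dim (perp Z \<inter> {w. orth v w}))"
      using W.dim_Int_hyperplane[OF subspace_perp subspace_right] codim_right by blast
    then show ?case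
      using step V.dim_ssum_line[of Z v] perp_ssum_line[of Z v] by simp
  qed simp
  have "{v. orth v w} = {v. orth v w} \<and> orth 0 w" for w
    using V.subspace_0[OF subspace_left] by blast
  then have "perp {0} = UNIV"
    by (auto simp: perp_def)
  then have "n \<le> W.dim (perp S) + V.dim S"
    using mono[OF V.subspace_zero S] V.subspace_0[OF S] W.dim_UNIV V.dim_0 by simp
  moreover have "perp UNIV \<subseteq> {0}"
    using nondegenerate_right unfolding perp_def by blast
  then have "perp UNIV = {0}"
    using W.subspace_0[OF subspace_perp] by blast
  then have "W.dim (perp S) + V.dim S \<le> n"
    using mono[OF S V.subspace_UNIV] W.dim_0 V.dim_UNIV by simp
  ultimately show ?thesis
    by simp
qed

lemma flipped: "duality scale2 scale1 n (\<lambda>w v. orth v w)"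
  by unfold_locales
    (use subspace_left subspace_right codim_left codim_right nondegenerate_left
      nondegenerate_right in blast)+

definition coperp :: "'w set \<Rightarrow> 'v set" where
  "coperp T = {v. \<forall>w\<in>T. orth v w}"

lemma coperp_flip: "coperp = duality.perp (\<lambda>w v. orth v w)"
proof -
  interpret flip: duality scale2 scale1 n "\<lambda>w v. orth v w"
    by (rule flipped)
  show ?thesis
    by (simp add: fun_eq_iff coperp_def flip.perp_def)
qed

lemma subspace_coperp: "V.subspace (coperp T)"
  using duality.subspace_perp[OF flipped] by (simp add: coperp_flip)

lemma dim_coperp: "W.subspace T \<Longrightarrow> V.dim (coperp T) + W.dim T = n"
  using duality.dim_perp[OF flipped] by (simp add: coperp_flip)

lemma coperp_perp:
  assumes S: "V.subspace S"
  shows "coperp (perp S) = S"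
proof -
  have "S \<subseteq> coperp (perp S)"
    unfolding coperp_def perp_def by blast
  moreover have "V.dim (coperp (perp S)) \<le> V.dim S"
    using dim_coperp[OF subspace_perp[of S]] dim_perp[OF S] by simp
  ultimately show ?thesis
    using V.dim_subset_eq[OF S subspace_coperp] by blast
qed

lemma perp_coperp: "W.subspace T \<Longrightarrow> perp (coperp T) = T"
proof -
  assume T: "W.subspace T"
  have "T \<subseteq> perp (coperp T)"
    unfolding coperp_def perp_def by blast
  moreover have "W.dim (perp (coperp T)) \<le> W.dim T"
    using dim_coperp[OF T] dim_perp[OF subspace_coperp[of T]] by simp
  ultimately show ?thesis
    using W.dim_subset_eq[OF T subspace_perp] by blast
qed

lemma perp_le_iff:
  assumes "V.subspace S" "V.subspace T"
  shows "perp T \<subseteq> perp S \<longleftrightarrow> S \<subseteq> T"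
proof
  assume "perp T \<subseteq> perp S"
  then have "coperp (perp S) \<subseteq> coperp (perp T)"
    unfolding coperp_def by blast
  then show "S \<subseteq> T"
    using coperp_perp assms by simp
qed (rule perp_antimono)

lemma perp_ssum:
  assumes "V.subspace S" "V.subspace T"
  shows "perp (S \<oplus> T) = perp S \<inter> perp T"
proof
  have "S \<subseteq> S \<oplus> T" "T \<subseteq> S \<oplus> T"
    using assms by (simp_all add: V.ssum_upper1 V.ssum_upper2)
  then show "perp (S \<oplus> T) \<subseteq> perp S \<inter> perp T"
    using perp_antimono by blast
  show "perp S \<inter> perp T \<subseteq> perp (S \<oplus> T)"
  proof
    fix w assume "w \<in> perp S \<inter> perp T"
    then have "S \<oplus> T \<subseteq> {v. orth v w}"
      using V.ssum_least[OF subspace_left[of w], of S T] by (auto simp: perp_def)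
    then show "w \<in> perp (S \<oplus> T)"
      unfolding perp_def by blast
  qed
qed

lemma perp_Int:
  assumes S: "V.subspace S" and T: "V.subspace T"
  shows "perp (S \<inter> T) = perp S \<oplus> perp T"
proof -
  have "perp S \<oplus> perp T \<subseteq> perp (S \<inter> T)"
    using W.ssum_least[OF subspace_perp] perp_antimono by (metis Int_lower1 Int_lower2)
  moreover have "V.dim (S \<oplus> T) + V.dim (S \<inter> T) = V.dim S + V.dim T"
    using V.dim_ssum_Int[OF S T] .
  then have "W.dim (perp (S \<inter> T)) \<le> W.dim (perp S \<oplus> perp T)"
    using W.dim_ssum_Int[OF subspace_perp subspace_perp, of S T] perp_ssum[OF S T]
      dim_perp[OF S] dim_perp[OF T] dim_perp[of "S \<inter> T"] dim_perp[of "S \<oplus> T"] S T by simp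
  ultimately show ?thesis
    using W.dim_subset_eq[of "perp S \<oplus> perp T" "perp (S \<inter> T)"] subspace_perp by simp
qed

lemma perp_grassmannian: "S \<in> V.Gr j \<Longrightarrow> perp S \<in> W.Gr (n - j)"
  using dim_perp[of S] subspace_perp[of S] by (simp add: V.grassmannian_iff W.grassmannian_iff)

lemma coperp_grassmannian: "T \<in> W.Gr j \<Longrightarrow> coperp T \<in> V.Gr (n - j)"
  using dim_coperp[of T] subspace_coperp[of T] by (simp add: V.grassmannian_iff W.grassmannian_iff)

lemma bij_betw_perp:
  assumes "j \<le> n"
  shows "bij_betw perp (V.Gr j) (W.Gr (n - j))"
proof (rule bij_betw_byWitness[where f' = coperp])
  show "coperp ` W.Gr (n - j) \<subseteq> V.Gr j"
    using coperp_grassmannian[of _ "n - j"] assms by auto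
qed (use perp_grassmannian in \<open>auto simp: V.grassmannian_iff W.grassmannian_iff coperp_perp perp_coperp\<close>)

lemma adjacent_perp_iff:
  assumes S: "S \<in> V.Gr j" and T: "T \<in> V.Gr j"
  shows "W.subspace_adjacent (perp S) (perp T) \<longleftrightarrow> V.subspace_adjacent S T"
proof -
  have sub: "V.subspace S" "V.subspace T" "V.dim S = j"
    using S T by (simp_all add: V.grassmannian_iff)
  have "W.subspace_adjacent (perp S) (perp T) \<longleftrightarrow> Suc (W.dim (perp (S \<oplus> T))) = n - j"
    using W.adjacent_iff[OF perp_grassmannian[OF S] perp_grassmannian[OF T]] perp_ssum sub by simp
  also have "\<dots> \<longleftrightarrow> V.dim (S \<oplus> T) = Suc j"
    using dim_perp[of "S \<oplus> T"] dim_perp[of S] sub by auto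
  also have "\<dots> \<longleftrightarrow> V.subspace_adjacent S T"
    using V.adjacent_iff_ssum[OF S T] by simp
  finally show ?thesis .
qed

end

text \<open>A right vector space is a left vector space over the opposite ring.\<close>

datatype 'k opp = Opp (unopp: 'k)

lemma unopp_nonzero: "a \<noteq> Opp 0 \<Longrightarrow> unopp a \<noteq> 0"
  by (cases a) simp

instantiation opp :: (division_ring) division_ring
begin

definition "0 = Opp 0"
definition "1 = Opp 1"
definition "x + y = Opp (unopp x + unopp y)"
definition "x - y = Opp (unopp x - unopp y)"
definition "- x = Opp (- unopp x)"
definition "x * y = Opp (unopp y * unopp x)"
definition "inverse x = Opp (inverse (unopp x))"
definition "x div y = x * inverse (y :: 'a opp)"

instance
  by standard
    (auto simp: zero_opp_def one_opp_def plus_opp_def minus_opp_def uminus_opp_def times_opp_def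
      inverse_opp_def divide_opp_def opp.expand unopp_nonzero algebra_simps)

end

lemma unopp_simps [simp]:
  "unopp 0 = 0" "unopp 1 = 1" "unopp (x + y) = unopp x + unopp y" "unopp (x * y) = unopp y * unopp x"
  for x y :: "'k::division_ring opp"
  by (simp_all add: zero_opp_def one_opp_def plus_opp_def times_opp_def)

text \<open>With respect to a basis, the right vector space of functionals is the set of vectors with
  scalars acting on the coordinates from the right.\<close>

locale space_with_basis = finite_dim_space scale n
  for scale :: "'k::division_ring \<Rightarrow> 'v::ab_group_add \<Rightarrow> 'v" (infixr \<open>*s\<close> 75) and n +
  fixes B :: "'v set"
  assumes finite_B: "finite B" and independent_B: "independent B" and span_B: "span B = UNIV"
begin

definition comb :: "('v \<Rightarrow> 'k) \<Rightarrow> 'v" where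
  "comb r = (\<Sum>b\<in>B. r b *s b)"

definition coord :: "'v \<Rightarrow> 'v \<Rightarrow> 'k" where
  "coord v = (SOME r. v = comb r)"

lemma comb_coord: "comb (coord v) = v"
proof -
  have "\<exists>r. v = comb r"
    using span_B span_finite[OF finite_B] unfolding comb_def by auto
  from someI_ex[OF this] show ?thesis
    by (simp add: coord_def)
qed

lemma comb_diff: "comb r - comb q = comb (\<lambda>b. r b - q b)"
  by (simp add: comb_def scale_left_diff sum_subtractf)

lemma comb_eq: "comb r = comb q \<Longrightarrow> b \<in> B \<Longrightarrow> r b = q b"
  using independent_B finite_B comb_diff[of r q] unfolding independent_def comb_def by fastforce

lemma coord_comb: "b \<in> B \<Longrightarrow> coord (comb r) b = r b"
  using comb_eq comb_coord by blast

lemma eq_iff_coord: "v = w \<longleftrightarrow> (\<forall>b\<in>B. coord v b = coord w b)"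
proof
  assume "\<forall>b\<in>B. coord v b = coord w b"
  then have "comb (coord v) = comb (coord w)"
    by (simp add: comb_def)
  then show "v = w"
    by (simp add: comb_coord)
qed simp

lemma coord_add: "b \<in> B \<Longrightarrow> coord (v + w) b = coord v b + coord w b"
proof -
  have "v + w = comb (\<lambda>b. coord v b + coord w b)"
    by (subst (1 2) comb_coord[symmetric]) (simp add: comb_def scale_left_distrib sum.distrib)
  then show "b \<in> B \<Longrightarrow> coord (v + w) b = coord v b + coord w b"
    by (simp add: coord_comb)
qed

lemma coord_scale: "b \<in> B \<Longrightarrow> coord (a *s v) b = a * coord v b"
proof -
  have "a *s v = comb (\<lambda>b. a * coord v b)"
    by (subst comb_coord[symmetric]) (simp add: comb_def scale_right_sum scale_scale)
  then show "b \<in> B \<Longrightarrow> coord (a *s v) b = a * coord v b"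
    by (simp add: coord_comb)
qed

lemma comb_basis: "b \<in> B \<Longrightarrow> comb (\<lambda>b'. if b' = b then c else 0) = c *s b"
  using finite_B by (simp add: comb_def if_distrib[of "\<lambda>c. c *s _"] cong: if_cong)

lemma coord_basis: "b \<in> B \<Longrightarrow> b' \<in> B \<Longrightarrow> coord b b' = (if b' = b then 1 else 0)"
  using coord_comb[of b' "\<lambda>b'. if b' = b then 1 else 0"] comb_basis[of b 1] by (simp add: scale_one)

definition rscale :: "'k opp \<Rightarrow> 'v \<Rightarrow> 'v" where
  "rscale c w = comb (\<lambda>b. coord w b * unopp c)"

lemma coord_rscale: "b \<in> B \<Longrightarrow> coord (rscale c w) b = coord w b * unopp c"
  by (simp add: rscale_def coord_comb)

lemma rscale_basis: "b \<in> B \<Longrightarrow> rscale c b = unopp c *s b"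
  by (subst eq_iff_coord) (auto simp: coord_rscale coord_scale coord_basis)

sublocale R: left_vector_space rscale
  by unfold_locales (simp_all add: eq_iff_coord coord_rscale coord_add algebra_simps)

lemma R_rank_UNIV: "R.rank UNIV n"
proof -
  have sum: "(\<Sum>b\<in>T. rscale (r b) b) = (\<Sum>b\<in>T. unopp (r b) *s b)" if "T \<subseteq> B" for T r
    using that by (intro sum.cong) (auto simp: rscale_basis)
  have "R.independent B"
    unfolding R.independent_def
  proof (intro allI impI ballI)
    fix T u v assume T: "finite T \<and> T \<subseteq> B \<and> (\<Sum>v\<in>T. rscale (u v) v) = 0" and v: "v \<in> T"
    then have "(\<Sum>v\<in>T. unopp (u v) *s v) = 0"
      using sum[of T u] by simp
    then have "unopp (u v) = 0"
      using independent_B[unfolded independent_def, THEN spec[of _ T],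
          THEN spec[of _ "\<lambda>v. unopp (u v)"]] T v by simp
    then show "u v = 0"
      by (simp add: zero_opp_def opp.expand)
  qed
  moreover have "R.span B = UNIV"
  proof -
    have "v = (\<Sum>b\<in>B. rscale (Opp (coord v b)) b)" for v
      using comb_coord[of v] by (simp add: sum comb_def)
    then have "v \<in> R.span B" for v
      using R.span_mem[OF finite_B, of B "\<lambda>b. Opp (coord v b)"] by simp
    then show ?thesis
      by blast
  qed
  moreover have "card B = n"
    using rank_span[OF finite_B independent_B] span_B rank_UNIV rank_unique by simp
  ultimately show ?thesis
    using R.rank_span[OF finite_B] by simp
qed

definition pairing :: "'v \<Rightarrow> 'v \<Rightarrow> 'k" where
  "pairing v w = (\<Sum>b\<in>B. coord v b * coord w b)"

lemma pairing_add_left: "pairing (u + v) w = pairing u w + pairing v w"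
  by (simp add: pairing_def coord_add algebra_simps sum.distrib)

lemma pairing_add_right: "pairing u (v + w) = pairing u v + pairing u w"
  by (simp add: pairing_def coord_add algebra_simps sum.distrib)

lemma pairing_scale_left: "pairing (a *s v) w = a * pairing v w"
  by (simp add: pairing_def coord_scale sum_distrib_left mult.assoc)

lemma pairing_scale_right: "pairing v (rscale c w) = pairing v w * unopp c"
  by (simp add: pairing_def coord_rscale sum_distrib_right mult.assoc)

lemma pairing_diff_left: "pairing (u - v) w = pairing u w - pairing v w"
  using pairing_add_left[of "u - v" v w] by simp

lemma pairing_diff_right: "pairing u (v - w) = pairing u v - pairing u w"
  using pairing_add_right[of u "v - w" w] by simp

lemma pairing_zero: "pairing 0 w = 0" "pairing v 0 = 0"
  using pairing_diff_left[of 0 0] pairing_diff_right[of _ 0 0] by simp_all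

lemma pairing_basis:
  assumes "b \<in> B"
  shows "pairing b w = coord w b" "pairing v b = coord v b"
proof -
  have "pairing b w = (\<Sum>b'\<in>B. if b' = b then coord w b' else 0)"
    unfolding pairing_def using assms by (intro sum.cong) (auto simp: coord_basis)
  then show "pairing b w = coord w b"
    using assms finite_B by simp
  have "pairing v b = (\<Sum>b'\<in>B. if b' = b then coord v b' else 0)"
    unfolding pairing_def using assms by (intro sum.cong) (auto simp: coord_basis)
  then show "pairing v b = coord v b"
    using assms finite_B by simp
qed

lemma pairing_nondegenerate_right:
  assumes "\<And>v. pairing v w = pairing v w'"
  shows "w = w'"
  using assms by (subst eq_iff_coord) (metis pairing_basis(1))

lemma duality_pairing: "duality scale rscale n (\<lambda>v w. pairing v w = 0)"
proof
  show "R.rank UNIV n"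
    by (rule R_rank_UNIV)
  show "subspace {v. pairing v w = 0}" for w
    by (simp add: subspace_def pairing_zero pairing_add_left pairing_scale_left)
  show "R.subspace {w. pairing v w = 0}" for v
    by (simp add: R.subspace_def pairing_zero pairing_add_right pairing_scale_right)
  show "\<exists>c. pairing (y - c *s x) w = 0" if "pairing x w \<noteq> 0" for x y w
    using that by (intro exI[of _ "pairing y w * inverse (pairing x w)"])
      (simp add: pairing_diff_left pairing_scale_left mult.assoc)
  show "\<exists>c. pairing v (y - rscale c x) = 0" if "pairing v x \<noteq> 0" for v x y
    using that by (intro exI[of _ "Opp (inverse (pairing v x) * pairing v y)"])
      (simp add: pairing_diff_right pairing_scale_right flip: mult.assoc)
  show "v = 0" if "\<And>w. pairing v w = 0" for v
    using that by (subst eq_iff_coord) (metis pairing_basis(2) pairing_zero(1))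
  show "w = 0" if "\<And>v. pairing v w = 0" for w
    using that pairing_nondegenerate_right[of w 0] by (simp add: pairing_zero)
qed

text \<open>The coordinates of \<open>w\<close> are the values of the functional on the basis.\<close>

lemma ex_pairing_of_functional:
  assumes "\<psi> \<in> dual"
  shows "\<exists>w. \<psi> = (\<lambda>x. pairing x w)"
proof -
  have add: "\<psi> (u + v) = \<psi> u + \<psi> v" and hom: "\<psi> (a *s v) = a * \<psi> v" for u v a
    using assms by (simp_all add: dual_def)
  have "\<psi> 0 = 0"
    using add[of 0 0] by simp
  then have sum: "\<psi> (\<Sum>b\<in>B. r b *s b) = (\<Sum>b\<in>B. r b * \<psi> b)" for r
    by (induction B rule: infinite_finite_induct) (simp_all add: add hom)
  have "\<psi> x = pairing x (comb \<psi>)" for x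
  proof -
    have "\<psi> x = \<psi> (comb (coord x))"
      by (simp add: comb_coord)
    also have "\<dots> = pairing x (comb \<psi>)"
      unfolding comb_def[of "coord x"] sum by (simp add: pairing_def coord_comb)
    finally show ?thesis .
  qed
  then show ?thesis
    by blast
qed

end

section \<open>Pairs of maps preserving complementarity\<close>

context finite_dim_space
begin

lemma points_complementary_iff:
  assumes "n = 2" "P \<in> Gr 1" "Q \<in> Gr 1"
  shows "P \<oplus> Q = UNIV \<longleftrightarrow> P \<noteq> Q"
proof
  show "P \<noteq> Q" if "P \<oplus> Q = UNIV"
    using that assms dim_UNIV ssum_absorb[of P P] by (auto simp: grassmannian_iff)
  assume "P \<noteq> Q"
  then have "P \<inter> Q = {0}"
    using adjacent_of_Int[of P 1 Q "{0}"] assms subspace_0 dim_0 by (simp add: grassmannian_iff)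
  then show "P \<oplus> Q = UNIV"
    using complementary_iff[of P 1 Q] assms by simp
qed

text \<open>A subspace is determined by its complements, and the complements of \<open>b U\<close> are the images \<open>a S\<close> of
the complements \<open>S\<close> of \<open>U\<close>.\<close>

lemma second_map_determined:
  assumes m: "m \<le> n" and a: "bij_betw a (Gr k) (Gr m)"
    and b: "bij_betw b (Gr (n - k)) (Gr (n - m))"
    and ab: "\<And>S U. S \<in> Gr k \<Longrightarrow> U \<in> Gr (n - k) \<Longrightarrow>
      a S \<oplus> b U = UNIV \<longleftrightarrow> S \<oplus> U = UNIV"
    and U: "U \<in> Gr (n - k)" and X: "X \<in> Gr (n - m)"
    and compl: "\<And>S. S \<in> Gr k \<Longrightarrow> S \<oplus> U = UNIV \<Longrightarrow> a S \<oplus> X = UNIV"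
  shows "b U = X"
proof (rule complements_determine)
  show "b U \<in> Gr (n - m)"
    using b U bij_betwE by blast
  show "X \<oplus> Z = UNIV" if Z: "Z \<in> Gr (n - (n - m))" "b U \<oplus> Z = UNIV" for Z
  proof -
    have "Z \<in> a ` Gr k"
      using a Z(1) m by (simp add: bij_betw_def)
    then obtain S where "S \<in> Gr k" "Z = a S"
      by blast
    then show ?thesis
      using ab compl U Z(2) ssum_commute by metis
  qed
qed (use X in auto)

text \<open>A straight \<open>a\<close> is induced by a semilinear map of \<open>V\<close>.  A twisted \<open>a\<close> becomes straight when it is
followed by the duality, and a semilinear map \<open>l\<close> to the dual space, realised by coordinates, then
induces \<open>perp (a S) = l ` S\<close>; the functional \<open>s u\<close> is the pairing with \<open>l u\<close>.\<close>

theorem complementarity_preserving_pair: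
  assumes n: "3 \<le> n" and k: "1 \<le> k" "k < n" and m: "m = k \<or> m = n - k"
    and a: "bij_betw a (Gr k) (Gr m)"
    and b: "bij_betw b (Gr (n - k)) (Gr (n - m))"
    and ab: "\<And>S U. S \<in> Gr k \<Longrightarrow> U \<in> Gr (n - k) \<Longrightarrow>
      a S \<oplus> b U = UNIV \<longleftrightarrow> S \<oplus> U = UNIV"
  shows "(\<exists>l. semilinear_iso l \<and> m = k \<and> (\<forall>S \<in> Gr k. a S = G_map l S) \<and>
      (\<forall>U \<in> Gr (n - k). b U = G_map l U))
    \<or> (\<exists>s. semilinear_iso_dual s \<and> m = n - k \<and> (\<forall>S \<in> Gr k. a S = D_map s S) \<and>
      (\<forall>U \<in> Gr (n - k). b U = D_map s U))"
proof -
  have le: "k \<le> n" "m \<le> n"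
    using k m by auto
  note pencils = complementarity_preserves_pencils[OF le a b ab]
  interpret P: pencil_map scale scale n k m a
    by unfold_locales (use a pencils in blast)+
  have a_in: "a S \<in> Gr m" "subspace (a S)" if "S \<in> Gr k" for S
    using P.a_in[OF that] by (simp_all add: grassmannian_iff)
  note determined = second_map_determined[OF le(2) a b ab]
  consider "\<forall>S \<in> Gr k. \<forall>T \<in> Gr k. subspace_adjacent S T \<longrightarrow> P.straight k a S T"
    | "\<forall>S \<in> Gr k. \<forall>T \<in> Gr k. subspace_adjacent S T \<longrightarrow> P.twisted k a S T"
    using P.straight_or_twisted_everywhere[OF k _ m] n by auto
  then show ?thesis
  proof cases
    case 1
    then obtain l \<sigma> where l: "P.semilinear_bijection \<sigma> l" and mk: "m = k"
      and a_l: "\<forall>S \<in> Gr k. a S = l ` S"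
      using P.straight_semilinear[OF k n] by blast
    have "semilinear_iso l"
      using l by (auto simp: P.semilinear_bijection_def semilinear_iso_def ring_automorphism_def)
    moreover have "b U = l ` U" if U: "U \<in> Gr (n - k)" for U
    proof (rule determined[OF _ _ U])
      show "l ` U \<in> Gr (n - m)"
        using P.semilinear_image_grassmannian[OF l U] mk by simp
      show "a S \<oplus> l ` U = UNIV" if "S \<in> Gr k" "S \<oplus> U = UNIV" for S
        using P.additive_image_ssum[of l S U] l a_l that
        by (simp add: P.semilinear_bijection_def bij_is_surj)
    qed
    ultimately show ?thesis
      using mk a_l by (auto simp: G_map_def)
  next
    case 2
    obtain B where B: "finite B" "independent B" "span B = UNIV"
      using rank_basis[OF rank_UNIV] by blast
    interpret space_with_basis scale n B
      by unfold_locales (use B in auto)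
    interpret D: duality scale rscale n "\<lambda>v w. pairing v w = 0"
      by (rule duality_pairing)
    let ?a = "\<lambda>S. D.perp (a S)"
    have adj: "R.subspace_adjacent (?a S) (?a T) \<longleftrightarrow> subspace_adjacent S T"
      if "S \<in> Gr k" "T \<in> Gr k" for S T
      using D.adjacent_perp_iff[OF a_in(1)[OF that(1)] a_in(1)[OF that(2)]] pencils(1)[OF _ _ that]
      by simp
    have straight: "(S \<inter> T \<subseteq> R \<longleftrightarrow> ?a S \<inter> ?a T \<subseteq> ?a R) \<and> (R \<subseteq> S \<oplus> T \<longleftrightarrow> ?a R \<subseteq> ?a S \<oplus> ?a T)"
      if S: "S \<in> Gr k" and T: "T \<in> Gr k" and ST: "subspace_adjacent S T"
        and R: "R \<in> Gr k" for S T R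
    proof -
      have "S \<inter> T \<subseteq> R \<longleftrightarrow> a R \<subseteq> a S \<oplus> a T" "R \<subseteq> S \<oplus> T \<longleftrightarrow> a S \<inter> a T \<subseteq> a R"
        using 2 S T ST R by (simp_all add: P.twisted_def)
      then show ?thesis
        using a_in(2)[OF S] a_in(2)[OF T] a_in(2)[OF R]
        by (simp add: D.perp_le_iff flip: D.perp_ssum D.perp_Int)
    qed
    interpret Q: pencil_map scale rscale n k "n - m" ?a
    proof
      show "bij_betw ?a (Gr k) (R.Gr (n - m))"
        using bij_betw_trans[OF a D.bij_betw_perp[OF le(2)]] by (simp add: comp_def)
      show "?a S \<inter> ?a T \<subseteq> ?a R \<and> ?a R \<subseteq> ?a S \<oplus> ?a T \<longleftrightarrow> S \<inter> T \<subseteq> R \<and> R \<subseteq> S \<oplus> T"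
        if "S \<in> Gr k" "T \<in> Gr k" "R \<in> Gr k"
          "subspace_adjacent S T" for S T R
        using straight[OF that(1,2,4,3)] by argo
    qed (rule adj)
    have "D.straight k ?a S T"
      if "S \<in> Gr k" "T \<in> Gr k" "subspace_adjacent S T" for S T
      using straight[OF that] by (simp add: D.straight_def)
    from Q.straight_semilinear[OF k n this] obtain l \<sigma>
      where l: "D.semilinear_bijection \<sigma> l" and mk: "n - m = k"
      and a_l: "\<forall>S \<in> Gr k. ?a S = l ` S"
      by blast
    have l_props: "bij l" "\<And>u v. l (u + v) = l u + l v" "\<And>a v. l (a *s v) = rscale (\<sigma> a) (l v)"
      using l by (simp_all add: D.semilinear_bijection_def)
    define s where "s u = (\<lambda>x. pairing x (l u))" for u
    have "semilinear_iso_dual s"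
      unfolding semilinear_iso_dual_def
    proof (intro conjI exI allI)
      show "bij_betw s UNIV dual"
        unfolding bij_betw_def
      proof
        show "inj s"
        proof (rule injI)
          fix u v assume "s u = s v"
          then have "pairing x (l u) = pairing x (l v)" for x
            unfolding s_def by metis
          then have "l u = l v"
            by (rule pairing_nondegenerate_right)
          then show "u = v"
            using l_props(1) by (simp add: bij_is_inj inj_eq)
        qed
        show "range s = dual"
        proof
          show "range s \<subseteq> dual"
            by (auto simp: s_def dual_def pairing_add_left pairing_scale_left)
          show "dual \<subseteq> range s"
          proof
            fix \<psi> assume "\<psi> \<in> dual"
            then obtain w where w: "\<psi> = (\<lambda>x. pairing x w)"
              using ex_pairing_of_functional by blast
            moreover obtain u where "w = l u"
              using l_props(1) by (metis bij_pointE)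
            ultimately show "\<psi> \<in> range s"
              by (simp add: s_def)
          qed
        qed
      qed
      show "s (u + v) = (\<lambda>x. s u x + s v x)" for u v
        by (simp add: s_def l_props pairing_add_right)
      show "s (a *s v) = (\<lambda>x. s v x * unopp (\<sigma> a))" for a v
        by (simp add: s_def l_props pairing_scale_right)
      have "bij (unopp \<circ> \<sigma>)"
      proof (rule bij_comp)
        show "bij \<sigma>"
          using l by (simp add: D.semilinear_bijection_def)
        show "bij unopp"
          by (rule bijI') (auto simp: opp.expand intro: exI[of _ "Opp _"])
      qed
      then show "ring_anti_automorphism (\<lambda>a. unopp (\<sigma> a))"
        using l by (simp add: ring_anti_automorphism_def D.semilinear_bijection_def comp_def)
    qed
    moreover have D_map: "D_map s X = D.coperp (l ` X)" for X
      by (auto simp: D_map_def annihilator_def s_def D.coperp_def)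
    have a_D: "a S = D_map s S" if S: "S \<in> Gr k" for S
      using D.coperp_perp[OF a_in(2)[OF S]] a_l S by (simp add: D_map)
    moreover have "b U = D_map s U" if U: "U \<in> Gr (n - k)" for U
    proof (rule determined[OF _ _ U])
      have lU: "l ` U \<in> R.Gr (n - k)"
        using D.semilinear_image_grassmannian[OF l U] .
      show "D_map s U \<in> Gr (n - m)"
        using D.coperp_grassmannian[OF lU] mk k by (simp add: D_map)
      show "a S \<oplus> D_map s U = UNIV" if S: "S \<in> Gr k" and SU: "S \<oplus> U = UNIV" for S
      proof -
        have lS: "l ` S \<in> R.Gr k"
          using D.semilinear_image_grassmannian[OF l S] .
        have sub: "R.subspace (l ` S)" "R.subspace (l ` U)"
          using lS lU by (simp_all add: D.W.grassmannian_iff)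
        have "l ` S \<oplus> l ` U = UNIV"
          using D.additive_image_ssum[of l S U] l_props SU by (simp add: bij_is_surj)
        then have "l ` S \<inter> l ` U = {0}"
          using D.W.complementary_iff[OF lS lU le(1)] by simp
        moreover have "D.perp (D.coperp (l ` S) \<oplus> D.coperp (l ` U)) = l ` S \<inter> l ` U"
          using D.perp_ssum[OF D.subspace_coperp D.subspace_coperp] D.perp_coperp sub by simp
        ultimately have "R.dim (D.perp (D.coperp (l ` S) \<oplus> D.coperp (l ` U))) = 0"
          using D.W.dim_0 by simp
        then have "dim (D.coperp (l ` S) \<oplus> D.coperp (l ` U)) = n"
          using D.dim_perp[of "D.coperp (l ` S) \<oplus> D.coperp (l ` U)"] D.subspace_coperp by simp
        then have "D.coperp (l ` S) \<oplus> D.coperp (l ` U) = UNIV"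
          using dim_eq_n[of "D.coperp (l ` S) \<oplus> D.coperp (l ` U)"] D.subspace_coperp by simp
        then show ?thesis
          using a_D[OF S] by (simp add: D_map)
      qed
    qed
    moreover have "m = n - k"
      using mk le by simp
    ultimately show ?thesis
      by blast
  qed
qed

lemma complementary_pairs_eq:
  "complementary_pairs k = incidence_pairs (Gr k) (Gr (n - k)) (\<lambda>S U. S \<oplus> U = UNIV)"
  by (auto simp: complementary_pairs_def incidence_pairs_def ssum_def dim_UNIV)

lemma closeness_preserving_pair:
  assumes k: "1 \<le> k" "k < n"
    and f: "preserving_transformation close_pairs (complementary_pairs k) f"
  shows "(\<exists>a b. bij_betw a (Gr k) (Gr k) \<and>
      bij_betw b (Gr (n - k)) (Gr (n - k)) \<and>
      (\<forall>S \<in> Gr k. \<forall>U \<in> Gr (n - k). S \<oplus> U = UNIV \<longleftrightarrow> a S \<oplus> b U = UNIV) \<and>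
      (\<forall>(S, U) \<in> complementary_pairs k. f (S, U) = (a S, b U)))
    \<or> (\<exists>a b. bij_betw a (Gr k) (Gr (n - k)) \<and>
      bij_betw b (Gr (n - k)) (Gr k) \<and>
      (\<forall>S \<in> Gr k. \<forall>U \<in> Gr (n - k). S \<oplus> U = UNIV \<longleftrightarrow> a S \<oplus> b U = UNIV) \<and>
      (\<forall>(S, U) \<in> complementary_pairs k. f (S, U) = (b U, a S)))"
proof -
  let ?C = "\<lambda>S U. S \<oplus> U = (UNIV :: 'v set)"
  have "(\<exists>a b. bij_betw a (Gr k) (Gr k) \<and>
      bij_betw b (Gr (n - k)) (Gr (n - k)) \<and>
      (\<forall>S \<in> Gr k. \<forall>U \<in> Gr (n - k). ?C S U \<longleftrightarrow> ?C (a S) (b U)) \<and>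
      (\<forall>(S, U) \<in> incidence_pairs (Gr k) (Gr (n - k)) ?C. f (S, U) = (a S, b U)))
    \<or> (\<exists>a b. bij_betw a (Gr k) (Gr (n - k)) \<and>
      bij_betw b (Gr (n - k)) (Gr k) \<and>
      (\<forall>S \<in> Gr k. \<forall>U \<in> Gr (n - k). ?C S U \<longleftrightarrow> ?C (b U) (a S)) \<and>
      (\<forall>(S, U) \<in> incidence_pairs (Gr k) (Gr (n - k)) ?C. f (S, U) = (b U, a S)))"
  proof (rule closeness_preserving_splits)
    show "preserving_transformation close_pairs
        (incidence_pairs (Gr k) (Gr (n - k)) ?C) f"
      using f by (simp add: complementary_pairs_eq)
    show "\<exists>U\<in>Gr (n - k). ?C S U \<and> ?C T U"
      if "S \<in> Gr k" "T \<in> Gr k" for S T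
      using common_complement[OF that] k by simp
    show "\<exists>S\<in>Gr k. ?C S U \<and> ?C S W"
      if "U \<in> Gr (n - k)" "W \<in> Gr (n - k)" for U W
      using common_complement[OF that] k by (simp add: ssum_commute)
    show "\<exists>U\<in>Gr (n - k). \<not> ?C S U" if "S \<in> Gr k" for S
      using ex_not_complementary[of S "n - k"] that k by (simp add: ssum_commute)
    show "\<exists>S\<in>Gr k. \<not> ?C S U" if "U \<in> Gr (n - k)" for U
      using ex_not_complementary[of U k] that k by simp
  qed
  then show ?thesis
    by (simp add: complementary_pairs_eq ssum_commute)
qed

end

lemma preserving_transformationI:
  assumes bij: "bij_betw f A A" and R: "\<And>x y. x \<in> A \<Longrightarrow> y \<in> A \<Longrightarrow> R (f x) (f y) \<longleftrightarrow> R x y"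
  shows "preserving_transformation R A f"
  unfolding preserving_transformation_def
proof (intro conjI ballI impI)
  show "R (f x) (f y)" if "x \<in> A" "y \<in> A" "R x y" for x y
    using R that by blast
  show "R (inv_into A f x) (inv_into A f y)" if "x \<in> A" "y \<in> A" "R x y" for x y
  proof -
    have "f (inv_into A f x) = x" "f (inv_into A f y) = y"
      using bij that by (simp_all add: bij_betw_inv_into_right)
    moreover have "inv_into A f x \<in> A" "inv_into A f y \<in> A"
      using bij that by (simp_all add: bij_betw_def inv_into_into)
    ultimately show ?thesis
      using R that(3) by metis
  qed
qed (rule bij)

theorem theorem1:
  fixes scale :: "'k::division_ring \<Rightarrow> 'v::ab_group_add \<Rightarrow> 'v"
    and n k :: nat
    and \<G> :: "('v set \<times> 'v set) set"
    and f :: "'v set \<times> 'v set \<Rightarrow> 'v set \<times> 'v set"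
  assumes "left_vector_space scale"
    and "left_vector_space.dim scale UNIV = n"
    and "2 \<le> n"
    and "k \<in> {1..n - 1}"
    and "\<G> = left_vector_space.complementary_pairs scale k"
    and "preserving_transformation close_pairs \<G> f"
  shows "((\<exists>l. left_vector_space.semilinear_iso scale l \<and>
              is_restriction f \<G>
                (map_prod (G_map l) (G_map l)))
        \<or> (\<exists>s. left_vector_space.semilinear_iso_dual scale s \<and>
              is_restriction f \<G>
                (D_map s \<times>\<^sub>d D_map s))
        \<or> (n = 2 * k \<and>
            ((\<exists>l. left_vector_space.semilinear_iso scale l \<and>
                is_restriction f \<G>
                  (G_map l \<times>\<^sub>d G_map l))
            \<or> (\<exists>s. left_vector_space.semilinear_iso_dual scale s \<and>
                is_restriction f \<G>
                  (map_prod (D_map s) (D_map s)))))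
        \<or> (n = 2 \<and> k = 1 \<and>
            (\<exists>h. bij_betw h (left_vector_space.grassmannian scale 1)
                    (left_vector_space.grassmannian scale 1) \<and>
                (is_restriction f \<G> (map_prod h h) \<or> is_restriction f \<G> (h \<times>\<^sub>d h)))))
      \<and> preserving_transformation (left_vector_space.adjacent scale) \<G> f"
proof -
  interpret left_vector_space scale
    by (rule assms(1))
  interpret finite_dim_space scale n
    by unfold_locales (use rank_UNIV_of_dim assms(2,3) in auto)
  have k: "1 \<le> k" "k < n" "k \<le> n" "n - k \<le> n" "n - (n - k) = k"
    using assms(3,4) by auto
  have \<G>_mem: "S \<in> Gr k \<and> U \<in> Gr (n - k)" if "(S, U) \<in> \<G>" for S U
    using that assms(5) by (simp add: complementary_pairs_eq)
  have bij: "bij_betw f \<G> \<G>"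
    using assms(6) by (simp add: preserving_transformation_def)
  consider (direct) a b where "bij_betw a (Gr k) (Gr k)"
      "bij_betw b (Gr (n - k)) (Gr (n - k))"
      "\<forall>S \<in> Gr k. \<forall>U \<in> Gr (n - k). S \<oplus> U = UNIV \<longleftrightarrow> a S \<oplus> b U = UNIV"
      "\<forall>(S, U) \<in> \<G>. f (S, U) = (a S, b U)"
    | (crossed) a b where "bij_betw a (Gr k) (Gr (n - k))"
      "bij_betw b (Gr (n - k)) (Gr k)"
      "\<forall>S \<in> Gr k. \<forall>U \<in> Gr (n - k). S \<oplus> U = UNIV \<longleftrightarrow> a S \<oplus> b U = UNIV"
      "\<forall>(S, U) \<in> \<G>. f (S, U) = (b U, a S)"
    using closeness_preserving_pair[OF k(1,2), of f] assms(5,6) by blast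
  then show ?thesis
  proof cases
    case direct
    note ab = direct(3)[rule_format, symmetric]
    have ba: "b U \<oplus> a S = UNIV \<longleftrightarrow> U \<oplus> S = UNIV"
      if "U \<in> Gr (n - k)" "S \<in> Gr (n - (n - k))" for U S
      using ab[of S U] that k by (simp add: ssum_commute)
    have adj_a: "subspace_adjacent (a S) (a T) \<longleftrightarrow> subspace_adjacent S T"
      if "S \<in> Gr k" "T \<in> Gr k" for S T
      using complementarity_preserves_pencils(1)[OF k(3,3) direct(1,2) ab that] by simp
    have adj_b: "subspace_adjacent (b U) (b W) \<longleftrightarrow> subspace_adjacent U W"
      if "U \<in> Gr (n - k)" "W \<in> Gr (n - k)" for U W
      using complementarity_preserves_pencils(1)[of "n - k" "n - k" b a U W] direct(1,2) ba that k
      by simp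
    have eqs: "a S = a T \<longleftrightarrow> S = T" "b U = b W \<longleftrightarrow> U = W"
      if "S \<in> Gr k" "T \<in> Gr k" "U \<in> Gr (n - k)"
        "W \<in> Gr (n - k)" for S T U W
      using direct(1,2) that by (auto simp: bij_betw_def inj_on_def)
    have "adjacent (f p) (f q) \<longleftrightarrow> adjacent p q" if pq: "p \<in> \<G>" "q \<in> \<G>" for p q
    proof -
      obtain S U T W where p: "p = (S, U)" and q: "q = (T, W)"
        by (cases p, cases q) auto
      have mem: "S \<in> Gr k" "T \<in> Gr k" "U \<in> Gr (n - k)"
        "W \<in> Gr (n - k)"
        using pq \<G>_mem[of S U] \<G>_mem[of T W] by (simp_all add: p q)
      have "f p = (a S, b U)" "f q = (a T, b W)"
        using bspec[OF direct(4) pq(1)] bspec[OF direct(4) pq(2)] by (simp_all add: p q)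
      then show ?thesis
        using adj_a[OF mem(1,2)] adj_b[OF mem(3,4)] eqs[OF mem] by (auto simp: p q adjacent_def)
    qed
    then have adj: "preserving_transformation adjacent \<G> f"
      using bij by (intro preserving_transformationI)
    show ?thesis
    proof (cases "n = 2")
      case True
      then have k1: "k = 1" "n - k = 1"
        using k by auto
      have "b U = a U" if U: "U \<in> Gr 1" for U
      proof (rule second_map_determined[OF k(3) direct(1,2) ab])
        show "a U \<in> Gr (n - k)"
          using direct(1) U k1 by (auto dest: bij_betwE)
        show "a S \<oplus> a U = UNIV" if S: "S \<in> Gr k" "S \<oplus> U = UNIV" for S
        proof -
          have "S \<noteq> U"
            using points_complementary_iff[OF True, of S U] S U k1 by simp
          moreover have "inj_on a (Gr 1)" "a S \<in> Gr 1" "a U \<in> Gr 1"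
            using direct(1) S U k1 by (auto simp: bij_betw_def)
          ultimately have "a S \<noteq> a U"
            using S U k1 by (metis inj_on_eq_iff)
          then show ?thesis
            using points_complementary_iff[OF True \<open>a S \<in> Gr 1\<close> \<open>a U \<in> Gr 1\<close>]
            by simp
        qed
      qed (use U k1 in auto)
      then have "is_restriction f \<G> (map_prod a a)"
        using direct(4) \<G>_mem k1 by (auto simp: is_restriction_def)
      then show ?thesis
        using True k1 direct(1) adj by auto
    next
      case False
      then have "3 \<le> n"
        using assms(3) by simp
      then consider l where "semilinear_iso l"
          "\<forall>S \<in> Gr k. a S = G_map l S" "\<forall>U \<in> Gr (n - k). b U = G_map l U"
        | s where "semilinear_iso_dual s" "n = 2 * k"
          "\<forall>S \<in> Gr k. a S = D_map s S" "\<forall>U \<in> Gr (n - k). b U = D_map s U"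
        using complementarity_preserving_pair[OF _ k(1,2) _ direct(1) direct(2) ab] k by auto
      then show ?thesis
      proof cases
        case 1
        have "is_restriction f \<G> (map_prod (G_map l) (G_map l))"
          unfolding is_restriction_def
        proof
          fix p assume p: "p \<in> \<G>"
          then show "f p = (map_prod (G_map l) (G_map l)) p"
            using bspec[OF direct(4) p] \<G>_mem[of "fst p" "snd p"] 1(2,3)
            by (simp add: map_prod_def split_beta)
        qed
        then show ?thesis
          using 1(1) adj by auto
      next
        case 2
        have "is_restriction f \<G> (map_prod (D_map s) (D_map s))"
          unfolding is_restriction_def
        proof
          fix p assume p: "p \<in> \<G>"
          then show "f p = (map_prod (D_map s) (D_map s)) p"
            using bspec[OF direct(4) p] \<G>_mem[of "fst p" "snd p"] 2(3,4)
            by (simp add: map_prod_def split_beta)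
        qed
        then show ?thesis
          using 2(1,2) adj by auto
      qed
    qed
  next
    case crossed
    note ab = crossed(3)[rule_format, symmetric]
    have b: "bij_betw b (Gr (n - k)) (Gr (n - (n - k)))"
      using crossed(2) k by simp
    have ba: "b U \<oplus> a S = UNIV \<longleftrightarrow> U \<oplus> S = UNIV"
      if "U \<in> Gr (n - k)" "S \<in> Gr (n - (n - k))" for U S
      using ab[of S U] that k by (simp add: ssum_commute)
    have adj_a: "subspace_adjacent (a S) (a T) \<longleftrightarrow> subspace_adjacent S T"
      if "S \<in> Gr k" "T \<in> Gr k" for S T
      using complementarity_preserves_pencils(1)[OF k(3,4) crossed(1) b ab that] by simp
    have adj_b: "subspace_adjacent (b U) (b W) \<longleftrightarrow> subspace_adjacent U W"
      if "U \<in> Gr (n - k)" "W \<in> Gr (n - k)" for U W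
      using complementarity_preserves_pencils(1)[of "n - k" k b a U W] crossed(1,2) ba that k
      by simp
    have eqs: "a S = a T \<longleftrightarrow> S = T" "b U = b W \<longleftrightarrow> U = W"
      if "S \<in> Gr k" "T \<in> Gr k" "U \<in> Gr (n - k)"
        "W \<in> Gr (n - k)" for S T U W
      using crossed(1,2) that by (auto simp: bij_betw_def inj_on_def)
    have "adjacent (f p) (f q) \<longleftrightarrow> adjacent p q" if pq: "p \<in> \<G>" "q \<in> \<G>" for p q
    proof -
      obtain S U T W where p: "p = (S, U)" and q: "q = (T, W)"
        by (cases p, cases q) auto
      have mem: "S \<in> Gr k" "T \<in> Gr k" "U \<in> Gr (n - k)"
        "W \<in> Gr (n - k)"
        using pq \<G>_mem[of S U] \<G>_mem[of T W] by (simp_all add: p q)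
      have "f p = (b U, a S)" "f q = (b W, a T)"
        using bspec[OF crossed(4) pq(1)] bspec[OF crossed(4) pq(2)] by (simp_all add: p q)
      then show ?thesis
        using adj_a[OF mem(1,2)] adj_b[OF mem(3,4)] eqs[OF mem] by (auto simp: p q adjacent_def)
    qed
    then have adj: "preserving_transformation adjacent \<G> f"
      using bij by (intro preserving_transformationI)
    show ?thesis
    proof (cases "n = 2")
      case True
      then have k1: "k = 1" "n - k = 1"
        using k by auto
      have "b U = a U" if U: "U \<in> Gr 1" for U
      proof (rule second_map_determined[OF k(4) crossed(1) b ab])
        show "a U \<in> Gr (n - (n - k))"
          using crossed(1) U k1 by (auto dest: bij_betwE)
        show "a S \<oplus> a U = UNIV" if S: "S \<in> Gr k" "S \<oplus> U = UNIV" for S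
        proof -
          have "S \<noteq> U"
            using points_complementary_iff[OF True, of S U] S U k1 by simp
          moreover have "inj_on a (Gr 1)" "a S \<in> Gr 1" "a U \<in> Gr 1"
            using crossed(1) S U k1 by (auto simp: bij_betw_def)
          ultimately have "a S \<noteq> a U"
            using S U k1 by (metis inj_on_eq_iff)
          then show ?thesis
            using points_complementary_iff[OF True \<open>a S \<in> Gr 1\<close> \<open>a U \<in> Gr 1\<close>]
            by simp
        qed
      qed (use U k1 in auto)
      then have "is_restriction f \<G> (a \<times>\<^sub>d a)"
        using crossed(4) \<G>_mem k1 by (auto simp: is_restriction_def cross_prod_def)
      then show ?thesis
        using True k1 crossed(1) adj by auto
    next
      case False
      then have "3 \<le> n"
        using assms(3) by simp
      then consider l where "semilinear_iso l" "n = 2 * k"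
          "\<forall>S \<in> Gr k. a S = G_map l S" "\<forall>U \<in> Gr (n - k). b U = G_map l U"
        | s where "semilinear_iso_dual s"
          "\<forall>S \<in> Gr k. a S = D_map s S" "\<forall>U \<in> Gr (n - k). b U = D_map s U"
        using complementarity_preserving_pair[OF _ k(1,2) _ crossed(1) b ab] k by auto
      then show ?thesis
      proof cases
        case 1
        have "is_restriction f \<G> (G_map l \<times>\<^sub>d G_map l)"
          unfolding is_restriction_def
        proof
          fix p assume p: "p \<in> \<G>"
          then show "f p = (G_map l \<times>\<^sub>d G_map l) p"
            using bspec[OF crossed(4) p] \<G>_mem[of "fst p" "snd p"] 1(3,4)
            by (simp add: cross_prod_def split_beta)
        qed
        then show ?thesis
          using 1(1,2) adj by auto
      next
        case 2
        have "is_restriction f \<G> (D_map s \<times>\<^sub>d D_map s)"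
          unfolding is_restriction_def
        proof
          fix p assume p: "p \<in> \<G>"
          then show "f p = (D_map s \<times>\<^sub>d D_map s) p"
            using bspec[OF crossed(4) p] \<G>_mem[of "fst p" "snd p"] 2(2,3)
            by (simp add: cross_prod_def split_beta)
        qed
        then show ?thesis
          using 2(1) adj by auto
      qed
    qed
  qed
qed

end
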